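(* Let $f$ be an even, real-valued Schwartz function on $\mathbb{R}$, with Fourier transform $\hat f(t)=\int_{-\infty}^{\infty} f(x)e^{-2\pi i x t}\,dx$. For $N\ge 1$ put $F_N(\theta)=\sum_{j=-\infty}^{\infty} f\!\left(\frac{N}{2\pi}(\theta+2\pi j)\right)$, and for an $N\times N$ unitary matrix $U$ with eigenvalues $e^{i\theta_1},\dots,e^{i\theta_N}$ put $Z_f(U)=\sum_{n=1}^N F_N(\theta_n)$. Let $m\ge 1$ be an integer. (i) If $\operatorname{supp}\hat f\subseteq[-1/m,1/m]$, then as $N\to\infty$ through even integers, the first $m$ moments of $Z_f(U)$, where $U$ is distributed according to Haar probability measure on the symplectic group $\mathrm{Sp}(N)$, converge to the corresponding moments of a Gaussian random variable with mean $\hat f(0)-\int_0^1\hat f(u)\,du$ and variance $2\int_{-1/2}^{1/2}|u|\,\hat f(u)^2\,du$. (ii) If $\operatorname{supp}\hat f\subseteq(-1/m,1/m)$, then as $N\to\infty$, the first $m$ moments of $Z_f(U)$, where $U$ is distributed according to Haar probability measure on the special orthogonal group $\mathrm{SO}(N)$, converge to the corresponding moments of a Gaussian random variable with mean $\hat f(0)+\int_0^1\hat f(u)\,du$ and variance $2\int_{-1/2}^{1/2}|u|\,\hat f(u)^2\,du$.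
   Context: $\mathrm{Sp}(N)$ ($N$ even) denotes the group of $N\times N$ unitary symplectic matrices and $\mathrm{SO}(N)$ the group of $N\times N$ real orthogonal matrices of determinant $1$; both are equipped with normalized Haar measure. Eigenvalues are counted with multiplicity. *)

theory Defs
  imports "HOL-Probability.Probability" "HOL-Computational_Algebra.Polynomial"
          "HOL-Combinatorics.Permutations"
begin

definition schwartz :: "(real \<Rightarrow> real) \<Rightarrow> bool" where
  "schwartz f \<longleftrightarrow>
     (\<forall>n x. ((deriv ^^ n) f) differentiable (at x)) \<and>
     (\<forall>k n. bounded (range (\<lambda>x. x ^ k * (deriv ^^ n) f x)))"

definition fourier :: "(real \<Rightarrow> real) \<Rightarrow> real \<Rightarrow> complex" where
  "fourier f t = (\<integral>x. complex_of_real (f x) * exp (- (2 * of_real pi * \<i> * of_real x * of_real t)) \<partial>lborel)"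

definition fsupp :: "(real \<Rightarrow> complex) \<Rightarrow> real set" where
  "fsupp g = closure {t. g t \<noteq> 0}"

section \<open>N x N matrices as extensional functions on {..<N} x {..<N}\<close>

type_synonym cmat = "nat \<times> nat \<Rightarrow> complex"

definition idx :: "nat \<Rightarrow> (nat \<times> nat) set" where
  "idx N = {..<N} \<times> {..<N}"

definition mat_space :: "nat \<Rightarrow> cmat measure" where
  "mat_space N = PiM (idx N) (\<lambda>_. borel)"

definition mmul :: "nat \<Rightarrow> cmat \<Rightarrow> cmat \<Rightarrow> cmat" where
  "mmul N A B = restrict (\<lambda>(i,j). \<Sum>k<N. A (i,k) * B (k,j)) (idx N)"

definition mid :: "nat \<Rightarrow> cmat" where
  "mid N = restrict (\<lambda>(i,j). if i = j then 1 else 0) (idx N)"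

definition mtrans :: "nat \<Rightarrow> cmat \<Rightarrow> cmat" where
  "mtrans N A = restrict (\<lambda>(i,j). A (j,i)) (idx N)"

definition madj :: "nat \<Rightarrow> cmat \<Rightarrow> cmat" where
  "madj N A = restrict (\<lambda>(i,j). cnj (A (j,i))) (idx N)"

definition mdet :: "nat \<Rightarrow> (nat \<times> nat \<Rightarrow> 'a::comm_ring_1) \<Rightarrow> 'a" where
  "mdet N A = (\<Sum>p | p permutes {..<N}. of_int (sign p) * (\<Prod>i<N. A (i, p i)))"

definition charpoly :: "nat \<Rightarrow> cmat \<Rightarrow> complex poly" where
  "charpoly N U = mdet N (\<lambda>(i,j). (if i = j then [:0, 1:] else 0) - [:U (i,j):])"

text \<open>Symplectic form J = [[0, I_n], [-I_n, 0]] of size 2n.\<close>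
definition symJ :: "nat \<Rightarrow> cmat" where
  "symJ n = restrict (\<lambda>(i,j). if i < n \<and> j = i + n then 1
                             else if n \<le> i \<and> j + n = i then -1 else 0) (idx (2*n))"

definition Sp :: "nat \<Rightarrow> cmat set" where
  "Sp n = {U \<in> space (mat_space (2*n)).
             mmul (2*n) (madj (2*n) U) U = mid (2*n) \<and>
             mmul (2*n) (mtrans (2*n) U) (mmul (2*n) (symJ n) U) = symJ n}"

definition SO :: "nat \<Rightarrow> cmat set" where
  "SO N = {U \<in> space (mat_space N).
             (\<forall>ij\<in>idx N. Im (U ij) = 0) \<and>
             mmul N (mtrans N U) U = mid N \<and> mdet N U = 1}"

definition is_haar :: "nat \<Rightarrow> cmat set \<Rightarrow> cmat measure \<Rightarrow> bool" where
  "is_haar N G M \<longleftrightarrow>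
     sets M = sets (mat_space N) \<and> prob_space M \<and> G \<in> sets M \<and> emeasure M G = 1 \<and>
     (\<forall>g\<in>G. \<forall>A\<in>sets M. A \<subseteq> G \<longrightarrow> emeasure M (mmul N g ` A) = emeasure M A)"

definition FN :: "(real \<Rightarrow> real) \<Rightarrow> nat \<Rightarrow> real \<Rightarrow> real" where
  "FN f N \<theta> = (\<Sum>\<^sub>\<infinity>j\<in>(UNIV :: int set). f (real N / (2 * pi) * (\<theta> + 2 * pi * of_int j)))"

definition Zf :: "(real \<Rightarrow> real) \<Rightarrow> nat \<Rightarrow> cmat \<Rightarrow> real" where
  "Zf f N U = (\<Sum>z \<in> {z. poly (charpoly N U) z = 0}.
                  real (order z (charpoly N U)) * FN f N (Arg z))"

text \<open>k-th moment of a Gaussian with mean mu and variance v (v = 0 allowed).\<close>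
definition gauss_moment :: "real \<Rightarrow> real \<Rightarrow> nat \<Rightarrow> real" where
  "gauss_moment mu v k = (\<integral>x. (mu + sqrt v * x) ^ k * std_normal_density x \<partial>lborel)"

end

theory Submission
  imports Defs "Jordan_Normal_Form.Schur_Decomposition"
begin

text \<open>By Poisson summation \<open>Z\<^sub>f(U) = F(0) + (2/N) \<Sum>\<^sub>k\<^sub>\<ge>\<^sub>1 F(k/N) tr U\<^sup>k\<close>, where \<open>F\<close> is the
  Fourier transform of \<open>f\<close>. Only \<open>k < N/m\<close>
  contribute to the sum, so the first \<open>m\<close> moments involve products of traces of total degree less than \<open>N\<close>.
  Invariance of Haar measure under one-parameter subgroups gives loop equations for the expectations
  of such products. Independent Gaussians of mean \<open>\<plusminus>[k even]\<close> and variance \<open>k\<close> in place of the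
  \<open>tr U\<^sup>k\<close> satisfy the same equations for every \<open>N\<close>, and by a maximum principle the equations have
  only one solution in degrees less than \<open>N\<close>. Hence the first \<open>m\<close> moments are exactly those of a
  Gaussian for each \<open>N\<close>, and its mean and variance are Riemann sums of the limiting ones.\<close>

section \<open>Moments of a Gaussian variable\<close>

text \<open>In degree n the terms of top degree have total weight n - 1 against the coefficient N -
  \<epsilon> of the leading term, so the maximum principle asks for n - 1 < N - \<epsilon>. For
  \<epsilon> = 1 this is exactly n < N. The borderline index j = N/m does no harm: the transform is
  continuous, hence zero at the ends of its support interval.

  The loop equations come from derivatives along elementary matrices minus their adjoints, which
  need not lie in the real Lie algebra. That a mean derivative vanishes is a complex-linear
  condition on the direction, so a spanning family suffices; it is chosen with X^3 = -X, where the
  exponential is an explicit trigonometric formula. One sign \<epsilon>, with J^T = \<epsilon> J for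
  the preserved form, treats both groups at once.

  \<open>Zf\<close> is defined on all matrices through roots and their arguments, so its
  measurability off the group needs an argument of its own. For m = 1 the variance integral over
  [-1/2, 1/2] may cut off part of the support, but then only the first moment is claimed, and it
  does not see the variance.\<close>

lemma std_normal_moment_Suc_Suc:
  "(\<integral>x. std_normal_density x * x ^ Suc (Suc n) \<partial>lborel) =
   real (Suc n) * (\<integral>x. std_normal_density x * x ^ n \<partial>lborel)"
proof (cases "even n")
  case True
  then obtain k where n: "n = 2 * k" by (auto elim: evenE)
  define F G :: real where "F = fact (2 * k)" and "G = 2 ^ k * fact k"
  have "G \<noteq> 0" by (simp add: G_def)
  have 1: "fact (2 * Suc k) = (2 * real k + 1) * ((2 * real k + 2) * F)"
    by (simp add: F_def algebra_simps)
  have 2: "2 ^ Suc k * fact (Suc k) = (2 * real k + 2) * G"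
    by (simp add: G_def algebra_simps)
  have "(\<integral>x. std_normal_density x * x ^ Suc (Suc n) \<partial>lborel) =
      fact (2 * Suc k) / (2 ^ Suc k * fact (Suc k))"
    using integral_std_normal_moment_even[of "Suc k"] by (simp add: n)
  also have "\<dots> = (2 * real k + 1) * (F / G)"
    unfolding 1 2 using \<open>G \<noteq> 0\<close> by (simp add: divide_simps)
  also have "F / G = (\<integral>x. std_normal_density x * x ^ n \<partial>lborel)"
    unfolding n F_def G_def by (rule integral_std_normal_moment_even[symmetric])
  finally show ?thesis by (simp add: n)
next
  case False
  then obtain k where n: "n = 2 * k + 1" by (auto elim: oddE)
  have "Suc (Suc n) = 2 * Suc k + 1" by (simp add: n)
  then show ?thesis
    unfolding n by (simp only: integral_std_normal_moment_odd mult_zero_right)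
qed

lemma std_normal_moment_Suc:
  "(\<integral>x. std_normal_density x * x ^ Suc n \<partial>lborel) =
   real n * (\<integral>x. std_normal_density x * x ^ (n - 1) \<partial>lborel)"
proof (cases n)
  case 0
  then show ?thesis using integral_std_normal_moment_odd[of 0] by simp
next
  case (Suc j)
  then show ?thesis using std_normal_moment_Suc_Suc[of j] by simp
qed

text \<open>The extra factor \<open>x ^ j\<close> lets Stein's identity E[x g(x)] = E[g'(x)] for
  these integrands be proved by induction on k, starting from the moments of the standard normal
  law.\<close>

definition mixed_moment :: "real \<Rightarrow> real \<Rightarrow> nat \<Rightarrow> nat \<Rightarrow> real" where
  "mixed_moment \<mu> s j k = (\<integral>x. std_normal_density x * (x ^ j * (\<mu> + s * x) ^ k) \<partial>lborel)"

lemma integrable_mixed_moment: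
  "integrable lborel (\<lambda>x. std_normal_density x * (x ^ j * (\<mu> + s * x) ^ k))"
proof (induction k arbitrary: j)
  case 0
  then show ?case by (simp add: integrable_std_normal_moment)
next
  case (Suc k)
  have *: "std_normal_density x * (x ^ j * (\<mu> + s * x) ^ Suc k) =
      \<mu> * (std_normal_density x * (x ^ j * (\<mu> + s * x) ^ k))
    + s * (std_normal_density x * (x ^ Suc j * (\<mu> + s * x) ^ k))" for x
    by (simp only: power_Suc algebra_simps)
  show ?case
    unfolding * by (intro Bochner_Integration.integrable_add integrable_mult_right Suc.IH)
qed

lemma mixed_moment_Suc:
  "mixed_moment \<mu> s j (Suc k) = \<mu> * mixed_moment \<mu> s j k + s * mixed_moment \<mu> s (Suc j) k"
proof -
  have *: "std_normal_density x * (x ^ j * (\<mu> + s * x) ^ Suc k) =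
      \<mu> * (std_normal_density x * (x ^ j * (\<mu> + s * x) ^ k))
    + s * (std_normal_density x * (x ^ Suc j * (\<mu> + s * x) ^ k))" for x
    by (simp only: power_Suc algebra_simps)
  show ?thesis unfolding mixed_moment_def *
    by (subst Bochner_Integration.integral_add;
        (intro integrable_mult_right integrable_mixed_moment)?; simp only: integral_mult_right_zero)
qed

lemma mixed_moment_stein:
  "mixed_moment \<mu> s (Suc j) k =
   real j * mixed_moment \<mu> s (j - 1) k + real k * s * mixed_moment \<mu> s j (k - 1)"
proof (induction k arbitrary: j)
  case 0
  then show ?case using std_normal_moment_Suc[of j] by (simp add: mixed_moment_def)
next
  case (Suc k)
  \<comment> \<open>At j = 0 and k = 0 the truncated predecessors are multiplied by 0, so both
    expansions hold there too.\<close>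
  have 1: "real j * mixed_moment \<mu> s (j - 1) (Suc k) =
      real j * (\<mu> * mixed_moment \<mu> s (j - 1) k + s * mixed_moment \<mu> s j k)"
    by (cases j) (simp_all add: mixed_moment_Suc)
  have 2: "real k * mixed_moment \<mu> s j k =
      real k * (\<mu> * mixed_moment \<mu> s j (k - 1) + s * mixed_moment \<mu> s (Suc j) (k - 1))"
    by (cases k) (simp_all add: mixed_moment_Suc)
  have "mixed_moment \<mu> s (Suc j) (Suc k) =
     real j * (\<mu> * mixed_moment \<mu> s (j - 1) k + s * mixed_moment \<mu> s j k)
     + s * (real k * (\<mu> * mixed_moment \<mu> s j (k - 1) + s * mixed_moment \<mu> s (Suc j) (k - 1)))
     + s * mixed_moment \<mu> s j k"
    by (simp add: mixed_moment_Suc[of _ _ "Suc j"] Suc.IH algebra_simps)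
  also have "\<dots> = real j * mixed_moment \<mu> s (j - 1) (Suc k)
      + real (Suc k) * s * mixed_moment \<mu> s j (Suc k - 1)"
    unfolding 1[symmetric] 2[symmetric] by (simp add: algebra_simps)
  finally show ?case .
qed

lemma gauss_moment_0 [simp]: "gauss_moment \<mu> v 0 = 1"
  using integral_std_normal_moment_even[of 0] by (simp add: gauss_moment_def)

lemma gauss_moment_Suc:
  assumes "v \<ge> 0"
  shows "gauss_moment \<mu> v (Suc k) =
         \<mu> * gauss_moment \<mu> v k + real k * v * gauss_moment \<mu> v (k - 1)"
proof -
  have *: "gauss_moment \<mu> v n = mixed_moment \<mu> (sqrt v) 0 n" for n
    by (simp add: gauss_moment_def mixed_moment_def mult.commute)
  show ?thesis
    unfolding * mixed_moment_Suc mixed_moment_stein[of _ _ 0 k] using assms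
    by (simp add: algebra_simps flip: real_sqrt_mult)
qed

text \<open>Stated for every v, of either sign: in the limit the first moment is compared without
  any information on the variance.\<close>

lemma gauss_moment_1 [simp]: "gauss_moment \<mu> v (Suc 0) = \<mu>"
proof -
  have "gauss_moment \<mu> v (Suc 0) = mixed_moment \<mu> (sqrt v) 0 (Suc 0)"
    by (simp add: gauss_moment_def mixed_moment_def mult.commute)
  also have "\<dots> = \<mu> * gauss_moment \<mu> v 0"
    unfolding mixed_moment_Suc mixed_moment_stein[of _ _ 0 0]
    by (simp add: gauss_moment_def mixed_moment_def)
  finally show ?thesis by simp
qed

text \<open>By the recursion every moment is a polynomial in mean and variance, so it is enough that
  these two converge.\<close>

lemma tendsto_gauss_moment:
  assumes "a \<longlonglongrightarrow> \<mu>" "b \<longlonglongrightarrow> v" "\<And>n. b n \<ge> 0" "v \<ge> 0"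
  shows "(\<lambda>n. gauss_moment (a n) (b n) k) \<longlonglongrightarrow> gauss_moment \<mu> v k"
proof (induction k rule: less_induct)
  case (less k)
  show ?case
  proof (cases k)
    case (Suc j)
    show ?thesis
      unfolding Suc gauss_moment_Suc[OF assms(3)] gauss_moment_Suc[OF assms(4)]
      by (intro tendsto_intros assms less.IH) (use Suc in auto)
  qed simp
qed

section \<open>Joint moments of independent Gaussians\<close>

text \<open>Joint moments of independent Gaussians of mean \<open>\<epsilon>[j even]\<close> and variance \<open>j\<close>, indexed by
  \<open>j \<ge> 1\<close>. The index \<open>0\<close> stands for the constant \<open>tr U\<^sup>0 = c\<close>.\<close>

definition gm :: "real \<Rightarrow> real \<Rightarrow> nat \<Rightarrow> nat \<Rightarrow> real" where
  "gm \<epsilon> c j a = (if j = 0 then c ^ a else gauss_moment (\<epsilon> * of_bool (even j)) (real j) a)"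

definition joint :: "real \<Rightarrow> real \<Rightarrow> nat multiset \<Rightarrow> real" where
  "joint \<epsilon> c P = (\<Prod>j\<in>set_mset P. gm \<epsilon> c j (count P j))"

lemma gm_0 [simp]: "gm \<epsilon> c j 0 = 1"
  by (simp add: gm_def)

lemma joint_superset:
  assumes "finite A" "set_mset P \<subseteq> A"
  shows "joint \<epsilon> c P = (\<Prod>j\<in>A. gm \<epsilon> c j (count P j))"
  unfolding joint_def
  by (rule prod.mono_neutral_left) (use assms in \<open>auto simp: not_in_iff\<close>)

lemma joint_remove:
  assumes "finite A" "set_mset P \<subseteq> A" "k \<in> A"
  shows "joint \<epsilon> c P = gm \<epsilon> c k (count P k) * (\<Prod>j\<in>A - {k}. gm \<epsilon> c j (count P j))"
  using assms by (simp add: joint_superset prod.remove)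

lemma joint_empty [simp]: "joint \<epsilon> c {#} = 1"
  by (simp add: joint_def)

lemma joint_add_0: "joint \<epsilon> c (add_mset 0 P) = c * joint \<epsilon> c P"
proof -
  have "(\<Prod>j\<in>set_mset P - {0}. gm \<epsilon> c j (count (add_mset 0 P) j)) =
      (\<Prod>j\<in>set_mset P - {0}. gm \<epsilon> c j (count P j))"
    by (rule prod.cong) auto
  then show ?thesis
    using joint_remove[of "insert 0 (set_mset P)" P 0 \<epsilon> c]
      joint_remove[of "insert 0 (set_mset P)" "add_mset 0 P" 0 \<epsilon> c]
    by (simp add: gm_def[of _ _ 0] subset_insertI)
qed

text \<open>By independence only the factor of index k changes, and there
  \<open>gauss_moment_Suc\<close> applies with mean \<open>\<epsilon> * of_bool (even k)\<close> and
  variance k.\<close>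

lemma joint_stein:
  assumes "k > 0"
  shows "joint \<epsilon> c (add_mset k P) =
    \<epsilon> * of_bool (even k) * joint \<epsilon> c P + real (k * count P k) * joint \<epsilon> c (P - {#k#})"
proof -
  let ?A = "insert k (set_mset P)"
  \<comment> \<open>The three multisets to be compared agree with P away from k, so they share the
    product over the other indices.\<close>
  have eq: "joint \<epsilon> c Q = gm \<epsilon> c k (count Q k) * (\<Prod>j\<in>?A - {k}. gm \<epsilon> c j (count P j))"
    if "set_mset Q \<subseteq> ?A" "\<And>j. j \<noteq> k \<Longrightarrow> count Q j = count P j" for Q
  proof -
    have "(\<Prod>j\<in>?A - {k}. gm \<epsilon> c j (count Q j)) = (\<Prod>j\<in>?A - {k}. gm \<epsilon> c j (count P j))"
      by (rule prod.cong) (use that(2) in auto)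
    then show ?thesis using joint_remove[of ?A Q k \<epsilon> c] that(1) by simp
  qed
  have "set_mset (P - {#k#}) \<subseteq> ?A" by (auto dest: in_diffD)
  then have 1: "joint \<epsilon> c (P - {#k#}) =
      gm \<epsilon> c k (count P k - 1) * (\<Prod>j\<in>?A - {k}. gm \<epsilon> c j (count P j))"
    using eq[of "P - {#k#}"] by simp
  have 2: "joint \<epsilon> c (add_mset k P) =
      gm \<epsilon> c k (Suc (count P k)) * (\<Prod>j\<in>?A - {k}. gm \<epsilon> c j (count P j))"
    using eq[of "add_mset k P"] by simp
  have 3: "joint \<epsilon> c P = gm \<epsilon> c k (count P k) * (\<Prod>j\<in>?A - {k}. gm \<epsilon> c j (count P j))"
    using eq[of P] by (simp add: subset_insertI)
  have "gm \<epsilon> c k (Suc (count P k)) = \<epsilon> * of_bool (even k) * gm \<epsilon> c k (count P k)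
      + real (k * count P k) * gm \<epsilon> c k (count P k - 1)"
    using assms by (simp add: gm_def gauss_moment_Suc)
  then show ?thesis unfolding 1 2 3 by (simp only: distrib_right mult.assoc)
qed

lemma sum_mset_sum_count:
  fixes F :: "nat \<Rightarrow> real"
  assumes "set_mset P \<subseteq> {..<K}"
  shows "(\<Sum>l\<in>#P. F l) = (\<Sum>l<K. real (count P l) * F l)"
  using assms
proof (induction P)
  case (add x P)
  have "(\<Sum>l<K. real (count (add_mset x P) l) * F l) =
        (\<Sum>l<K. real (count P l) * F l + (if l = x then F l else 0))"
    by (rule sum.cong) (auto simp: algebra_simps)
  also have "\<dots> = (\<Sum>l<K. real (count P l) * F l) + F x"
    using add.prems by (simp add: sum.distrib)
  finally show ?case using add by simp
qed simp

text \<open>The distance |a - b|. For U in either group tr (U^a U^-b) is the power trace of this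
  index, because tr U^-n = tr U^n.\<close>

definition ndist :: "nat \<Rightarrow> nat \<Rightarrow> nat" where
  "ndist a b = (a - b) + (b - a)"

text \<open>The loop (Schwinger--Dyson) equation satisfied by the moments of traces of powers. Summing
  over \<open>r < k\<close> instead of \<open>0 < r < k\<close> absorbs the leading term \<open>(c - \<epsilon>) e(add_mset k P)\<close>,
  since index \<open>0\<close> stands for the constant \<open>c\<close>.\<close>

definition loop_eq :: "real \<Rightarrow> (nat multiset \<Rightarrow> real) \<Rightarrow> nat \<Rightarrow> nat multiset \<Rightarrow> bool" where
  "loop_eq \<epsilon> e k P \<longleftrightarrow>
     (\<Sum>r<k. e (add_mset r (add_mset (k - r) P)) - \<epsilon> * e (add_mset (ndist (2 * r) k) P))
   + (\<Sum>l\<in>#P. real l * (e (add_mset (k + l) (P - {#l#})) - e (add_mset (ndist k l) (P - {#l#})))) = 0"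

lemma sum_even_less:
  fixes F :: "nat \<Rightarrow> real"
  shows "(\<Sum>r\<in>{1..<k}. of_bool (even r) * F (k - r)) = (\<Sum>s | 1 \<le> s \<and> 2 * s < k. F (k - 2 * s))"
proof -
  have "(\<Sum>r\<in>{1..<k}. of_bool (even r) * F (k - r)) = (\<Sum>r\<in>{r. r \<in> {1..<k} \<and> even r}. F (k - r))"
    by (rule sum.mono_neutral_cong_right) auto
  also have "\<dots> = (\<Sum>s | 1 \<le> s \<and> 2 * s < k. F (k - 2 * s))"
    by (rule sum.reindex_bij_witness[of _ "\<lambda>s. 2 * s" "\<lambda>r. r div 2"]) auto
  finally show ?thesis .
qed

lemma finite_double_less: "finite {s. 1 \<le> s \<and> 2 * s < (k::nat)}"
  by (rule finite_subset[of _ "{..k}"]) auto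

text \<open>The indices r = s and r = k - s have the same distance k - 2 s; the midpoint r = k/2,
  present for even k, has distance 0.\<close>

lemma sum_ndist:
  fixes F :: "nat \<Rightarrow> real"
  shows "(\<Sum>r\<in>{1..<k}. F (ndist (2 * r) k)) =
    2 * (\<Sum>s | 1 \<le> s \<and> 2 * s < k. F (k - 2 * s)) + (if even k \<and> k > 0 then F 0 else 0)"
proof -
  let ?A = "{r. 1 \<le> r \<and> 2 * r < k}" and ?B = "{r. k < 2 * r \<and> r < k}" and ?C = "{r. 1 \<le> r \<and> 2 * r = k}"
  have fin: "finite ?A" "finite ?B" "finite ?C"
    by (rule finite_subset[of _ "{..k}"]; auto)+
  have "{1..<k} = ?A \<union> (?B \<union> ?C)" by auto
  then have "(\<Sum>r\<in>{1..<k}. F (ndist (2 * r) k)) =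
    (\<Sum>r\<in>?A. F (ndist (2 * r) k)) + ((\<Sum>r\<in>?B. F (ndist (2 * r) k)) + (\<Sum>r\<in>?C. F (ndist (2 * r) k)))"
    using fin by (simp only:) (subst sum.union_disjoint, auto intro: sum.union_disjoint)+
  also have "(\<Sum>r\<in>?A. F (ndist (2 * r) k)) = (\<Sum>s\<in>?A. F (k - 2 * s))"
    by (rule sum.cong) (auto simp: ndist_def)
  also have "(\<Sum>r\<in>?B. F (ndist (2 * r) k)) = (\<Sum>s\<in>?A. F (k - 2 * s))"
    by (rule sum.reindex_bij_witness[of _ "\<lambda>s. k - s" "\<lambda>s. k - s"])
       (auto simp: ndist_def intro!: arg_cong[of _ _ F])
  also have "?C = (if even k \<and> k > 0 then {k div 2} else {})"
    by auto
  also have "(\<Sum>r\<in>\<dots>. F (ndist (2 * r) k)) = (if even k \<and> k > 0 then F 0 else 0)"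
    by (auto simp: ndist_def)
  finally show ?thesis by simp
qed

lemma sum_parity:
  fixes F :: "nat \<Rightarrow> real"
  shows "(\<Sum>s | 2 * s < k. F (k - 2 * s)) = (\<Sum>l | 1 \<le> l \<and> l \<le> k \<and> (even l \<longleftrightarrow> even k). F l)"
  by (rule sum.reindex_bij_witness[of _ "\<lambda>l. (k - l) div 2" "\<lambda>s. k - 2 * s"]) auto

lemma card_double_less: "even k \<Longrightarrow> 2 * card {s. 2 * s < (k::nat)} = k"
proof -
  assume "even k"
  then have "{s. 2 * s < k} = {..<k div 2}" by auto
  then show ?thesis using \<open>even k\<close> by simp
qed

text \<open>Stein's identity in the variable r. The new entry k - r is one more copy of r exactly
  when 2 r = k, which gives the middle term.\<close>

lemma joint_pair:
  fixes \<epsilon> c :: real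
  defines "L \<equiv> joint \<epsilon> c"
  assumes "r > 0" "r < k"
  shows "L (add_mset r (add_mset (k - r) P)) =
     \<epsilon> * (of_bool (even r) * L (add_mset (k - r) P)) + of_bool (2 * r = k) * real r * L P
     + real (count P r) * (real r * L (add_mset (k - r) (P - {#r#})))"
proof -
  let ?Q = "add_mset (k - r) P"
  have "real (r * count ?Q r) * L (?Q - {#r#}) = of_bool (2 * r = k) * real r * L P
     + real (count P r) * (real r * L (add_mset (k - r) (P - {#r#})))"
  proof (cases "2 * r = k")
    case True
    then have kr: "k - r = r" by simp
    show ?thesis
    proof (cases "r \<in># P")
      case True
      then show ?thesis using \<open>2 * r = k\<close> by (simp add: kr algebra_simps)
    next
      case False
      then show ?thesis using \<open>2 * r = k\<close> by (simp add: kr not_in_iff)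
    qed
  next
    case False
    then have kr: "k - r \<noteq> r" using assms by auto
    show ?thesis
    proof (cases "r \<in># P")
      case True
      then show ?thesis using False kr by (simp add: diff_add_mset_swap)
    next
      case nin: False
      then show ?thesis using False kr by (simp add: not_in_iff)
    qed
  qed
  then show ?thesis
    unfolding L_def by (subst joint_stein) (use assms in auto)
qed

text \<open>The double sums over pairs \<open>l, l'\<close> of \<open>P\<close> with \<open>l' = l + k\<close> and \<open>l = l' + k\<close> agree by
  exchanging \<open>l\<close> and \<open>l'\<close>.\<close>

lemma sum_pairs_swap:
  fixes L :: "nat multiset \<Rightarrow> real"
  assumes "k > 0"
  shows "(\<Sum>l\<in>#P. real l * (real ((k + l) * count (P - {#l#}) (k + l)) * L (P - {#l#} - {#k + l#}))) =
     (\<Sum>l\<in>#P. if k < l then real l * (real ((l - k) * count (P - {#l#}) (l - k)) * L (P - {#l#} - {#l - k#})) else 0)"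
proof -
  obtain K where "\<forall>l\<in>set_mset P. l < K"
    using finite_nat_set_iff_bounded[of "set_mset P"] by auto
  then have K: "set_mset P \<subseteq> {..<K}" "set_mset P \<subseteq> {..<K+k}" by fastforce+
  define g where "g l = real (count P l) * real l * (real (k + l) * real (count P (k + l)) * L (P - {#l#} - {#k + l#}))" for l
  have "(\<Sum>l\<in>#P. real l * (real ((k + l) * count (P - {#l#}) (k + l)) * L (P - {#l#} - {#k + l#}))) = (\<Sum>l<K. g l)"
    unfolding sum_mset_sum_count[OF K(1)] g_def using assms by (intro sum.cong) auto
  also have "\<dots> = (\<Sum>l\<in>{k..<K+k}. g (l - k))"
    by (rule sum.reindex_bij_witness[of _ "\<lambda>l. l - k" "\<lambda>l. l + k"]) auto
  \<comment> \<open>The term l = k can be left out, as \<open>g 0\<close> has the factor 0.\<close>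
  also have "\<dots> = (\<Sum>l<K+k. if k < l then g (l - k) else 0)"
    by (rule sum.mono_neutral_cong_left) (auto simp: g_def)
  also have "\<dots> = (\<Sum>l\<in>#P. if k < l then real l * (real ((l - k) * count (P - {#l#}) (l - k)) * L (P - {#l#} - {#l - k#})) else 0)"
    unfolding sum_mset_sum_count[OF K(2)]
  proof (rule sum.cong)
    fix l
    have "P - {#l - k#} - {#l#} = P - {#l#} - {#l - k#}"
      by (simp add: diff_diff_add_mset add.commute)
    then show "(if k < l then g (l - k) else 0) =
      real (count P l) * (if k < l then real l * (real ((l - k) * count (P - {#l#}) (l - k)) * L (P - {#l#} - {#l - k#})) else 0)"
      using assms by (auto simp: g_def)
  qed simp
  finally show ?thesis .
qed

lemma sum_mset_sum_count_le:
  fixes F :: "nat \<Rightarrow> real"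
  shows "(\<Sum>l\<in>#P. if l \<le> k \<and> Q l then F l else 0) = (\<Sum>l | l \<le> k \<and> Q l. real (count P l) * F l)"
proof -
  obtain K where "\<forall>l\<in>set_mset P. l < K"
    using finite_nat_set_iff_bounded[of "set_mset P"] by auto
  then have K: "set_mset P \<subseteq> {..<K + Suc k}" by fastforce
  show ?thesis
    unfolding sum_mset_sum_count[OF K]
    by (rule sum.mono_neutral_cong_right) auto
qed

lemma sum_mset_subtractf:
  fixes f g :: "'b \<Rightarrow> 'a::ab_group_add"
  shows "(\<Sum>x\<in>#M. f x - g x) = (\<Sum>x\<in>#M. f x) - (\<Sum>x\<in>#M. g x)"
  by (induction M) simp_all

text \<open>Stein's identity expands every sum. The terms with c cancel by the identity for index k
  itself, and U, W and DD each occur twice with opposite signs. What remains is (1 - \<epsilon>^2)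
  times \<open>E * (k / 2) * L P\<close>, which is zero since \<epsilon>^2 = 1.\<close>

lemma loop_eq_joint:
  fixes \<epsilon> c :: real
  assumes "k > 0" "\<epsilon> * \<epsilon> = 1"
  shows "loop_eq \<epsilon> (joint \<epsilon> c) k P"
proof -
  define L where "L = joint \<epsilon> c"
  have stein: "L (add_mset j Q) = \<epsilon> * of_bool (even j) * L Q + real (j * count Q j) * L (Q - {#j#})"
    if "j > 0" for j Q
    unfolding L_def using joint_stein[OF that] .
  \<comment> \<open>S, V and W collect the terms in which a mean \<epsilon> is taken, V and W being
    separated by l \<le> k and l > k. U comes from contracting a new index with an entry of P, and
    DD from merging with one entry of P and contracting with another.\<close>
  define E where "E = (of_bool (even k) :: real)"
  define S where "S = (\<Sum>s | 1 \<le> s \<and> 2 * s < k. L (add_mset (k - 2 * s) P))"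
  define U where "U = (\<Sum>l\<in>#P. if l < k then real l * L (add_mset (k - l) (P - {#l#})) else 0)"
  define V where "V = (\<Sum>l\<in>#P. if l \<le> k \<and> (even l \<longleftrightarrow> even k) then real l * L (P - {#l#}) else 0)"
  define W where "W = (\<Sum>l\<in>#P. if k < l then real l * of_bool (even (l - k)) * L (P - {#l#}) else 0)"
  define DD where "DD = (\<Sum>l\<in>#P. real l * (real ((k + l) * count (P - {#l#}) (k + l)) * L (P - {#l#} - {#k + l#})))"
  have split0: "(\<Sum>r<k. f r) = f 0 + (\<Sum>r\<in>{1..<k}. f r)" for f :: "nat \<Rightarrow> real"
    using assms(1) by (simp add: lessThan_atLeast0 sum.atLeast_Suc_lessThan)

  have "(\<Sum>r\<in>{1..<k}. L (add_mset r (add_mset (k - r) P))) =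
    (\<Sum>r\<in>{1..<k}. \<epsilon> * (of_bool (even r) * L (add_mset (k - r) P)) + of_bool (2 * r = k) * real r * L P
     + real (count P r) * (real r * L (add_mset (k - r) (P - {#r#}))))"
    unfolding L_def by (intro sum.cong joint_pair refl) auto
  also have "\<dots> = \<epsilon> * (\<Sum>r\<in>{1..<k}. of_bool (even r) * L (add_mset (k - r) P))
     + (\<Sum>r\<in>{1..<k}. of_bool (2 * r = k) * real r * L P)
     + (\<Sum>r\<in>{1..<k}. real (count P r) * (real r * L (add_mset (k - r) (P - {#r#}))))"
    by (simp only: sum.distrib sum_distrib_left)
  also have "(\<Sum>r\<in>{1..<k}. of_bool (even r) * L (add_mset (k - r) P)) = S"
    unfolding S_def by (rule sum_even_less)
  \<comment> \<open>For even k the index r = k/2 is contracted with its partner k - r = r; the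
    factor k/2 is the variance of that variable.\<close>
  also have "(\<Sum>r\<in>{1..<k}. of_bool (2 * r = k) * real r * L P) = E * (real k / 2) * L P"
  proof (cases "even k")
    case True
    then obtain h where h: "k = 2 * h" by auto
    have "(\<Sum>r\<in>{1..<k}. of_bool (2 * r = k) * real r * L P) = (\<Sum>r\<in>{h}. real r * L P)"
      using assms(1) by (intro sum.mono_neutral_cong_right) (auto simp: h)
    then show ?thesis by (simp add: E_def h)
  next
    case False
    then have "2 * r \<noteq> k" for r by auto
    then show ?thesis using False by (simp add: E_def)
  qed
  also have "(\<Sum>r\<in>{1..<k}. real (count P r) * (real r * L (add_mset (k - r) (P - {#r#})))) = U"
  proof -
    have "U = (\<Sum>l\<in>#P. if l \<le> k \<and> l < k then real l * L (add_mset (k - l) (P - {#l#})) else 0)"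
      unfolding U_def by (intro arg_cong[of _ _ sum_mset] image_mset_cong) auto
    also have "\<dots> = (\<Sum>r\<in>{1..<k}. real (count P r) * (real r * L (add_mset (k - r) (P - {#r#}))))"
      unfolding sum_mset_sum_count_le
      by (rule sum.mono_neutral_right) (auto simp: not_less_eq_eq)
    finally show ?thesis ..
  qed
  finally have T1: "(\<Sum>r\<in>{1..<k}. L (add_mset r (add_mset (k - r) P))) = \<epsilon> * S + E * (real k / 2) * L P + U" .

  have T2: "(\<Sum>r\<in>{1..<k}. L (add_mset (ndist (2 * r) k) P)) = 2 * S + E * c * L P"
    unfolding S_def using sum_ndist[of "\<lambda>j. L (add_mset j P)" k] assms(1)
    by (simp add: E_def L_def joint_add_0)

  \<comment> \<open>The term s = 0 completes S to a sum over all positive indices up to k of the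
    parity of k. Stein's identity, applied to each of them, produces V.\<close>
  have "S + L (add_mset k P) = (\<Sum>s | 2 * s < k. L (add_mset (k - 2 * s) P))"
  proof -
    have "{s. 2 * s < k} = insert 0 {s. 1 \<le> s \<and> 2 * s < k}" using assms(1) by auto
    then show ?thesis using finite_double_less[of k] by (simp add: S_def)
  qed
  also have "\<dots> = (\<Sum>s | 2 * s < k. \<epsilon> * E * L P +
      real (count P (k - 2 * s)) * (real (k - 2 * s) * L (P - {#k - 2 * s#})))"
    by (rule sum.cong) (simp_all add: stein E_def)
  also have "\<dots> = \<epsilon> * E * real (card {s. 2 * s < k}) * L P + (\<Sum>s | 2 * s < k.
      real (count P (k - 2 * s)) * (real (k - 2 * s) * L (P - {#k - 2 * s#})))"
    by (simp add: sum.distrib)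
  also have "E * real (card {s. 2 * s < k}) = E * (real k / 2)"
    using card_double_less[of k] by (auto simp: E_def)
  then have "\<epsilon> * E * real (card {s. 2 * s < k}) * L P = \<epsilon> * E * (real k / 2) * L P"
    by (simp only: mult.assoc[of \<epsilon> E])
  also have "(\<Sum>s | 2 * s < k. real (count P (k - 2 * s)) * (real (k - 2 * s) * L (P - {#k - 2 * s#}))) = V"
    unfolding sum_parity[of "\<lambda>l. real (count P l) * (real l * L (P - {#l#}))"] V_def sum_mset_sum_count_le
    by (rule sum.mono_neutral_left) (auto simp: not_less_eq_eq)
  finally have S': "S + L (add_mset k P) = \<epsilon> * E * (real k / 2) * L P + V" .

  have "(\<Sum>l\<in>#P. real l * L (add_mset (k + l) (P - {#l#}))) =
      (\<Sum>l\<in>#P. \<epsilon> * (real l * of_bool (even (k + l)) * L (P - {#l#})) +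
        real l * (real ((k + l) * count (P - {#l#}) (k + l)) * L (P - {#l#} - {#k + l#})))"
    using assms(1) by (subst stein) (simp_all add: algebra_simps)
  also have "\<dots> = \<epsilon> * (\<Sum>l\<in>#P. real l * of_bool (even (k + l)) * L (P - {#l#})) + DD"
    by (simp only: sum_mset.distrib sum_mset_distrib_left DD_def)
  also have "(\<Sum>l\<in>#P. real l * of_bool (even (k + l)) * L (P - {#l#})) = V + W"
    unfolding V_def W_def sum_mset.distrib[symmetric]
    by (intro arg_cong[of _ _ sum_mset] image_mset_cong) auto
  finally have C: "(\<Sum>l\<in>#P. real l * L (add_mset (k + l) (P - {#l#}))) = \<epsilon> * (V + W) + DD" .

  have "(\<Sum>l\<in>#P. real l * L (add_mset (ndist k l) (P - {#l#}))) =
     U + (\<Sum>l\<in>#P. if l \<le> k \<and> l = k then real k * (c * L (P - {#k#})) else 0)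
     + (\<Sum>l\<in>#P. if k < l then real l * L (add_mset (l - k) (P - {#l#})) else 0)"
    unfolding U_def sum_mset.distrib[symmetric]
    by (intro arg_cong[of _ _ sum_mset] image_mset_cong) (auto simp: ndist_def L_def joint_add_0)
  also have "(\<Sum>l\<in>#P. if l \<le> k \<and> l = k then real k * (c * L (P - {#k#})) else 0) =
      real (count P k) * (real k * (c * L (P - {#k#})))"
  proof -
    have "{l. l \<le> k \<and> l = k} = {k}" by auto
    then show ?thesis unfolding sum_mset_sum_count_le by simp
  qed
  also have "(\<Sum>l\<in>#P. if k < l then real l * L (add_mset (l - k) (P - {#l#})) else 0) =
     (\<Sum>l\<in>#P. \<epsilon> * (if k < l then real l * of_bool (even (l - k)) * L (P - {#l#}) else 0) +
      (if k < l then real l * (real ((l - k) * count (P - {#l#}) (l - k)) * L (P - {#l#} - {#l - k#})) else 0))"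
    by (intro arg_cong[of _ _ sum_mset] image_mset_cong) (simp add: stein algebra_simps)
  also have "\<dots> = \<epsilon> * W + DD"
    by (simp only: sum_mset.distrib W_def DD_def sum_pairs_swap[OF assms(1)] sum_mset_distrib_left)
  finally have D: "(\<Sum>l\<in>#P. real l * L (add_mset (ndist k l) (P - {#l#}))) =
     U + real (count P k) * (real k * (c * L (P - {#k#}))) + (\<epsilon> * W + DD)" .

  have kP: "L (add_mset k P) = \<epsilon> * E * L P + real k * real (count P k) * L (P - {#k#})"
    using stein[OF assms(1), of P] by (simp add: E_def)
  have zero: "L (add_mset 0 (add_mset k P)) = c * L (add_mset k P)"
    by (simp add: L_def joint_add_0)

  have "(\<Sum>r<k. L (add_mset r (add_mset (k - r) P)) - \<epsilon> * L (add_mset (ndist (2 * r) k) P)) =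
      (c - \<epsilon>) * L (add_mset k P) + (\<epsilon> * S + E * (real k / 2) * L P + U) - \<epsilon> * (2 * S + E * c * L P)"
    unfolding split0 sum_subtractf sum_distrib_left[symmetric] T1 T2
    by (simp add: zero ndist_def algebra_simps)
  moreover have "(\<Sum>l\<in>#P. real l * (L (add_mset (k + l) (P - {#l#})) - L (add_mset (ndist k l) (P - {#l#})))) =
      (\<epsilon> * (V + W) + DD) - (U + real (count P k) * (real k * (c * L (P - {#k#}))) + (\<epsilon> * W + DD))"
    unfolding C[symmetric] D[symmetric] right_diff_distrib by (rule sum_mset_subtractf)
  moreover have "(c - \<epsilon>) * L (add_mset k P) + (\<epsilon> * S + E * (real k / 2) * L P + U) - \<epsilon> * (2 * S + E * c * L P)
     + ((\<epsilon> * (V + W) + DD) - (U + real (count P k) * (real k * (c * L (P - {#k#}))) + (\<epsilon> * W + DD))) =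
     c * (L (add_mset k P) - (\<epsilon> * E * L P + real k * real (count P k) * L (P - {#k#})))
     - \<epsilon> * (S + L (add_mset k P)) + E * (real k / 2) * L P + \<epsilon> * V"
    by (simp add: algebra_simps)
  moreover have "\<dots> = (1 - \<epsilon> * \<epsilon>) * (E * (real k / 2) * L P)"
    unfolding S' by (simp add: kP algebra_simps)
  ultimately show ?thesis
    using assms(2) unfolding loop_eq_def L_def[symmetric] by simp
qed

section \<open>Uniqueness of solutions of the loop equations\<close>

text \<open>Without the entry 0 both the size and the entries are bounded by the sum. Finiteness
  provides the maximum used in the uniqueness argument.\<close>

lemma finite_multisets_sum_mset: "finite {M :: nat multiset. 0 \<notin># M \<and> sum_mset M = n}"
proof -
  have "{M :: nat multiset. 0 \<notin># M \<and> sum_mset M = n} \<subseteq> mset ` {xs. set xs \<subseteq> {..n} \<and> length xs \<le> n}"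
  proof
    fix M :: "nat multiset" assume "M \<in> {M. 0 \<notin># M \<and> sum_mset M = n}"
    moreover have "0 \<notin># M \<Longrightarrow> size M \<le> sum_mset M"
      by (induction M) (auto simp: Suc_le_eq intro: add_mono)
    moreover obtain xs where "M = mset xs" by (metis ex_mset)
    ultimately show "M \<in> mset ` {xs. set xs \<subseteq> {..n} \<and> length xs \<le> n}"
      by (auto simp: sum_mset_sum_list member_le_sum_list)
  qed
  then show ?thesis
    by (rule finite_subset) (intro finite_imageI finite_lists_length_le, simp)
qed

lemma loop_eq_diff:
  assumes "loop_eq \<epsilon> e k P" "loop_eq \<epsilon> e' k P"
  shows "loop_eq \<epsilon> (\<lambda>M. e M - e' M) k P"
proof -
  let ?S = "\<lambda>e. \<Sum>r<k. e (add_mset r (add_mset (k - r) P)) - \<epsilon> * e (add_mset (ndist (2 * r) k) P)"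
  let ?T = "\<lambda>e. \<Sum>l\<in>#P. real l * (e (add_mset (k + l) (P - {#l#})) - e (add_mset (ndist k l) (P - {#l#})))"
  have "?S (\<lambda>M. e M - e' M) = ?S e - ?S e'"
    unfolding sum_subtractf[symmetric] by (rule sum.cong) (simp_all add: algebra_simps)
  moreover have "?T (\<lambda>M. e M - e' M) = ?T e - ?T e'"
    unfolding sum_mset_subtractf[symmetric] by (simp add: algebra_simps)
  ultimately show ?thesis using assms unfolding loop_eq_def by linarith
qed

text \<open>For 0 < r < k the index |2 r - k| is below k, and for l > 0 the index |k - l| is below k
  + l. So the terms with \<open>ndist\<close> have lower degree, except at r = 0, where the index is
  k and \<epsilon> joins the leading coefficient. Terms with l = 0 carry the factor 0.\<close>

lemma loop_eq_leading:
  assumes "loop_eq \<epsilon> e k P" "k > 0" "\<And>Q. e (add_mset 0 Q) = c * e Q"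
    and lower: "\<And>Q. sum_mset Q < k + sum_mset P \<Longrightarrow> e Q = 0"
  shows "(c - \<epsilon>) * e (add_mset k P) =
    - (\<Sum>r\<in>{1..<k}. e (add_mset r (add_mset (k - r) P)))
    - (\<Sum>l\<in>#P. real l * e (add_mset (k + l) (P - {#l#})))"
proof -
  have "(\<Sum>r<k. e (add_mset r (add_mset (k - r) P)) - \<epsilon> * e (add_mset (ndist (2 * r) k) P)) =
      (c - \<epsilon>) * e (add_mset k P) +
      (\<Sum>r\<in>{1..<k}. e (add_mset r (add_mset (k - r) P)) - \<epsilon> * e (add_mset (ndist (2 * r) k) P))"
    using assms(2,3)
    by (simp add: lessThan_atLeast0 sum.atLeast_Suc_lessThan ndist_def algebra_simps)
  moreover have "(\<Sum>r\<in>{1..<k}. e (add_mset r (add_mset (k - r) P)) - \<epsilon> * e (add_mset (ndist (2 * r) k) P))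
      = (\<Sum>r\<in>{1..<k}. e (add_mset r (add_mset (k - r) P)))"
    by (rule sum.cong) (auto simp: lower ndist_def)
  moreover have "(\<Sum>l\<in>#P. real l * (e (add_mset (k + l) (P - {#l#})) - e (add_mset (ndist k l) (P - {#l#}))))
      = (\<Sum>l\<in>#P. real l * e (add_mset (k + l) (P - {#l#})))"
  proof (intro arg_cong[of _ _ sum_mset] image_mset_cong)
    fix l assume "l \<in># P"
    then obtain Q where "P = add_mset l Q" by (meson mset_add)
    then have "l > 0 \<Longrightarrow> e (add_mset (ndist k l) (P - {#l#})) = 0"
      using assms(2) by (intro lower) (auto simp: ndist_def)
    then show "real l * (e (add_mset (k + l) (P - {#l#})) - e (add_mset (ndist k l) (P - {#l#})))
      = real l * e (add_mset (k + l) (P - {#l#}))"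
      by (cases "l = 0") auto
  qed
  ultimately show ?thesis
    using assms(1) unfolding loop_eq_def by linarith
qed

text \<open>Maximum principle: in degree \<open>n\<close> the terms of top degree on the right of
  \<open>loop_eq_leading\<close> have total weight \<open>n - 1\<close>.\<close>

lemma loop_eq_imp_zero:
  assumes loop: "\<And>k P. k > 0 \<Longrightarrow> loop_eq \<epsilon> e k P"
    and e0: "e {#} = 0" "\<And>Q. e (add_mset 0 Q) = c * e Q"
    and D: "real D - 1 < c - \<epsilon>"
    and M: "sum_mset M \<le> D"
  shows "e M = 0"
  using M
proof (induction "sum_mset M" arbitrary: M rule: less_induct)
  case less
  define n where "n = sum_mset M"
  have lower: "e Q = 0" if "sum_mset Q < n" for Q
    using that less by (auto simp: n_def)
  \<comment> \<open>The maximum is taken over monomials without index 0, of which there are finitely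
    many in each degree. The inserted 0 below makes it well defined for empty A.\<close>
  define A where "A = {M :: nat multiset. 0 \<notin># M \<and> sum_mset M = n}"
  define m where "m = Max (insert 0 ((\<lambda>M. \<bar>e M\<bar>) ` A))"
  have finA: "finite A" unfolding A_def by (rule finite_multisets_sum_mset)
  have m_A: "\<bar>e Q\<bar> \<le> m" if "Q \<in> A" for Q
    unfolding m_def using finA that by simp
  have m0: "m \<ge> 0" unfolding m_def using finA by simp
  have "m = 0"
  proof (rule ccontr)
    assume "m \<noteq> 0"
    moreover have "m \<in> insert 0 ((\<lambda>M. \<bar>e M\<bar>) ` A)"
      unfolding m_def using finA by (intro Max_in) auto
    ultimately obtain Q where Q: "Q \<in> A" "\<bar>e Q\<bar> = m" by auto
    then have "Q \<noteq> {#}" using \<open>m \<noteq> 0\<close> e0 by auto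
    then obtain k P where P: "Q = add_mset k P" by (meson multiset_cases)
    have k: "k > 0" "0 \<notin># P" "k + sum_mset P = n"
      using Q(1) unfolding P A_def by auto
    have "(c - \<epsilon>) * e (add_mset k P) =
      - (\<Sum>r\<in>{1..<k}. e (add_mset r (add_mset (k - r) P)))
      - (\<Sum>l\<in>#P. real l * e (add_mset (k + l) (P - {#l#})))"
      by (rule loop_eq_leading) (use k loop e0 lower in auto)
    moreover have "\<bar>\<Sum>r\<in>{1..<k}. e (add_mset r (add_mset (k - r) P))\<bar> \<le> (\<Sum>r\<in>{1..<k}. m)"
      by (intro order.trans[OF sum_abs] sum_mono m_A) (use k in \<open>auto simp: A_def\<close>)
    moreover have "\<bar>\<Sum>l\<in>#P. real l * e (add_mset (k + l) (P - {#l#}))\<bar> \<le> (\<Sum>l\<in>#P. real l * m)"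
    proof -
      have "\<bar>\<Sum>l\<in>#R. f l\<bar> \<le> (\<Sum>l\<in>#R. g l)"
        if "\<And>l. l \<in># R \<Longrightarrow> \<bar>f l\<bar> \<le> g l" for R and f g :: "nat \<Rightarrow> real"
        using that by (induction R) (auto intro: order.trans[OF abs_triangle_ineq] add_mono)
      moreover have "\<bar>e (add_mset (k + l) (P - {#l#}))\<bar> \<le> m" if "l \<in># P" for l
      proof -
        from that obtain R where "P = add_mset l R" by (meson mset_add)
        then show ?thesis using k by (intro m_A) (auto simp: A_def)
      qed
      ultimately show ?thesis by (simp add: abs_mult mult_left_mono)
    qed
    moreover have "(\<Sum>l\<in>#P. real l * m) = real (sum_mset P) * m"
      by (induction P) (simp_all add: algebra_simps)
    ultimately have "\<bar>(c - \<epsilon>) * e Q\<bar> \<le> real (k - 1) * m + real (sum_mset P) * m"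
      unfolding P by simp
    also have "\<dots> = (real n - 1) * m"
      using k by (auto simp: of_nat_diff algebra_simps)
    finally have "\<bar>c - \<epsilon>\<bar> * m \<le> (real n - 1) * m"
      unfolding abs_mult Q(2) .
    moreover have "real n \<le> real D"
      using less.prems unfolding n_def by (simp only: of_nat_le_iff)
    then have "real n - 1 < \<bar>c - \<epsilon>\<bar>" using D by linarith
    ultimately show False using m0 \<open>m \<noteq> 0\<close> by (simp add: mult_le_cancel_right)
  qed
  then have A0: "e Q = 0" if "Q \<in> A" for Q using m_A[OF that] by simp
  \<comment> \<open>Entries 0 do not change the degree; each is removed at the price of a factor
    c.\<close>
  have "e Q = 0" if "sum_mset Q = n" for Q
    using that
  proof (induction "size Q" arbitrary: Q)
    case 0
    then show ?case using e0 by simp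
  next
    case (Suc j)
    show ?case
    proof (cases "0 \<in># Q")
      case True
      then obtain R where "Q = add_mset 0 R" by (meson mset_add)
      then show ?thesis using Suc e0 by simp
    qed (use A0 Suc in \<open>auto simp: A_def\<close>)
  qed
  then show ?case by (simp add: n_def)
qed

lemma loop_eq_unique:
  assumes "\<epsilon> * \<epsilon> = 1" "\<And>k P. k > 0 \<Longrightarrow> loop_eq \<epsilon> e k P"
    and "e {#} = 1" "\<And>Q. e (add_mset 0 Q) = c * e Q"
    and "real (sum_mset M) - 1 < c - \<epsilon>"
  shows "e M = joint \<epsilon> c M"
proof -
  have "e M - joint \<epsilon> c M = 0"
    by (rule loop_eq_imp_zero[of \<epsilon> "\<lambda>M. e M - joint \<epsilon> c M" c "sum_mset M"])
       (use assms in \<open>auto intro!: loop_eq_diff loop_eq_joint simp: joint_add_0 algebra_simps\<close>)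
  then show ?thesis by simp
qed

section \<open>Moments of linear combinations\<close>

text \<open>The value on \<open>(a + \<Sum>j\<in>J. c\<^sub>j p\<^sub>j)\<^sup>k \<cdot> p\<^sub>M\<close> of the linear functional with value \<open>e M\<close> on
  the monomial \<open>p\<^sub>M\<close>.\<close>

primrec lin_moment :: "(nat multiset \<Rightarrow> real) \<Rightarrow> nat set \<Rightarrow> real \<Rightarrow> (nat \<Rightarrow> real) \<Rightarrow> nat \<Rightarrow> nat multiset \<Rightarrow> real" where
  "lin_moment e J a c 0 M = e M"
| "lin_moment e J a c (Suc k) M = a * lin_moment e J a c k M + (\<Sum>j\<in>J. c j * lin_moment e J a c k (add_mset j M))"

text \<open>Expanding the power only meets monomials of size at most n with indices in J, so
  agreement in low degree is all that a moment of low order sees.\<close>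

lemma lin_moment_cong:
  assumes "\<And>M. set_mset M \<subseteq> J \<Longrightarrow> size M \<le> n \<Longrightarrow> e M = e' M"
    and "set_mset M \<subseteq> J" "k + size M \<le> n"
  shows "lin_moment e J a c k M = lin_moment e' J a c k M"
  using assms(2,3)
proof (induction k arbitrary: M)
  case (Suc k)
  have "(\<Sum>j\<in>J. c j * lin_moment e J a c k (add_mset j M)) = (\<Sum>j\<in>J. c j * lin_moment e' J a c k (add_mset j M))"
    by (rule sum.cong) (use Suc in auto)
  then show ?case using Suc by simp
qed (use assms(1) in auto)

text \<open>Gaussian integration by parts in p_j applied to (a + sum of c_i p_i)^k p_M: the second
  term differentiates the monomial, the third the power.\<close>

lemma lin_moment_joint_stein:
  fixes a c' \<epsilon> :: real and c :: "nat \<Rightarrow> real"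
  assumes "finite J" "j \<in> J" "0 \<notin> J"
  defines "W \<equiv> lin_moment (joint \<epsilon> c') J a c"
  shows "W k (add_mset j M) = \<epsilon> * of_bool (even j) * W k M + real (j * count M j) * W k (M - {#j#})
    + real (j * k) * c j * W (k - 1) M"
proof (induction k arbitrary: M)
  case 0
  have "j > 0" using assms by (metis gr0I)
  then show ?case using joint_stein[of j \<epsilon> c' M] by (simp add: W_def)
next
  case (Suc k)
  have step: "W (Suc k) Q = a * W k Q + (\<Sum>i\<in>J. c i * W k (add_mset i Q))" for Q
    by (simp add: W_def)
  \<comment> \<open>Adjoining i raises the multiplicity of j by one exactly if i = j; this extra
    term later supplies the step from k to k + 1 in the last summand.\<close>
  have eq: "W k (add_mset j (add_mset i M)) =
      \<epsilon> * of_bool (even j) * W k (add_mset i M) + real (j * count M j) * W k (add_mset i (M - {#j#}))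
      + of_bool (i = j) * real j * W k M + real (j * k) * c j * W (k - 1) (add_mset i M)" for i
  proof -
    have "real (j * count (add_mset i M) j) * W k (add_mset i M - {#j#}) =
      real (j * count M j) * W k (add_mset i (M - {#j#})) + of_bool (i = j) * real j * W k M"
    proof (cases "j \<in># M")
      case True
      then show ?thesis by (cases "i = j") (auto simp: algebra_simps diff_add_mset_swap)
    next
      case False
      then show ?thesis by (auto simp: not_in_iff)
    qed
    then show ?thesis unfolding Suc.IH[of "add_mset i M"] by simp
  qed
  have "(\<Sum>i\<in>J. c i * W k (add_mset i (add_mset j M))) =
     (\<Sum>i\<in>J. \<epsilon> * of_bool (even j) * (c i * W k (add_mset i M))
       + real (j * count M j) * (c i * W k (add_mset i (M - {#j#})))
       + (if i = j then c j * real j * W k M else 0)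
       + real (j * k) * c j * (c i * W (k - 1) (add_mset i M)))"
    by (rule sum.cong) (auto simp: add_mset_commute[of _ j] eq algebra_simps)
  also have "\<dots> = \<epsilon> * of_bool (even j) * (\<Sum>i\<in>J. c i * W k (add_mset i M))
       + real (j * count M j) * (\<Sum>i\<in>J. c i * W k (add_mset i (M - {#j#})))
       + c j * real j * W k M
       + real (j * k) * c j * (\<Sum>i\<in>J. c i * W (k - 1) (add_mset i M))"
    using assms(1,2) by (simp only: sum.distrib sum_distrib_left sum.delta) simp
  finally have "W (Suc k) (add_mset j M) = \<epsilon> * of_bool (even j) * W (Suc k) M
       + real (j * count M j) * W (Suc k) (M - {#j#}) + c j * real j * W k M
       + real (j * k) * c j * (a * W (k - 1) M + (\<Sum>i\<in>J. c i * W (k - 1) (add_mset i M)))"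
    unfolding step Suc.IH[of M] by (simp add: algebra_simps)
  moreover have "real (j * k) * c j * (a * W (k - 1) M + (\<Sum>i\<in>J. c i * W (k - 1) (add_mset i M))) = real (j * k) * c j * W k M"
    using step[of M] by (cases k) (simp_all add: W_def)
  ultimately show ?case by (simp add: algebra_simps)
qed

text \<open>A linear combination of independent Gaussians is Gaussian. Summing Stein's identity over
  j with weights c_j gives the recursion of \<open>gauss_moment_Suc\<close> with the mean and
  variance shown.\<close>

lemma lin_moment_joint:
  assumes "finite J" "0 \<notin> J"
  shows "lin_moment (joint \<epsilon> c') J a c k {#} =
    gauss_moment (a + \<epsilon> * (\<Sum>j\<in>J. of_bool (even j) * c j)) (\<Sum>j\<in>J. real j * (c j)\<^sup>2) k"
proof (induction k rule: less_induct)
  case (less k)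
  let ?v = "\<Sum>j\<in>J. real j * (c j)\<^sup>2"
  let ?W = "lin_moment (joint \<epsilon> c') J a c"
  have v: "?v \<ge> 0" by (intro sum_nonneg) auto
  show ?case
  proof (cases k)
    case (Suc n)
    have "?W (Suc n) {#} = a * ?W n {#} + (\<Sum>j\<in>J. c j * (\<epsilon> * of_bool (even j) * ?W n {#} + real (j * n) * c j * ?W (n - 1) {#}))"
      using assms by (auto simp: lin_moment_joint_stein intro!: sum.cong)
    also have "\<dots> = (a + \<epsilon> * (\<Sum>j\<in>J. of_bool (even j) * c j)) * ?W n {#} + real n * ?v * ?W (n - 1) {#}"
      by (simp add: sum.distrib sum_distrib_left sum_distrib_right algebra_simps power2_eq_square)
    finally show ?thesis
      using less.IH[of n] less.IH[of "n - 1"] Suc by (cases n) (simp_all add: gauss_moment_Suc[OF v])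
  qed simp
qed

section \<open>Matrices\<close>

abbreviation to_mat :: "nat \<Rightarrow> cmat \<Rightarrow> complex mat" where
  "to_mat N U \<equiv> Matrix.mat N N U"

text \<open>Passes from the matrix type, which has products, determinants and Schur form, back to
  extensional functions; it is inverse to \<open>to_mat\<close> on \<open>mat_space\<close>.\<close>

definition of_mat :: "nat \<Rightarrow> complex mat \<Rightarrow> cmat" where
  "of_mat N A = restrict (\<lambda>ij. A $$ ij) (idx N)"

lemma to_mat_of_mat [simp]: "A \<in> carrier_mat N N \<Longrightarrow> to_mat N (of_mat N A) = A"
  by (auto simp: of_mat_def idx_def)

lemma of_mat_in_space [simp]: "of_mat N A \<in> space (mat_space N)"
  by (simp add: of_mat_def mat_space_def space_PiM)

lemma mat_mult_entry:
  assumes "A \<in> carrier_mat N N" "B \<in> carrier_mat N N" "i < N" "j < N"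
  shows "(A * B) $$ (i, j) = (\<Sum>k<N. A $$ (i, k) * B $$ (k, j))"
  using assms by (auto simp: scalar_prod_def lessThan_atLeast0 intro!: sum.cong)

lemma mmul_eq: "mmul N A B = of_mat N (to_mat N A * to_mat N B)"
proof (rule ext, clarify)
  fix i j
  show "mmul N A B (i, j) = of_mat N (to_mat N A * to_mat N B) (i, j)"
    by (cases "i < N \<and> j < N")
       (auto simp: mmul_def of_mat_def idx_def mat_mult_entry[of _ N] simp del: index_mult_mat)
qed

lemma mult_carrier_square [simp]:
  "A \<in> carrier_mat N N \<Longrightarrow> B \<in> carrier_mat N N \<Longrightarrow> A * B \<in> carrier_mat N N"
  by (rule mult_carrier_mat)

lemma to_mat_mmul [simp]: "to_mat N (mmul N A B) = to_mat N A * to_mat N B"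
  unfolding mmul_eq by (rule to_mat_of_mat) simp

lemma mid_eq: "mid N = of_mat N (1\<^sub>m N)"
  by (rule ext) (auto simp: mid_def of_mat_def idx_def)

definition hadj :: "complex mat \<Rightarrow> complex mat" where
  "hadj A = Matrix.mat (dim_col A) (dim_row A) (\<lambda>(i, j). cnj (A $$ (j, i)))"

lemma hadj_carrier [simp]: "A \<in> carrier_mat n m \<Longrightarrow> hadj A \<in> carrier_mat m n"
  by (auto simp: hadj_def)

lemma hadj_entry: "A \<in> carrier_mat N N \<Longrightarrow> i < N \<Longrightarrow> j < N \<Longrightarrow> hadj A $$ (i, j) = cnj (A $$ (j, i))"
  by (auto simp: hadj_def)

lemma hadj_mult:
  assumes "A \<in> carrier_mat N N" "B \<in> carrier_mat N N"
  shows "hadj (A * B) = hadj B * hadj A"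
proof (rule eq_matI)
  fix i j assume "i < dim_row (hadj B * hadj A)" "j < dim_col (hadj B * hadj A)"
  then have ij: "i < N" "j < N" using assms by (auto simp: hadj_def)
  then show "hadj (A * B) $$ (i, j) = (hadj B * hadj A) $$ (i, j)"
    using assms
    by (simp add: hadj_entry[of _ N] mat_mult_entry[of _ N] mult.commute del: index_mult_mat(1))
qed (use assms in \<open>auto simp: hadj_def\<close>)

section \<open>Traces of powers and their derivatives along curves\<close>

definition tr :: "complex mat \<Rightarrow> complex" where
  "tr A = (\<Sum>i<dim_row A. A $$ (i, i))"

lemma tr_mult_comm:
  assumes "A \<in> carrier_mat N N" "B \<in> carrier_mat N N"
  shows "tr (A * B) = tr (B * A)"
proof -
  have "tr (A * B) = (\<Sum>i<N. \<Sum>k<N. A $$ (i, k) * B $$ (k, i))"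
    using assms by (simp add: tr_def mat_mult_entry[of _ N] del: index_mult_mat(1))
  also have "\<dots> = (\<Sum>k<N. \<Sum>i<N. B $$ (k, i) * A $$ (i, k))"
    by (subst sum.swap) (simp add: mult.commute)
  also have "\<dots> = tr (B * A)"
    using assms by (simp add: tr_def mat_mult_entry[of _ N] del: index_mult_mat(1))
  finally show ?thesis .
qed

lemma pow_mat_add:
  assumes A: "A \<in> carrier_mat N N"
  shows "A ^\<^sub>m a * A ^\<^sub>m b = A ^\<^sub>m (a + b)"
proof (induction b)
  case (Suc b)
  have "A ^\<^sub>m a * (A ^\<^sub>m b * A) = A ^\<^sub>m a * A ^\<^sub>m b * A"
    using A by (simp add: assoc_mult_mat[of _ N N _ N _ N])
  then show ?case using Suc by simp
qed (use A in simp)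

text \<open>The derivative of \<open>A\<^sup>k\<close> along a curve with \<open>A' = X A\<close>.\<close>

primrec dpow :: "complex mat \<Rightarrow> complex mat \<Rightarrow> nat \<Rightarrow> complex mat" where
  "dpow X A 0 = 0\<^sub>m (dim_row A) (dim_row A)"
| "dpow X A (Suc k) = dpow X A k * A + A ^\<^sub>m k * (X * A)"

lemma dpow_carrier [simp]:
  "A \<in> carrier_mat N N \<Longrightarrow> X \<in> carrier_mat N N \<Longrightarrow> dpow X A k \<in> carrier_mat N N"
  by (induction k) auto

text \<open>The Leibniz rule: replacing the factor in position r, counted from 0, by X A leaves r
  factors before X and k - r after it.\<close>

lemma dpow_entry:
  assumes A: "A \<in> carrier_mat N N" and X: "X \<in> carrier_mat N N" and ij: "i < N" "j < N"
  shows "dpow X A k $$ (i, j) = (\<Sum>r<k. (A ^\<^sub>m r * X * A ^\<^sub>m (k - r)) $$ (i, j))"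
  using ij
proof (induction k arbitrary: i j)
  case (Suc k)
  have "(dpow X A k * A) $$ (i, j) = (\<Sum>l<N. \<Sum>r<k. (A ^\<^sub>m r * X * A ^\<^sub>m (k - r)) $$ (i, l) * A $$ (l, j))"
    using A X Suc by (simp add: mat_mult_entry[of _ N] sum_distrib_right del: index_mult_mat(1))
  also have "\<dots> = (\<Sum>r<k. (A ^\<^sub>m r * X * A ^\<^sub>m (k - r) * A) $$ (i, j))"
    using A X Suc.prems by (subst sum.swap) (simp add: mat_mult_entry[OF _ A] del: index_mult_mat(1))
  also have "\<dots> = (\<Sum>r<k. (A ^\<^sub>m r * X * A ^\<^sub>m (Suc k - r)) $$ (i, j))"
  proof (intro sum.cong refl)
    fix r assume "r \<in> {..<k}"
    then have "A ^\<^sub>m (Suc k - r) = A ^\<^sub>m (k - r) * A" by (simp add: Suc_diff_le)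
    then show "(A ^\<^sub>m r * X * A ^\<^sub>m (k - r) * A) $$ (i, j) = (A ^\<^sub>m r * X * A ^\<^sub>m (Suc k - r)) $$ (i, j)"
      using A X assoc_mult_mat[of "A ^\<^sub>m r * X" N N "A ^\<^sub>m (k - r)" N A N] by simp
  qed
  finally show ?case
    using A X Suc.prems
    by (simp add: assoc_mult_mat[of _ N N _ N _ N] del: index_mult_mat(1))
qed (use A in auto)

text \<open>By cyclicity the k terms of the Leibniz rule have the same trace.\<close>

lemma tr_dpow:
  assumes A: "A \<in> carrier_mat N N" and X: "X \<in> carrier_mat N N"
  shows "tr (dpow X A k) = of_nat k * tr (X * A ^\<^sub>m k)"
proof -
  have "tr (dpow X A k) = (\<Sum>i<N. \<Sum>r<k. (A ^\<^sub>m r * X * A ^\<^sub>m (k - r)) $$ (i, i))"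
    using A X carrier_matD(1)[OF dpow_carrier[OF A X, of k]]
    by (simp add: tr_def dpow_entry[OF A X] del: index_mult_mat(1))
  also have "\<dots> = (\<Sum>r<k. tr (A ^\<^sub>m r * X * A ^\<^sub>m (k - r)))"
    using A X by (subst sum.swap) (simp add: tr_def)
  also have "\<dots> = (\<Sum>r<k. tr (X * A ^\<^sub>m k))"
  proof (intro sum.cong refl)
    fix r assume "r \<in> {..<k}"
    have "tr (A ^\<^sub>m r * X * A ^\<^sub>m (k - r)) = tr (A ^\<^sub>m r * (X * A ^\<^sub>m (k - r)))"
      using A X by (simp add: assoc_mult_mat[of _ N N _ N _ N])
    also have "\<dots> = tr (X * A ^\<^sub>m (k - r) * A ^\<^sub>m r)"
      by (rule tr_mult_comm[of _ N]) (use A X in auto)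
    also have "X * A ^\<^sub>m (k - r) * A ^\<^sub>m r = X * (A ^\<^sub>m (k - r) * A ^\<^sub>m r)"
      using A X by (simp add: assoc_mult_mat[of _ N N _ N _ N])
    also have "A ^\<^sub>m (k - r) * A ^\<^sub>m r = A ^\<^sub>m k"
      using A \<open>r \<in> _\<close> by (simp add: pow_mat_add)
    finally show "tr (A ^\<^sub>m r * X * A ^\<^sub>m (k - r)) = tr (X * A ^\<^sub>m k)" .
  qed
  finally show ?thesis by simp
qed

definition mat_deriv :: "nat \<Rightarrow> (real \<Rightarrow> complex mat) \<Rightarrow> complex mat \<Rightarrow> real \<Rightarrow> bool" where
  "mat_deriv N F F' t \<longleftrightarrow>
     (\<forall>i<N. \<forall>j<N. ((\<lambda>u. F u $$ (i, j)) has_vector_derivative F' $$ (i, j)) (at t))"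

lemma mat_deriv_mult:
  assumes "\<And>u. F u \<in> carrier_mat N N" "\<And>u. H u \<in> carrier_mat N N"
    "F' \<in> carrier_mat N N" "H' \<in> carrier_mat N N"
    "mat_deriv N F F' t" "mat_deriv N H H' t"
  shows "mat_deriv N (\<lambda>u. F u * H u) (F' * H t + F t * H') t"
  unfolding mat_deriv_def
proof (intro allI impI)
  fix i j assume ij: "i < N" "j < N"
  have "((\<lambda>u. \<Sum>k<N. F u $$ (i, k) * H u $$ (k, j)) has_vector_derivative
        (\<Sum>k<N. F t $$ (i, k) * H' $$ (k, j) + F' $$ (i, k) * H t $$ (k, j))) (at t)"
    using assms(5,6) ij unfolding mat_deriv_def
    by (intro has_vector_derivative_sum has_vector_derivative_mult) auto
  then show "((\<lambda>u. (F u * H u) $$ (i, j)) has_vector_derivative (F' * H t + F t * H') $$ (i, j)) (at t)"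
    using assms(1-4) ij carrier_matD(1)[OF assms(1)[of t]] carrier_matD(2)[OF assms(4)]
    by (simp add: mat_mult_entry[of _ N] sum.distrib add.commute del: index_mult_mat(1))
qed

lemma mat_deriv_pow:
  assumes "\<And>u. F u \<in> carrier_mat N N" "X \<in> carrier_mat N N" "mat_deriv N F (X * F t) t"
  shows "mat_deriv N (\<lambda>u. F u ^\<^sub>m k) (dpow X (F t) k) t"
proof (induction k)
  case 0
  have "dim_row (F u) = N" for u using assms(1)[of u] by simp
  then show ?case by (simp add: mat_deriv_def)
next
  case (Suc k)
  have "mat_deriv N (\<lambda>u. F u ^\<^sub>m k * F u) (dpow X (F t) k * F t + F t ^\<^sub>m k * (X * F t)) t"
    by (rule mat_deriv_mult) (use assms Suc in auto)
  then show ?case by simp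
qed

lemma mat_deriv_tr:
  assumes "\<And>u. F u \<in> carrier_mat N N" "F' \<in> carrier_mat N N" "mat_deriv N F F' t"
  shows "((\<lambda>u. tr (F u)) has_vector_derivative tr F') (at t)"
proof -
  have "dim_row (F u) = N" for u using assms(1)[of u] by simp
  moreover have "dim_row F' = N" using assms(2) by simp
  ultimately show ?thesis
    using assms(3) unfolding tr_def mat_deriv_def
    by (auto intro!: has_vector_derivative_sum)
qed

definition tr_prod :: "complex mat \<Rightarrow> nat multiset \<Rightarrow> complex" where
  "tr_prod A P = (\<Prod>l\<in>#P. tr (A ^\<^sub>m l))"

text \<open>The product rule along A' = X A. Removing one copy of l at a time differentiates
  repeated indices copy by copy.\<close>

definition dtr_prod :: "complex mat \<Rightarrow> complex mat \<Rightarrow> nat multiset \<Rightarrow> complex" where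
  "dtr_prod X A P = (\<Sum>l\<in>#P. tr (dpow X A l) * tr_prod A (P - {#l#}))"

lemma dtr_prod_add_mset:
  "dtr_prod X A (add_mset l P) = tr (dpow X A l) * tr_prod A P + tr (A ^\<^sub>m l) * dtr_prod X A P"
proof -
  have "(\<Sum>j\<in>#P. tr (dpow X A j) * tr_prod A (add_mset l P - {#j#})) =
        (\<Sum>j\<in>#P. tr (A ^\<^sub>m l) * (tr (dpow X A j) * tr_prod A (P - {#j#})))"
    by (intro arg_cong[of _ _ sum_mset] image_mset_cong)
       (auto simp: tr_prod_def diff_add_mset_swap dest!: multi_member_split)
  then show ?thesis by (simp only: dtr_prod_def sum_mset_distrib_left) simp
qed

lemma has_vector_derivative_tr_prod:
  assumes "\<And>u. F u \<in> carrier_mat N N" "X \<in> carrier_mat N N" "mat_deriv N F (X * F t) t"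
  shows "((\<lambda>u. tr_prod (F u) P) has_vector_derivative dtr_prod X (F t) P) (at t)"
proof (induction P)
  case empty
  then show ?case by (simp add: tr_prod_def dtr_prod_def)
next
  case (add l P)
  have "((\<lambda>u. tr (F u ^\<^sub>m l)) has_vector_derivative tr (dpow X (F t) l)) (at t)"
    by (rule mat_deriv_tr[of _ N]) (use assms mat_deriv_pow in auto)
  from has_vector_derivative_mult[OF this add]
  show ?case by (simp add: dtr_prod_add_mset tr_prod_def add.commute)
qed

section \<open>Sums over the eigenvalues\<close>

definition root_sum :: "(complex \<Rightarrow> real) \<Rightarrow> complex poly \<Rightarrow> real" where
  "root_sum \<phi> p = (\<Sum>z\<in>{z. poly p z = 0}. real (Polynomial.order z p) * \<phi> z)"

lemma Zf_root_sum: "Zf f N U = root_sum (\<lambda>z. FN f N (Arg z)) (charpoly N U)"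
  by (simp add: Zf_def root_sum_def)

lemma root_sum_linear_factors:
  "root_sum \<phi> (\<Prod>a\<leftarrow>as. [:- a, 1:]) = (\<Sum>a\<leftarrow>as. \<phi> a)"
proof -
  let ?p = "\<lambda>as. \<Prod>a\<leftarrow>as. [:- a, 1 :: complex:]"
  have nz: "?p as \<noteq> 0" for as by (induction as) (simp_all del: mult_pCons_left)
  have roots: "{z. poly (?p as) z = 0} = set as" for as
    by (induction as) (auto simp: add_eq_0_iff)
  \<comment> \<open>A fixed finite set S containing all roots keeps the index set unchanged when the
    induction adds a factor.\<close>
  have "(\<Sum>z\<in>S. real (Polynomial.order z (?p as)) * \<phi> z) = (\<Sum>a\<leftarrow>as. \<phi> a)"
    if "finite S" "set as \<subseteq> S" for S
    using that
  proof (induction as)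
    case (Cons a as)
    have "Polynomial.order z (?p (a # as)) = (if z = a then 1 else 0) + Polynomial.order z (?p as)" for z
      using order_mult[of "[:- a, 1:]" "?p as" z] nz[of "a # as"] by (simp add: order_linear')
    then have "(\<Sum>z\<in>S. real (Polynomial.order z (?p (a # as))) * \<phi> z) =
        (\<Sum>z\<in>S. (if z = a then \<phi> z else 0) + real (Polynomial.order z (?p as)) * \<phi> z)"
      by (intro sum.cong refl) (simp add: distrib_right)
    then show ?case using Cons by (simp add: sum.distrib)
  qed simp
  then show ?thesis by (simp add: root_sum_def roots)
qed

lemma mdet_eq_det: "mdet N A = det (Matrix.mat N N A)"
proof -
  have "(\<Prod>i<N. A (i, p i)) = (\<Prod>i = 0..<N. Matrix.mat N N A $$ (i, p i))" if "p permutes {0..<N}" for p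
    using permutes_in_image[OF that] by (auto simp: lessThan_atLeast0 intro!: prod.cong)
  then show ?thesis
    unfolding mdet_def det_def by (auto simp: lessThan_atLeast0 intro!: sum.cong)
qed

lemma charpoly_eq: "charpoly N U = char_poly (to_mat N U)"
proof -
  have "Matrix.mat N N (\<lambda>(i, j). (if i = j then [:0, 1:] else 0) - [:U (i, j):]) = char_poly_matrix (to_mat N U)"
    by (rule eq_matI) (auto simp: char_poly_matrix_def)
  then show ?thesis by (simp add: charpoly_def char_poly_def mdet_eq_det)
qed

lemma upper_triangular_pow_diag:
  assumes B: "B \<in> carrier_mat N N" "upper_triangular B"
  shows "(\<forall>i<N. \<forall>j<i. (B ^\<^sub>m k) $$ (i, j) = 0) \<and> (\<forall>i<N. (B ^\<^sub>m k) $$ (i, i) = (B $$ (i, i)) ^ k)"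
proof (induction k)
  case 0
  then show ?case using B by auto
next
  case (Suc k)
  have up: "B $$ (i, j) = 0" if "j < i" "i < N" for i j
    using B that by (auto simp: upper_triangular_def)
  have e: "(B ^\<^sub>m Suc k) $$ (i, j) = (\<Sum>l<N. (B ^\<^sub>m k) $$ (i, l) * B $$ (l, j))" if "i < N" "j < N" for i j
    using B that by (simp add: mat_mult_entry[of _ N] del: index_mult_mat(1))
  show ?case
  proof (intro conjI allI impI)
    fix i j assume ij: "i < N" "j < i"
    then have "j < N" by simp
    have "(B ^\<^sub>m k) $$ (i, l) * B $$ (l, j) = 0" if "l < N" for l
      using Suc up[of j l] ij that by (cases "l < i") auto
    then show "(B ^\<^sub>m Suc k) $$ (i, j) = 0"
      unfolding e[OF ij(1) \<open>j < N\<close>] by (intro sum.neutral) auto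
  next
    fix i assume i: "i < N"
    have "(B ^\<^sub>m Suc k) $$ (i, i) = (\<Sum>l<N. if l = i then (B ^\<^sub>m k) $$ (i, i) * B $$ (i, i) else 0)"
      unfolding e[OF i i]
    proof (intro sum.cong refl)
      fix l assume "l \<in> {..<N}"
      then show "(B ^\<^sub>m k) $$ (i, l) * B $$ (l, i) = (if l = i then (B ^\<^sub>m k) $$ (i, i) * B $$ (i, i) else 0)"
        using Suc up i by (cases l i rule: linorder_cases) auto
    qed
    then show "(B ^\<^sub>m Suc k) $$ (i, i) = (B $$ (i, i)) ^ Suc k"
      using Suc i by (simp add: power_commutes)
  qed
qed

text \<open>Schur triangularization: the diagonal of the triangular form lists the eigenvalues with
  multiplicity, and its k-th powers are the diagonal of the k-th power. One list thus serves both
  the characteristic polynomial and the traces.\<close>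

lemma eigenvalue_list:
  assumes A: "A \<in> carrier_mat N N"
  obtains as where "length as = N" "char_poly A = (\<Prod>a\<leftarrow>as. [:- a, 1:])"
    "\<And>k. tr (A ^\<^sub>m k) = (\<Sum>a\<leftarrow>as. a ^ k)"
proof -
  obtain cs where cs: "char_poly A = (\<Prod>a\<leftarrow>cs. [:- a, 1:])" using char_poly_factorized[OF A] by auto
  from schur_decomposition_exists[OF A cs] obtain B where
    B: "B \<in> carrier_mat N N" "upper_triangular B" "similar_mat A B" by auto
  from B(3) obtain P Q where w: "similar_mat_wit A B P Q" unfolding similar_mat_def by auto
  have PQ: "P \<in> carrier_mat N N" "Q \<in> carrier_mat N N" "Q * P = 1\<^sub>m N"
    using w A by (auto simp: similar_mat_wit_def Let_def)
  have tr: "tr (A ^\<^sub>m k) = (\<Sum>a\<leftarrow>diag_mat B. a ^ k)" for k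
  proof -
    have "tr (A ^\<^sub>m k) = tr (P * B ^\<^sub>m k * Q)" by (simp add: similar_mat_wit_pow_id[OF w])
    also have "\<dots> = tr (Q * (P * B ^\<^sub>m k))" by (rule tr_mult_comm[of _ N]) (use PQ B in auto)
    also have "Q * (P * B ^\<^sub>m k) = Q * P * B ^\<^sub>m k" by (rule assoc_mult_mat[symmetric, of _ N N _ N _ N]) (use PQ B in auto)
    also have "\<dots> = B ^\<^sub>m k" using PQ B by simp
    also have "tr (B ^\<^sub>m k) = (\<Sum>i<N. (B $$ (i, i)) ^ k)"
      using upper_triangular_pow_diag[OF B(1,2), of k] B(1) by (simp add: tr_def)
    also have "\<dots> = (\<Sum>a\<leftarrow>diag_mat B. a ^ k)"
      using B(1) by (simp add: diag_mat_def sum_list_sum_nth lessThan_atLeast0 o_def)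
    finally show ?thesis .
  qed
  show ?thesis
  proof (rule that[of "diag_mat B"])
    show "length (diag_mat B) = N" using B(1) by (simp add: diag_mat_def)
    show "char_poly A = (\<Prod>a\<leftarrow>diag_mat B. [:- a, 1:])"
      using char_poly_similar[OF B(3)] char_poly_upper_triangular[OF B(1,2)] by simp
  qed (rule tr)
qed

text \<open>A preserves the norm of an eigenvector. With S its squared norm this reads |z|^2 S = S,
  and S is not zero.\<close>

lemma unitary_eigenvalue:
  assumes A: "A \<in> carrier_mat N N" "hadj A * A = 1\<^sub>m N" and z: "poly (char_poly A) z = 0"
  shows "cmod z = 1"
proof -
  have "eigenvalue A z" using z eigenvalue_root_char_poly[OF A(1)] by simp
  then obtain v where v: "v \<in> carrier_vec N" "v \<noteq> 0\<^sub>v N" "A *\<^sub>v v = z \<cdot>\<^sub>v v"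
    using A(1) unfolding eigenvalue_def eigenvector_def by auto
  define x where "x i = vec_index v i" for i
  have Ax: "(\<Sum>k<N. A $$ (i, k) * x k) = z * x i" if "i < N" for i
  proof -
    have "vec_index (A *\<^sub>v v) i = (\<Sum>k<N. A $$ (i, k) * x k)"
      using A(1) v(1) that by (auto simp: scalar_prod_def x_def lessThan_atLeast0 intro!: sum.cong)
    then show ?thesis using v that by (simp add: x_def)
  qed
  have AA: "(\<Sum>i<N. cnj (A $$ (i, j)) * A $$ (i, k)) = of_bool (j = k)" if "j < N" "k < N" for j k
  proof -
    have "(\<Sum>i<N. cnj (A $$ (i, j)) * A $$ (i, k)) = (hadj A * A) $$ (j, k)"
      using A(1) that by (simp add: mat_mult_entry[of _ N] hadj_entry[of _ N] del: index_mult_mat(1))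
    also have "\<dots> = of_bool (j = k)" unfolding A(2) using that by simp
    finally show ?thesis .
  qed
  define S where "S = (\<Sum>i<N. (cmod (x i))\<^sup>2)"
  have "complex_of_real ((cmod z)\<^sup>2 * S) = (\<Sum>i<N. cnj (z * x i) * (z * x i))"
    by (simp add: S_def sum_distrib_left complex_norm_square mult_ac del: of_real_power)
  also have "\<dots> = (\<Sum>i<N. cnj (\<Sum>j<N. A $$ (i, j) * x j) * (\<Sum>k<N. A $$ (i, k) * x k))"
    by (intro sum.cong refl) (simp add: Ax)
  also have "\<dots> = (\<Sum>i<N. \<Sum>j<N. \<Sum>k<N. cnj (x j) * x k * (cnj (A $$ (i, j)) * A $$ (i, k)))"
    by (simp only: cnj_sum sum_product) (simp add: mult_ac)
  also have "\<dots> = (\<Sum>j<N. \<Sum>i<N. \<Sum>k<N. cnj (x j) * x k * (cnj (A $$ (i, j)) * A $$ (i, k)))"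
    by (rule sum.swap)
  also have "\<dots> = (\<Sum>j<N. \<Sum>k<N. \<Sum>i<N. cnj (x j) * x k * (cnj (A $$ (i, j)) * A $$ (i, k)))"
    by (rule sum.cong[OF refl]) (rule sum.swap)
  also have "\<dots> = (\<Sum>j<N. \<Sum>k<N. if k = j then cnj (x j) * x k else 0)"
  proof (intro sum.cong refl)
    fix j k assume jk: "j \<in> {..<N}" "k \<in> {..<N}"
    have "(\<Sum>i<N. cnj (x j) * x k * (cnj (A $$ (i, j)) * A $$ (i, k))) = cnj (x j) * x k * of_bool (j = k)"
      unfolding sum_distrib_left[symmetric] using AA jk by simp
    then show "(\<Sum>i<N. cnj (x j) * x k * (cnj (A $$ (i, j)) * A $$ (i, k))) = (if k = j then cnj (x j) * x k else 0)"
      by simp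
  qed
  also have "\<dots> = complex_of_real S"
    by (simp add: S_def complex_norm_square mult_ac del: of_real_power)
  finally have "(cmod z)\<^sup>2 * S = S" by (simp only: of_real_eq_iff)
  moreover have "S \<noteq> 0"
  proof
    assume "S = 0"
    then have "\<forall>i<N. x i = 0" unfolding S_def by (subst (asm) sum_nonneg_eq_0_iff) auto
    then have "v = 0\<^sub>v N" using v(1) by (intro eq_vecI) (auto simp: x_def)
    then show False using v(2) by simp
  qed
  ultimately have "(cmod z)\<^sup>2 = 1" by simp
  then show ?thesis by (simp add: abs_square_eq_1)
qed

subsection \<open>Measurability\<close>

text \<open>Every sum over roots of a polynomial of degree \<open>N\<close> is a measurable function of its
  coefficients: the map from roots to coefficients is continuous, hence maps the compact sets of
  root tuples with bounded roots and bounded value of the sum to compact sets.\<close>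

definition coeffs_of_roots :: "nat \<Rightarrow> (nat \<Rightarrow> complex) \<Rightarrow> nat \<Rightarrow> complex" where
  "coeffs_of_roots N z i = coeff (\<Prod>j<N. [:- z j, 1:]) i"

lemma continuous_coeffs_of_roots: "continuous_on UNIV (coeffs_of_roots N)"
proof (rule continuous_on_coordinatewise_then_product)
  fix i
  show "continuous_on UNIV (\<lambda>z. coeffs_of_roots N z i)"
  proof (induction N arbitrary: i)
    case 0
    then show ?case by (simp add: coeffs_of_roots_def)
  next
    case (Suc N)
    have "coeffs_of_roots (Suc N) z i = - z N * coeffs_of_roots N z i + (if i = 0 then 0 else coeffs_of_roots N z (i - 1))" for z
      by (cases i) (simp_all add: coeffs_of_roots_def)
    moreover have "continuous_on UNIV (\<lambda>z. - z N * coeffs_of_roots N z i + (if i = 0 then 0 else coeffs_of_roots N z (i - 1)))"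
      by (cases "i = 0") (auto intro!: continuous_intros Suc continuous_on_product_coordinates)
    ultimately show ?case by (simp only:)
  qed
qed

text \<open>Pinning the coordinates from N on to 0 makes the set a product of compact sets, and
  Tychonoff's theorem applies.\<close>

lemma compact_root_tuples: "compact {z :: nat \<Rightarrow> complex. (\<forall>j<N. cmod (z j) \<le> R) \<and> (\<forall>j\<ge>N. z j = 0)}"
proof -
  define S where "S j = (if j < N then cball 0 R else {0 :: complex})" for j
  have "compactin (product_topology (\<lambda>_. euclidean) UNIV) (PiE UNIV S)"
    unfolding compactin_PiE by (auto simp: S_def)
  then have "compact (PiE UNIV S)"
    by (simp add: euclidean_product_topology)
  moreover have "PiE UNIV S = {z. (\<forall>j<N. cmod (z j) \<le> R) \<and> (\<forall>j\<ge>N. z j = 0)}"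
    by (auto simp: PiE_def Pi_def S_def not_less)
  ultimately show ?thesis by simp
qed

lemma sets_root_sum_le:
  fixes \<psi> :: "complex \<Rightarrow> real"
  assumes \<psi>: "continuous_on UNIV \<psi>"
  shows "{c. \<exists>z. c = coeffs_of_roots N z \<and> (\<forall>j\<ge>N. z j = 0) \<and> (\<Sum>j<N. \<psi> (z j)) \<le> y} \<in> sets borel"
proof -
  define K where "K R = {z :: nat \<Rightarrow> complex. (\<forall>j<N. cmod (z j) \<le> R) \<and> (\<forall>j\<ge>N. z j = 0)} \<inter> {z. (\<Sum>j<N. \<psi> (z j)) \<le> y}" for R
  have "closed {z :: nat \<Rightarrow> complex. (\<Sum>j<N. \<psi> (z j)) \<le> y}"
    by (intro closed_Collect_le continuous_intros continuous_on_compose2[OF \<psi>] continuous_on_product_coordinates) auto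
  then have "compact (K R)" for R
    unfolding K_def by (intro compact_Int_closed compact_root_tuples)
  then have "compact (coeffs_of_roots N ` K R)" for R
    by (intro compact_continuous_image continuous_on_subset[OF continuous_coeffs_of_roots]) auto
  then have "(\<Union>n. coeffs_of_roots N ` K (real n)) \<in> sets borel"
    by (intro sets.countable_UN) (auto intro: borel_closed compact_imp_closed)
  also have "(\<Union>n. coeffs_of_roots N ` K (real n)) =
     {c. \<exists>z. c = coeffs_of_roots N z \<and> (\<forall>j\<ge>N. z j = 0) \<and> (\<Sum>j<N. \<psi> (z j)) \<le> y}" (is "?L = ?R")
  proof
    show "?L \<subseteq> ?R" by (auto simp: K_def)
    show "?R \<subseteq> ?L"
    proof clarify
      fix z :: "nat \<Rightarrow> complex" assume z: "\<forall>j\<ge>N. z j = 0" "(\<Sum>j<N. \<psi> (z j)) \<le> y"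
      obtain n where n: "(\<Sum>j<N. cmod (z j)) \<le> real n" using real_arch_simple by blast
      have "cmod (z j) \<le> real n" if "j < N" for j
        using member_le_sum[of j "{..<N}" "\<lambda>j. cmod (z j)"] that n by auto
      then have "z \<in> K (real n)" using z by (simp add: K_def)
      then show "coeffs_of_roots N z \<in> ?L" by blast
    qed
  qed
  finally show ?thesis .
qed

lemma charpoly_coeff_measurable: "(\<lambda>U. coeff (charpoly N U) i) \<in> borel_measurable (mat_space N)"
proof -
  let ?M = "mat_space N"
  \<comment> \<open>Measurability coefficient by coefficient. It is stable under the ring
    operations, hence passes through the Leibniz formula for the determinant.\<close>
  define pm where "pm g \<longleftrightarrow> (\<forall>i. (\<lambda>U. coeff (g U) i) \<in> borel_measurable ?M)" for g :: "cmat \<Rightarrow> complex poly"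
  have pm_const: "pm (\<lambda>U. c)" for c by (simp add: pm_def)
  have pm_mult: "pm (\<lambda>U. g U * h U)" if "pm g" "pm h" for g h
    using that unfolding pm_def coeff_mult by (auto intro!: borel_measurable_sum borel_measurable_times)
  have pm_diff: "pm (\<lambda>U. g U - h U)" if "pm g" "pm h" for g h
    using that unfolding pm_def coeff_diff by (auto intro!: borel_measurable_diff)
  have pm_sum: "pm (\<lambda>U. \<Sum>x\<in>I. g x U)" if "\<And>x. x \<in> I \<Longrightarrow> pm (g x)" for I :: "(nat \<Rightarrow> nat) set" and g
    using that unfolding pm_def coeff_sum by (auto intro!: borel_measurable_sum)
  have pm_prod: "pm (\<lambda>U. \<Prod>x\<in>I. g x U)" if "finite I" "\<And>x. x \<in> I \<Longrightarrow> pm (g x)" for I :: "nat set" and g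
    using that by (induction I rule: finite_induct) (auto intro: pm_mult pm_const)
  have pm_entry: "pm (\<lambda>U. [:U (i, j):])" if "i < N" "j < N" for i j
  proof -
    have "(\<lambda>U. U (i, j)) \<in> borel_measurable ?M"
      unfolding mat_space_def by (rule measurable_component_singleton) (use that in \<open>auto simp: idx_def\<close>)
    moreover have "coeff [:U (i, j):] k = (if k = 0 then U (i, j) else 0)" for U :: cmat and k
      by (cases k) auto
    ultimately show ?thesis unfolding pm_def by simp
  qed
  have "pm (charpoly N)"
    unfolding charpoly_def[abs_def] mdet_def case_prod_conv
  proof (intro pm_sum pm_mult pm_prod pm_diff pm_const pm_entry)
    fix p i assume "p \<in> {p. p permutes {..<N}}" "i \<in> {..<N}"
    then show "p i < N" using permutes_in_image[of p "{..<N}" i] by auto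
  qed auto
  then show ?thesis by (simp add: pm_def)
qed

lemma prod_list_nth: "(\<Prod>a\<leftarrow>as. g a) = (\<Prod>j<length as. g (as ! j))"
  for g :: "'a \<Rightarrow> 'b::comm_monoid_mult"
  by (induction as) (simp_all add: lessThan_Suc_eq_insert_0 prod.reindex)

lemma sum_list_nth: "(\<Sum>a\<leftarrow>as. g a) = (\<Sum>j<length as. g (as ! j))"
  for g :: "'a \<Rightarrow> 'b::comm_monoid_add"
  by (simp add: sum_list_sum_nth lessThan_atLeast0)

lemma root_sum_measurable_continuous:
  assumes \<psi>: "continuous_on UNIV \<psi>"
  shows "(\<lambda>U. root_sum \<psi> (charpoly N U)) \<in> borel_measurable (mat_space N)"
proof (rule borel_measurableI_le)
  fix y
  let ?C = "\<lambda>U i. coeff (charpoly N U) i"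
  let ?S = "{c. \<exists>z. c = coeffs_of_roots N z \<and> (\<forall>j\<ge>N. z j = 0) \<and> (\<Sum>j<N. \<psi> (z j)) \<le> y}"
  have C: "?C \<in> borel_measurable (mat_space N)"
    by (rule measurable_coordinatewise_then_product) (rule charpoly_coeff_measurable)
  have list: "root_sum \<psi> (\<Prod>j<N. [:- z j, 1:]) = (\<Sum>j<N. \<psi> (z j))" for z
    using root_sum_linear_factors[of \<psi> "map z [0..<N]"]
    by (simp add: prod_list_nth sum_list_nth)
  have "root_sum \<psi> (charpoly N U) \<le> y \<longleftrightarrow> ?C U \<in> ?S" for U
  proof
    assume le: "root_sum \<psi> (charpoly N U) \<le> y"
    obtain as where as: "length as = N" "char_poly (to_mat N U) = (\<Prod>a\<leftarrow>as. [:- a, 1:])"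
      using eigenvalue_list[of "to_mat N U" N] by auto
    define z where "z j = (if j < N then as ! j else 0)" for j
    have p: "charpoly N U = (\<Prod>j<N. [:- z j, 1:])"
      unfolding charpoly_eq as(2) prod_list_nth as(1) by (rule prod.cong) (auto simp: z_def)
    then have "(\<Sum>j<N. \<psi> (z j)) \<le> y" using le list by simp
    moreover have "?C U = coeffs_of_roots N z" by (rule ext) (simp add: p coeffs_of_roots_def)
    ultimately show "?C U \<in> ?S" by (auto simp: z_def)
  next
    assume "?C U \<in> ?S"
    then obtain z where z: "?C U = coeffs_of_roots N z" "(\<Sum>j<N. \<psi> (z j)) \<le> y" by blast
    then have "charpoly N U = (\<Prod>j<N. [:- z j, 1:])"
      by (intro poly_eqI) (metis coeffs_of_roots_def)
    then show "root_sum \<psi> (charpoly N U) \<le> y" using z(2) list by simp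
  qed
  then have "{U \<in> space (mat_space N). root_sum \<psi> (charpoly N U) \<le> y} = ?C -` ?S \<inter> space (mat_space N)"
    by auto
  also have "\<dots> \<in> sets (mat_space N)"
    by (rule measurable_sets[OF C sets_root_sum_le[OF \<psi>]])
  finally show "{U \<in> space (mat_space N). root_sum \<psi> (charpoly N U) \<le> y} \<in> sets (mat_space N)" .
qed

text \<open>A function of Arg z can jump at the origin, so the continuous case has to be extended to
  pointwise limits.\<close>

lemma root_sum_measurable_LIMSEQ:
  assumes "\<And>n. continuous_on UNIV (\<psi> n)" "\<And>z. (\<lambda>n. \<psi> n z) \<longlonglongrightarrow> \<phi> z"
  shows "(\<lambda>U. root_sum \<phi> (charpoly N U)) \<in> borel_measurable (mat_space N)"
proof (rule borel_measurable_LIMSEQ_real)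
  show "(\<lambda>U. root_sum (\<psi> n) (charpoly N U)) \<in> borel_measurable (mat_space N)" for n
    by (rule root_sum_measurable_continuous[OF assms(1)])
  show "(\<lambda>n. root_sum (\<psi> n) (charpoly N U)) \<longlonglongrightarrow> root_sum \<phi> (charpoly N U)" for U
    unfolding root_sum_def by (intro tendsto_intros assms(2))
qed

text \<open>Dominated convergence works with sequences, so the derivative is needed along the steps
  1/(n + 1).\<close>

lemma has_vector_derivative_LIMSEQ:
  fixes f :: "real \<Rightarrow> complex"
  assumes "(f has_vector_derivative D) (at 0)"
  shows "(\<lambda>n. real (Suc n) *\<^sub>R (f (1 / real (Suc n)) - f 0)) \<longlonglongrightarrow> D"
proof -
  have "((\<lambda>y. norm (f y - f 0 - (y - 0) *\<^sub>R D) / norm (y - 0)) \<longlongrightarrow> 0) (at 0)"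
    using assms unfolding has_vector_derivative_def has_derivative_iff_norm by blast
  moreover have "filterlim (\<lambda>n. 1 / real (Suc n)) (at 0) sequentially"
    by (rule filterlim_atI) (use LIMSEQ_inverse_real_of_nat in \<open>auto simp: inverse_eq_divide\<close>)
  ultimately have "(\<lambda>n. norm (f (1 / real (Suc n)) - f 0 - (1 / real (Suc n) - 0) *\<^sub>R D) / norm (1 / real (Suc n) - 0)) \<longlonglongrightarrow> 0"
    by (rule filterlim_compose)
  moreover have "norm (f (1 / real (Suc n)) - f 0 - (1 / real (Suc n) - 0) *\<^sub>R D) / norm (1 / real (Suc n) - 0)
      = norm (real (Suc n) *\<^sub>R (f (1 / real (Suc n)) - f 0) - D)" for n
  proof -
    have "real (Suc n) *\<^sub>R (f (1 / real (Suc n)) - f 0) - D =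
        real (Suc n) *\<^sub>R (f (1 / real (Suc n)) - f 0 - (1 / real (Suc n)) *\<^sub>R D)"
      by (simp add: scaleR_diff_right del: of_nat_Suc)
    then show ?thesis by (simp add: mult.commute del: of_nat_Suc)
  qed
  ultimately show ?thesis
    by (simp add: tendsto_norm_zero_iff Lim_null[symmetric] del: of_nat_Suc)
qed

section \<open>Left translations, one-parameter groups and bilinear forms\<close>

lemma measurable_mmul:
  assumes "sets M = sets (mat_space N)"
  shows "mmul N g \<in> measurable M M"
  unfolding measurable_cong_sets[OF assms assms]
  unfolding mat_space_def mmul_def
proof (rule measurable_restrict)
  fix ij assume "ij \<in> idx N"
  then obtain i j where ij: "ij = (i, j)" "i < N" "j < N" by (auto simp: idx_def)
  have "(\<lambda>x. x (k, j)) \<in> borel_measurable (Pi\<^sub>M (idx N) (\<lambda>_. borel))" if "k < N" for k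
    by (rule measurable_component_singleton) (use that ij in \<open>auto simp: idx_def\<close>)
  then show "(\<lambda>x. case ij of (i, j) \<Rightarrow> \<Sum>k<N. g (i, k) * x (k, j)) \<in> borel_measurable (Pi\<^sub>M (idx N) (\<lambda>_. borel))"
    unfolding ij by (auto intro!: borel_measurable_sum borel_measurable_times)
qed

text \<open>For X^3 = -X the exponential series of t X collapses to this expression, Rodrigues'
  rotation formula.\<close>

definition rot :: "nat \<Rightarrow> complex mat \<Rightarrow> real \<Rightarrow> complex mat" where
  "rot N X t = 1\<^sub>m N + complex_of_real (sin t) \<cdot>\<^sub>m X + complex_of_real (1 - cos t) \<cdot>\<^sub>m (X * X)"

lemma rot_carrier [simp]: "X \<in> carrier_mat N N \<Longrightarrow> rot N X t \<in> carrier_mat N N"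
  by (simp add: rot_def)

lemma rot_0 [simp]: "X \<in> carrier_mat N N \<Longrightarrow> rot N X 0 = 1\<^sub>m N"
  by (intro eq_matI) (auto simp: rot_def simp del: index_mult_mat(1))

text \<open>The right-hand side is the derivative of \<open>rot N X\<close> at t, so this is the
  differential equation of a one-parameter group.\<close>

lemma mult_rot:
  assumes X: "X \<in> carrier_mat N N" "X * X * X = - X"
  shows "X * rot N X t = complex_of_real (cos t) \<cdot>\<^sub>m X + complex_of_real (sin t) \<cdot>\<^sub>m (X * X)"
proof -
  have "X * (X * X) = - X" using X assoc_mult_mat[of X N N X N X N] by simp
  then have "X * rot N X t = X + complex_of_real (sin t) \<cdot>\<^sub>m (X * X) + complex_of_real (1 - cos t) \<cdot>\<^sub>m (- X)"
    using X by (simp add: rot_def mult_add_distrib_mat[of _ N N _ N] mult_smult_distrib[of _ N N _ N])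
  also have "\<dots> = complex_of_real (cos t) \<cdot>\<^sub>m X + complex_of_real (sin t) \<cdot>\<^sub>m (X * X)"
    by (rule eq_matI) (use X in \<open>auto simp: algebra_simps simp del: index_mult_mat(1)\<close>)
  finally show ?thesis .
qed

lemma mat_deriv_rot:
  assumes X: "X \<in> carrier_mat N N" "X * X * X = - X" and A: "A \<in> carrier_mat N N"
  shows "mat_deriv N (\<lambda>u. rot N X u * A) (X * (rot N X t * A)) t"
proof -
  have 1: "mat_deriv N (rot N X) (X * rot N X t) t"
    unfolding mult_rot[OF X] mat_deriv_def
  proof (intro allI impI)
    fix i j assume ij: "i < N" "j < N"
    have "((\<lambda>u. 1\<^sub>m N $$ (i, j) + complex_of_real (sin u) * X $$ (i, j) + complex_of_real (1 - cos u) * (X * X) $$ (i, j))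
      has_vector_derivative (complex_of_real (cos t) * X $$ (i, j) + complex_of_real (sin t) * (X * X) $$ (i, j))) (at t)"
      by (auto intro!: derivative_eq_intros has_vector_derivative_real_field simp del: index_mult_mat(1))
    then show "((\<lambda>u. rot N X u $$ (i, j)) has_vector_derivative
      (complex_of_real (cos t) \<cdot>\<^sub>m X + complex_of_real (sin t) \<cdot>\<^sub>m (X * X)) $$ (i, j)) (at t)"
      using X ij by (simp add: rot_def del: index_mult_mat(1))
  qed
  have 2: "mat_deriv N (\<lambda>u. A) (0\<^sub>m N N) t"
    by (simp add: mat_deriv_def)
  have "mat_deriv N (\<lambda>u. rot N X u * A) (X * rot N X t * A + rot N X t * 0\<^sub>m N N) t"
    by (rule mat_deriv_mult[OF _ _ _ _ 1 2]) (use X A in auto)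
  moreover have "X * rot N X t * A + rot N X t * 0\<^sub>m N N = X * (rot N X t * A)"
    using X A by (simp add: assoc_mult_mat[of _ N N _ N _ N] right_mult_zero_mat[of _ N])
  ultimately show ?thesis by simp
qed

definition fadj :: "nat \<Rightarrow> (nat \<Rightarrow> nat) \<Rightarrow> (nat \<Rightarrow> complex) \<Rightarrow> complex mat \<Rightarrow> complex mat" where
  "fadj N \<tau> s A = Matrix.mat N N (\<lambda>(a, b). s a * s b * A $$ (\<tau> b, \<tau> a))"

lemma fadj_carrier [simp]: "fadj N \<tau> s A \<in> carrier_mat N N"
  by (simp add: fadj_def)

text \<open>The bilinear form with matrix \<open>J\<^bsub>a,b\<^esub> = s\<^sub>a [b = \<tau> a]\<close>, where \<open>J\<^sup>T = \<epsilon> J\<close>.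
  The adjoint \<open>J\<^sup>-\<^sup>1 A\<^sup>T J\<close> of \<open>A\<close> is \<open>fadj N \<tau> s A\<close>.\<close>

locale bilinear_form =
  fixes N :: nat and \<tau> :: "nat \<Rightarrow> nat" and s :: "nat \<Rightarrow> complex" and \<epsilon> :: real
  assumes \<tau>: "\<And>a. a < N \<Longrightarrow> \<tau> a < N" "\<And>a. a < N \<Longrightarrow> \<tau> (\<tau> a) = a"
    and s: "\<And>a. a < N \<Longrightarrow> s a = 1 \<or> s a = -1" "\<And>a. a < N \<Longrightarrow> s (\<tau> a) = of_real \<epsilon> * s a"
    and \<epsilon>: "\<epsilon> = 1 \<or> \<epsilon> = -1"
begin

lemma s_sq: "a < N \<Longrightarrow> s a * s a = 1"
  using s(1)[of a] by auto

lemma \<epsilon>_sq: "\<epsilon> * \<epsilon> = 1"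
  using \<epsilon> by auto

lemma sum_\<tau>: "(\<Sum>a<N. f (\<tau> a)) = (\<Sum>a<N. f a)"
  by (rule sum.reindex_bij_witness[of _ \<tau> \<tau>]) (use \<tau> in auto)

abbreviation fa :: "complex mat \<Rightarrow> complex mat" where "fa \<equiv> fadj N \<tau> s"

lemma fa_entry: "a < N \<Longrightarrow> b < N \<Longrightarrow> fa A $$ (a, b) = s a * s b * A $$ (\<tau> b, \<tau> a)"
  by (simp add: fadj_def)

lemma fa_mult:
  assumes A: "A \<in> carrier_mat N N" "B \<in> carrier_mat N N"
  shows "fa (A * B) = fa B * fa A"
proof (rule eq_matI)
  fix a b assume "a < dim_row (fa B * fa A)" "b < dim_col (fa B * fa A)"
  then have ab: "a < N" "b < N" by (auto simp: fadj_def)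
  have "fa (A * B) $$ (a, b) = (\<Sum>c<N. s a * s b * (A $$ (\<tau> b, \<tau> c) * B $$ (\<tau> c, \<tau> a)))"
    using ab A \<tau> sum_\<tau>[of "\<lambda>c. A $$ (\<tau> b, c) * B $$ (c, \<tau> a)"]
    by (simp add: fa_entry mat_mult_entry[of _ N] flip: sum_distrib_left del: index_mult_mat(1))
  also have "\<dots> = (\<Sum>c<N. (s a * s c * B $$ (\<tau> c, \<tau> a)) * (s c * s b * A $$ (\<tau> b, \<tau> c)))"
  proof (intro sum.cong refl)
    fix c assume "c \<in> {..<N}"
    then have "(s a * s c * B $$ (\<tau> c, \<tau> a)) * (s c * s b * A $$ (\<tau> b, \<tau> c)) =
       (s c * s c) * (s a * s b * (A $$ (\<tau> b, \<tau> c) * B $$ (\<tau> c, \<tau> a)))" by (simp only: mult_ac)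
    then show "s a * s b * (A $$ (\<tau> b, \<tau> c) * B $$ (\<tau> c, \<tau> a)) =
      (s a * s c * B $$ (\<tau> c, \<tau> a)) * (s c * s b * A $$ (\<tau> b, \<tau> c))"
      using s_sq[of c] \<open>c \<in> _\<close> by simp
  qed
  also have "\<dots> = (fa B * fa A) $$ (a, b)"
    using ab by (simp add: fa_entry mat_mult_entry[of _ N] del: index_mult_mat(1))
  finally show "fa (A * B) $$ (a, b) = (fa B * fa A) $$ (a, b)" .
qed (auto simp: fadj_def)

lemma fa_one: "fa (1\<^sub>m N) = 1\<^sub>m N"
proof (rule eq_matI)
  fix a b assume "a < dim_row (1\<^sub>m N :: complex mat)" "b < dim_col (1\<^sub>m N :: complex mat)"
  then have ab: "a < N" "b < N" by auto
  moreover have "\<tau> b = \<tau> a \<longleftrightarrow> a = b" using ab \<tau> by metis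
  ultimately show "fa (1\<^sub>m N) $$ (a, b) = 1\<^sub>m N $$ (a, b)"
    using \<tau>(1) s_sq by (auto simp: fa_entry)
qed (auto simp: fadj_def)

lemma fa_pow: "A \<in> carrier_mat N N \<Longrightarrow> fa (A ^\<^sub>m k) = fa A ^\<^sub>m k"
proof (induction k)
  case 0
  then show ?case using fa_one by (auto simp: fadj_def)
next
  case (Suc k)
  have "fa A * fa A ^\<^sub>m k = fa A ^\<^sub>m k * fa A"
    using pow_mat_add[of "fa A" N 1 k] pow_mat_add[of "fa A" N k 1] by simp
  then show ?case using Suc by (simp add: fa_mult)
qed

lemma tr_fa: "A \<in> carrier_mat N N \<Longrightarrow> tr (fa A) = tr A"
proof -
  assume A: "A \<in> carrier_mat N N"
  have "tr (fa A) = (\<Sum>a<N. A $$ (\<tau> a, \<tau> a))"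
    unfolding tr_def carrier_matD(1)[OF fadj_carrier] by (simp add: fa_entry s_sq)
  then show ?thesis using A sum_\<tau>[of "\<lambda>a. A $$ (a, a)"] by (simp add: tr_def)
qed

end

text \<open>The properties of the two groups from which the loop equations are derived. The group
  may be smaller than the full isometry group, as SO(N) is. Directions are restricted to X^3 = -X,
  where the one-parameter group is explicit.\<close>

locale haar_form = prob_space M + bilinear_form N \<tau> s \<epsilon>
  for M :: "cmat measure" and N \<tau> s \<epsilon> +
  fixes G :: "cmat set"
  assumes unitary: "\<And>U. U \<in> G \<Longrightarrow> hadj (to_mat N U) * to_mat N U = 1\<^sub>m N"
    and form: "\<And>U. U \<in> G \<Longrightarrow> fa (to_mat N U) * to_mat N U = 1\<^sub>m N"
    and closed: "\<And>g U. g \<in> G \<Longrightarrow> U \<in> G \<Longrightarrow> mmul N g U \<in> G"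
    and rot_in: "\<And>X t. X \<in> carrier_mat N N \<Longrightarrow> X * X * X = - X \<Longrightarrow> hadj X = - X
        \<Longrightarrow> fa X = - X \<Longrightarrow> of_mat N (rot N X t) \<in> G"
    and sets_M: "sets M = sets (mat_space N)"
    and AE_G: "AE U in M. U \<in> G"
    and invariant: "\<And>g. g \<in> G \<Longrightarrow> distr M M (mmul N g) = M"
begin

text \<open>Boundedness is asked on G only: G has full measure, while on all of
  \<open>mat_space\<close> even the matrix entries are unbounded.\<close>

definition nice :: "(cmat \<Rightarrow> complex) \<Rightarrow> bool" where
  "nice f \<longleftrightarrow> f \<in> borel_measurable M \<and> bounded (f ` G)"

lemma nice_integrable: "nice f \<Longrightarrow> integrable M f"
proof -
  assume f: "nice f"
  then obtain C where "\<forall>x\<in>f ` G. norm x \<le> C" by (auto simp: nice_def bounded_iff)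
  then show ?thesis
    using AE_G f by (intro integrable_const_bound[of _ C]) (auto simp: nice_def)
qed

lemma nice_const [simp]: "nice (\<lambda>_. c)"
  by (simp add: nice_def) (rule bounded_subset[of "{c}"], auto)

lemma nice_add [simp]: "nice f \<Longrightarrow> nice g \<Longrightarrow> nice (\<lambda>U. f U + g U)"
  by (auto simp: nice_def intro!: bounded_plus_comp)

lemma nice_mult [simp]: "nice f \<Longrightarrow> nice g \<Longrightarrow> nice (\<lambda>U. f U * g U)"
proof -
  assume fg: "nice f" "nice g"
  then obtain B C where B: "\<forall>x\<in>f ` G. norm x \<le> B" and C: "\<forall>x\<in>g ` G. norm x \<le> C"
    by (auto simp: nice_def bounded_iff)
  have "norm (f U * g U) \<le> B * C" if "U \<in> G" for U
  proof -
    have "norm (f U) \<le> B" "norm (g U) \<le> C" using B C that by auto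
    then show ?thesis using norm_ge_zero order.trans
      unfolding norm_mult by (intro mult_mono) (auto intro: order.trans[OF norm_ge_zero])
  qed
  then have "bounded ((\<lambda>U. f U * g U) ` G)" by (auto simp: bounded_iff)
  then show ?thesis using fg by (auto simp: nice_def)
qed

lemma nice_sum: "(\<And>i. i \<in> I \<Longrightarrow> nice (f i)) \<Longrightarrow> nice (\<lambda>U. \<Sum>i\<in>I. f i U)"
  by (induction I rule: infinite_finite_induct) auto

lemma nice_sum_mset: "(\<And>i. i \<in># I \<Longrightarrow> nice (f i)) \<Longrightarrow> nice (\<lambda>U. \<Sum>i\<in>#I. f i U)"
  by (induction I) auto

lemma nice_prod_mset: "(\<And>i. i \<in># I \<Longrightarrow> nice (f i)) \<Longrightarrow> nice (\<lambda>U. \<Prod>i\<in>#I. f i U)"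
  by (induction I) auto

lemma unitary_entry_le:
  assumes "A \<in> carrier_mat N N" "hadj A * A = 1\<^sub>m N" "i < N" "j < N"
  shows "norm (A $$ (i, j)) \<le> 1"
proof -
  have "(hadj A * A) $$ (j, j) = (\<Sum>k<N. cnj (A $$ (k, j)) * A $$ (k, j))"
    using assms(1,3,4) by (simp add: mat_mult_entry[of _ N] hadj_entry[of _ N] del: index_mult_mat(1))
  also have "\<dots> = of_real (\<Sum>k<N. (norm (A $$ (k, j)))\<^sup>2)"
    by (simp add: complex_norm_square mult.commute del: of_real_power)
  finally have "(\<Sum>k<N. (norm (A $$ (k, j)))\<^sup>2) = 1"
    using assms(2,4) by (simp del: of_real_sum)
  moreover have "(norm (A $$ (i, j)))\<^sup>2 \<le> (\<Sum>k<N. (norm (A $$ (k, j)))\<^sup>2)"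
    by (rule member_le_sum) (use assms in auto)
  ultimately show ?thesis by (simp add: abs_square_le_1)
qed

lemma nice_entry [simp]:
  assumes "i < N" "j < N"
  shows "nice (\<lambda>U. to_mat N U $$ (i, j))"
proof -
  have "(\<lambda>U. to_mat N U $$ (i, j)) \<in> borel_measurable M"
    using assms unfolding measurable_cong_sets[OF sets_M refl] mat_space_def
    by (simp add: idx_def)
  moreover have "bounded ((\<lambda>U. to_mat N U $$ (i, j)) ` G)"
    unfolding bounded_iff using assms unitary unitary_entry_le[of "to_mat N _" i j]
    by (intro exI[of _ 1]) auto
  ultimately show ?thesis by (simp add: nice_def)
qed

lemma nice_coord [simp]: "i < N \<Longrightarrow> j < N \<Longrightarrow> nice (\<lambda>U. U (i, j))"
  using nice_entry[of i j] by simp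

lemma nice_matmult:
  assumes "\<And>U. A U \<in> carrier_mat N N" "\<And>U. B U \<in> carrier_mat N N"
    "\<And>i j. i < N \<Longrightarrow> j < N \<Longrightarrow> nice (\<lambda>U. A U $$ (i, j))"
    "\<And>i j. i < N \<Longrightarrow> j < N \<Longrightarrow> nice (\<lambda>U. B U $$ (i, j))"
    "i < N" "j < N"
  shows "nice (\<lambda>U. (A U * B U) $$ (i, j))"
  unfolding mat_mult_entry[OF assms(1,2,5,6)]
  by (intro nice_sum nice_mult) (use assms in auto)

lemma nice_pow [simp]: "i < N \<Longrightarrow> j < N \<Longrightarrow> nice (\<lambda>U. (to_mat N U ^\<^sub>m k) $$ (i, j))"
proof (induction k arbitrary: i j)
  case (Suc k)
  then show ?case by (simp del: index_mult_mat) (intro nice_matmult, auto)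
qed auto

lemma nice_dpow [simp]:
  assumes X: "X \<in> carrier_mat N N"
  shows "i < N \<Longrightarrow> j < N \<Longrightarrow> nice (\<lambda>U. dpow X (to_mat N U) k $$ (i, j))"
proof (induction k arbitrary: i j)
  case (Suc k)
  have "nice (\<lambda>U. (dpow X (to_mat N U) k * to_mat N U) $$ (i, j) + (to_mat N U ^\<^sub>m k * (X * to_mat N U)) $$ (i, j))"
    using Suc X by (intro nice_add nice_matmult) auto
  then show ?case using Suc.prems X by (simp del: index_mult_mat(1))
qed auto

lemma nice_tr:
  assumes "\<And>U. A U \<in> carrier_mat N N" "\<And>i j. i < N \<Longrightarrow> j < N \<Longrightarrow> nice (\<lambda>U. A U $$ (i, j))"
  shows "nice (\<lambda>U. tr (A U))"
  using carrier_matD(1)[OF assms(1)] assms(2) by (auto simp: tr_def intro!: nice_sum)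

lemma nice_tr_prod [simp]: "nice (\<lambda>U. tr_prod (to_mat N U) P)"
  unfolding tr_prod_def by (intro nice_prod_mset nice_tr) auto

lemma nice_dtr_prod [simp]: "X \<in> carrier_mat N N \<Longrightarrow> nice (\<lambda>U. dtr_prod X (to_mat N U) P)"
  unfolding dtr_prod_def by (intro nice_sum_mset nice_mult nice_tr nice_tr_prod) auto

lemma integral_mmul:
  fixes f :: "cmat \<Rightarrow> complex"
  assumes "g \<in> G" "f \<in> borel_measurable M"
  shows "(\<integral>U. f (mmul N g U) \<partial>M) = (\<integral>U. f U \<partial>M)"
proof -
  have "(\<integral>U. f U \<partial>M) = (\<integral>U. f U \<partial>distr M M (mmul N g))"
    using invariant[OF assms(1)] by simp
  also have "\<dots> = (\<integral>U. f (mmul N g U) \<partial>M)"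
    by (rule integral_distr) (use assms measurable_mmul[OF sets_M] in auto)
  finally show ?thesis ..
qed

text \<open>By invariance the mean of f(g_t U) does not depend on t, so its difference quotients
  have mean 0. Dominated convergence carries this over to the derivative at t = 0.\<close>

lemma integral_deriv_zero:
  assumes X: "X \<in> carrier_mat N N" "X * X * X = - X" "hadj X = - X" "fadj N \<tau> s X = - X"
    and nice: "nice (\<lambda>U. f (to_mat N U))" "nice (\<lambda>U. f' (to_mat N U))"
    and deriv: "\<And>F t. (\<And>u. F u \<in> carrier_mat N N) \<Longrightarrow> mat_deriv N F (X * F t) t \<Longrightarrow>
        ((\<lambda>u. f (F u)) has_vector_derivative f' (F t)) (at t)"
  shows "(\<integral>U. f' (to_mat N U) \<partial>M) = 0"
proof -
  obtain C where C: "\<And>U. U \<in> G \<Longrightarrow> norm (f' (to_mat N U)) \<le> C"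
    using nice(2) by (auto simp: nice_def bounded_iff)
  define g where "g t = of_mat N (rot N X t)" for t
  have g: "g t \<in> G" for t unfolding g_def by (rule rot_in[OF X])
  define h where "h n U = real (Suc n) *\<^sub>R (f (to_mat N (mmul N (g (1 / real (Suc n))) U)) - f (to_mat N U))" for n U
  have meas: "(\<lambda>U. f (to_mat N U)) \<in> borel_measurable M" "(\<lambda>U. f' (to_mat N U)) \<in> borel_measurable M"
    using nice by (auto simp: nice_def)
  have measg: "(\<lambda>U. f (to_mat N (mmul N (g t) U))) \<in> borel_measurable M" for t
    using measurable_compose[OF measurable_mmul[OF sets_M] meas(1)] .
  have nice_g: "nice (\<lambda>U. f (to_mat N (mmul N (g t) U)))" for t
  proof -
    have "(\<lambda>U. f (to_mat N (mmul N (g t) U))) ` G \<subseteq> (\<lambda>U. f (to_mat N U)) ` G"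
      using closed[OF g] by (intro image_subsetI) (rule image_eqI[OF refl])
    then show ?thesis using nice(1) measg by (auto simp: nice_def intro: bounded_subset)
  qed
  have F: "((\<lambda>u. f (rot N X u * to_mat N U)) has_vector_derivative f' (rot N X t * to_mat N U)) (at t)" for U t
    by (rule deriv) (use X in \<open>auto intro!: mat_deriv_rot\<close>)
  have to_mat_g: "to_mat N (g t) = rot N X t" for t
    using X by (simp add: g_def)
  have lim: "(\<lambda>n. h n U) \<longlonglongrightarrow> f' (to_mat N U)" for U
    using has_vector_derivative_LIMSEQ[OF F[of U 0]] X by (simp add: h_def to_mat_g)
  \<comment> \<open>Mean value inequality: the derivative along the curve is f' at g_t U, a point of
    G, where C bounds it.\<close>
  have bound: "norm (h n U) \<le> C" if U: "U \<in> G" for n U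
  proof -
    let ?t = "1 / real (Suc n)"
    have "norm (f (rot N X ?t * to_mat N U) - f (rot N X 0 * to_mat N U)) \<le> C * ?t - C * 0"
    proof (rule differentiable_bound_general)
      show "continuous_on {0..?t} (\<lambda>u. f (rot N X u * to_mat N U))"
        using F by (intro continuous_at_imp_continuous_on) (auto intro: has_vector_derivative_continuous)
      show "norm (f' (rot N X t * to_mat N U)) \<le> C" for t
        using C[OF closed[OF g U], of t] by (simp add: to_mat_g)
    qed (auto intro!: F derivative_eq_intros continuous_intros)
    then have "norm (f (rot N X ?t * to_mat N U) - f (to_mat N U)) \<le> C / real (Suc n)"
      using X by simp
    then show ?thesis
      by (simp add: h_def to_mat_g pos_le_divide_eq mult.commute del: of_nat_Suc)
  qed
  have "(\<lambda>n. \<integral>U. h n U \<partial>M) \<longlonglongrightarrow> (\<integral>U. f' (to_mat N U) \<partial>M)"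
  proof (rule integral_dominated_convergence[where w = "\<lambda>_. C"])
    show "h n \<in> borel_measurable M" for n
      unfolding h_def using meas(1) measg by auto
    show "AE U in M. norm (h n U) \<le> C" for n
      using AE_G by eventually_elim (rule bound)
  qed (use meas lim in auto)
  moreover have "(\<integral>U. h n U \<partial>M) = 0" for n
    unfolding h_def using nice_integrable[OF nice_g] nice_integrable[OF nice(1)]
    by (simp add: integral_mmul[OF g meas(1)] del: to_mat_mmul)
  ultimately show ?thesis by (simp add: LIMSEQ_const_iff)
qed

text \<open>The derivative of an entry of A^k times a product of traces in direction X has mean 0.
  This is complex linear in X, unlike membership in the Lie algebra, and so extends to the
  complexified Lie algebra.\<close>

definition null_dir :: "complex mat \<Rightarrow> bool" where
  "null_dir X \<longleftrightarrow> X \<in> carrier_mat N N \<and> (\<forall>k P a b. a < N \<longrightarrow> b < N \<longrightarrow>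
     (\<integral>U. dpow X (to_mat N U) k $$ (a, b) * tr_prod (to_mat N U) P
        + (to_mat N U ^\<^sub>m k) $$ (a, b) * dtr_prod X (to_mat N U) P \<partial>M) = 0)"

lemma null_dirI:
  assumes X: "X \<in> carrier_mat N N" "X * X * X = - X" "hadj X = - X" "fadj N \<tau> s X = - X"
  shows "null_dir X"
  unfolding null_dir_def
proof (intro conjI allI impI X)
  fix k P a b assume ab: "a < N" "b < N"
  show "(\<integral>U. dpow X (to_mat N U) k $$ (a, b) * tr_prod (to_mat N U) P
        + (to_mat N U ^\<^sub>m k) $$ (a, b) * dtr_prod X (to_mat N U) P \<partial>M) = 0"
  proof (rule integral_deriv_zero[OF X, of "\<lambda>A. (A ^\<^sub>m k) $$ (a, b) * tr_prod A P"
        "\<lambda>A. dpow X A k $$ (a, b) * tr_prod A P + (A ^\<^sub>m k) $$ (a, b) * dtr_prod X A P"])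
    fix F t assume F: "\<And>u. F u \<in> carrier_mat N N" "mat_deriv N F (X * F t) t"
    have "((\<lambda>u. (F u ^\<^sub>m k) $$ (a, b)) has_vector_derivative dpow X (F t) k $$ (a, b)) (at t)"
      using mat_deriv_pow[OF F(1) X(1) F(2)] ab by (auto simp: mat_deriv_def)
    from has_vector_derivative_mult[OF this has_vector_derivative_tr_prod[OF F(1) X(1) F(2)], of P]
    show "((\<lambda>u. (F u ^\<^sub>m k) $$ (a, b) * tr_prod (F u) P) has_vector_derivative
      dpow X (F t) k $$ (a, b) * tr_prod (F t) P + (F t ^\<^sub>m k) $$ (a, b) * dtr_prod X (F t) P) (at t)"
      by (simp add: add.commute)
  qed (use ab X in auto)
qed

end

section \<open>Linearity in the direction and the loop equation\<close>

lemma mat_mult3_entry: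
  assumes "A \<in> carrier_mat N N" "X \<in> carrier_mat N N" "B \<in> carrier_mat N N" "i < N" "j < N"
  shows "(A * X * B) $$ (i, j) = (\<Sum>p<N. \<Sum>q<N. A $$ (i, p) * X $$ (p, q) * B $$ (q, j))"
proof -
  have "(A * X * B) $$ (i, j) = (\<Sum>q<N. (A * X) $$ (i, q) * B $$ (q, j))"
    by (rule mat_mult_entry) (use assms in auto)
  also have "\<dots> = (\<Sum>q<N. \<Sum>p<N. A $$ (i, p) * X $$ (p, q) * B $$ (q, j))"
    using assms by (simp add: mat_mult_entry[of A N X] sum_distrib_right del: index_mult_mat(1))
  also have "\<dots> = (\<Sum>p<N. \<Sum>q<N. A $$ (i, p) * X $$ (p, q) * B $$ (q, j))"
    by (rule sum.swap)
  finally show ?thesis .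
qed

lemma dpow_lin:
  assumes "A \<in> carrier_mat N N" "X \<in> carrier_mat N N" "Y \<in> carrier_mat N N" "i < N" "j < N"
  shows "dpow (c \<cdot>\<^sub>m X + d \<cdot>\<^sub>m Y) A k $$ (i, j) = c * dpow X A k $$ (i, j) + d * dpow Y A k $$ (i, j)"
proof -
  have eq: "(A ^\<^sub>m r * Z * A ^\<^sub>m l) $$ (i, j) =
      (\<Sum>p<N. \<Sum>q<N. (A ^\<^sub>m r) $$ (i, p) * Z $$ (p, q) * (A ^\<^sub>m l) $$ (q, j))"
    if "Z \<in> carrier_mat N N" for r l Z
    by (rule mat_mult3_entry) (use that assms in auto)
  have "(A ^\<^sub>m r * (c \<cdot>\<^sub>m X + d \<cdot>\<^sub>m Y) * A ^\<^sub>m l) $$ (i, j) =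
      (\<Sum>p<N. \<Sum>q<N. c * ((A ^\<^sub>m r) $$ (i, p) * X $$ (p, q) * (A ^\<^sub>m l) $$ (q, j))
        + d * ((A ^\<^sub>m r) $$ (i, p) * Y $$ (p, q) * (A ^\<^sub>m l) $$ (q, j)))" for r l
    using assms(2,3) by (subst eq) (auto intro!: sum.cong simp: distrib_left distrib_right mult_ac)
  then have lin: "(A ^\<^sub>m r * (c \<cdot>\<^sub>m X + d \<cdot>\<^sub>m Y) * A ^\<^sub>m l) $$ (i, j) =
      c * (A ^\<^sub>m r * X * A ^\<^sub>m l) $$ (i, j) + d * (A ^\<^sub>m r * Y * A ^\<^sub>m l) $$ (i, j)" for r l
    unfolding eq[OF assms(2)] eq[OF assms(3)] sum_distrib_left by (simp only: sum.distrib)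
  have "c \<cdot>\<^sub>m X + d \<cdot>\<^sub>m Y \<in> carrier_mat N N" using assms by auto
  then show ?thesis
    unfolding dpow_entry[OF assms(1) _ assms(4,5)] dpow_entry[OF assms(1,2,4,5)] dpow_entry[OF assms(1,3,4,5)]
      lin sum_distrib_left by (simp only: sum.distrib dpow_entry[OF assms(1) _ assms(4,5)] lin sum_distrib_left)
qed

lemma tr_dpow_lin:
  assumes "A \<in> carrier_mat N N" "X \<in> carrier_mat N N" "Y \<in> carrier_mat N N"
  shows "tr (dpow (c \<cdot>\<^sub>m X + d \<cdot>\<^sub>m Y) A k) = c * tr (dpow X A k) + d * tr (dpow Y A k)"
proof -
  have "dim_row (dpow Z A k) = N" if "Z \<in> carrier_mat N N" for Z
    using dpow_carrier[OF assms(1) that, of k] by simp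
  then show ?thesis
    using assms by (simp add: tr_def dpow_lin[OF assms] sum.distrib sum_distrib_left)
qed

lemma dtr_prod_lin:
  assumes "A \<in> carrier_mat N N" "X \<in> carrier_mat N N" "Y \<in> carrier_mat N N"
  shows "dtr_prod (c \<cdot>\<^sub>m X + d \<cdot>\<^sub>m Y) A P = c * dtr_prod X A P + d * dtr_prod Y A P"
  by (simp only: dtr_prod_def tr_dpow_lin[OF assms] sum_mset_distrib_left sum_mset.distrib[symmetric])
     (simp add: algebra_simps)

context haar_form
begin

lemma null_dir_lin:
  assumes "null_dir X" "null_dir Y"
  shows "null_dir (c \<cdot>\<^sub>m X + d \<cdot>\<^sub>m Y)"
  unfolding null_dir_def
proof (intro conjI allI impI)
  have X: "X \<in> carrier_mat N N" and Y: "Y \<in> carrier_mat N N"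
    using assms by (auto simp: null_dir_def)
  then show "c \<cdot>\<^sub>m X + d \<cdot>\<^sub>m Y \<in> carrier_mat N N" by simp
  fix k P a b assume ab: "a < N" "b < N"
  define I where "I Z U = dpow Z (to_mat N U) k $$ (a, b) * tr_prod (to_mat N U) P
        + (to_mat N U ^\<^sub>m k) $$ (a, b) * dtr_prod Z (to_mat N U) P" for Z U
  have nI: "nice (I Z)" if "Z \<in> carrier_mat N N" for Z
    unfolding I_def using that ab by simp
  have "(\<integral>U. I (c \<cdot>\<^sub>m X + d \<cdot>\<^sub>m Y) U \<partial>M) = (\<integral>U. c * I X U + d * I Y U \<partial>M)"
    unfolding I_def using X Y ab
    by (intro Bochner_Integration.integral_cong refl) (simp add: dpow_lin[of _ N] dtr_prod_lin[of _ N] algebra_simps)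
  also have "\<dots> = c * (\<integral>U. I X U \<partial>M) + d * (\<integral>U. I Y U \<partial>M)"
    using nice_integrable[OF nI[OF X]] nice_integrable[OF nI[OF Y]] by simp
  also have "\<dots> = 0" using assms ab by (simp add: null_dir_def I_def)
  finally show "(\<integral>U. dpow (c \<cdot>\<^sub>m X + d \<cdot>\<^sub>m Y) (to_mat N U) k $$ (a, b) * tr_prod (to_mat N U) P
        + (to_mat N U ^\<^sub>m k) $$ (a, b) * dtr_prod (c \<cdot>\<^sub>m X + d \<cdot>\<^sub>m Y) (to_mat N U) P \<partial>M) = 0"
    unfolding I_def .
qed

text \<open>The elementary matrix E_ij minus its adjoint \<open>fa E_ij\<close>, an element of the
  complexified Lie algebra. Summing over all i and j yields the contractions that split and join
  traces.\<close>

definition Z :: "nat \<Rightarrow> nat \<Rightarrow> complex mat" where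
  "Z i j = Matrix.mat N N (\<lambda>(a, b). of_bool (a = i \<and> b = j) - s i * s j * of_bool (a = \<tau> j \<and> b = \<tau> i))"

lemma Z_carrier [simp]: "Z i j \<in> carrier_mat N N"
  by (simp add: Z_def)

text \<open>The part E_ij of \<open>Z i j\<close> splits the product into two traces; the adjoint
  part turns the second factor into its adjoint and leaves one trace. The sign \<epsilon> comes from
  \<open>s (\<tau> j)\<close> in the entry of \<open>fa C\<close>.\<close>

lemma sum_Z_split:
  assumes B: "B \<in> carrier_mat N N" and C: "C \<in> carrier_mat N N"
  shows "(\<Sum>i<N. \<Sum>j<N. (B * Z i j * C) $$ (i, j)) = tr B * tr C - of_real \<epsilon> * tr (B * fa C)"
proof -
  have "(B * Z i j * C) $$ (i, j) = B $$ (i, i) * C $$ (j, j) - of_real \<epsilon> * (B $$ (i, \<tau> j) * fa C $$ (\<tau> j, i))"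
    if ij: "i < N" "j < N" for i j
  proof -
    have "(B * Z i j * C) $$ (i, j) = (\<Sum>p<N. \<Sum>q<N. B $$ (i, p) * of_bool (p = i \<and> q = j) * C $$ (q, j)
       - s i * s j * (B $$ (i, p) * of_bool (p = \<tau> j \<and> q = \<tau> i) * C $$ (q, j)))"
      unfolding mat_mult3_entry[OF B Z_carrier C ij]
      by (intro sum.cong refl) (simp add: Z_def algebra_simps)
    also have "\<dots> = (\<Sum>p<N. \<Sum>q<N. (if q = j then if p = i then B $$ (i, p) * C $$ (q, j) else 0 else 0))
       - s i * s j * (\<Sum>p<N. \<Sum>q<N. (if q = \<tau> i then if p = \<tau> j then B $$ (i, p) * C $$ (q, j) else 0 else 0))"
      unfolding sum_subtractf sum_distrib_left
      by (intro arg_cong2[of _ _ _ _ "(-)"] sum.cong refl) auto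
    also have "\<dots> = B $$ (i, i) * C $$ (j, j) - s i * s j * (B $$ (i, \<tau> j) * C $$ (\<tau> i, j))"
      using ij \<tau> by simp
    also have "s i * s j * (B $$ (i, \<tau> j) * C $$ (\<tau> i, j)) = of_real \<epsilon> * (B $$ (i, \<tau> j) * fa C $$ (\<tau> j, i))"
    proof -
      have "of_real \<epsilon> * fa C $$ (\<tau> j, i) = of_real (\<epsilon> * \<epsilon>) * (s i * s j * C $$ (\<tau> i, j))"
        using ij \<tau> s(2) by (simp add: fa_entry)
      then show ?thesis by (simp add: \<epsilon>_sq)
    qed
    finally show ?thesis .
  qed
  then have "(\<Sum>i<N. \<Sum>j<N. (B * Z i j * C) $$ (i, j)) =
      (\<Sum>i<N. \<Sum>j<N. B $$ (i, i) * C $$ (j, j)) - of_real \<epsilon> * (\<Sum>i<N. \<Sum>j<N. B $$ (i, \<tau> j) * fa C $$ (\<tau> j, i))"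
    by (simp add: sum_subtractf sum_distrib_left)
  also have "(\<Sum>i<N. \<Sum>j<N. B $$ (i, i) * C $$ (j, j)) = tr B * tr C"
    using B C by (simp add: tr_def sum_product)
  also have "(\<Sum>i<N. \<Sum>j<N. B $$ (i, \<tau> j) * fa C $$ (\<tau> j, i)) = tr (B * fa C)"
    using B sum_\<tau>[of "\<lambda>j. B $$ (_, j) * fa C $$ (j, _)"]
    by (simp add: tr_def mat_mult_entry[of _ N] del: index_mult_mat(1))
  finally show ?thesis .
qed

text \<open>The opposite contraction: an entry of B and a separate trace are merged into one trace,
  again with a correction by the adjoint.\<close>

lemma sum_Z_join:
  assumes B: "B \<in> carrier_mat N N" and C: "C \<in> carrier_mat N N"
  shows "(\<Sum>i<N. \<Sum>j<N. B $$ (i, j) * tr (Z i j * C)) = tr (B * C) - tr (B * fa C)"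
proof -
  have "tr (Z i j * C) = C $$ (j, i) - fa C $$ (j, i)" if ij: "i < N" "j < N" for i j
  proof -
    have "dim_row (Z i j * C) = N" by (simp add: Z_def)
    then have "tr (Z i j * C) = (\<Sum>a<N. (Z i j * C) $$ (a, a))" by (simp only: tr_def)
    also have "\<dots> = (\<Sum>a<N. \<Sum>b<N. Z i j $$ (a, b) * C $$ (b, a))"
      by (intro sum.cong refl mat_mult_entry C Z_carrier) auto
    also have "\<dots> = (\<Sum>a<N. \<Sum>b<N. (if b = j then if a = i then C $$ (b, a) else 0 else 0)
       - s i * s j * (if b = \<tau> i then if a = \<tau> j then C $$ (b, a) else 0 else 0))"
      by (intro sum.cong refl) (simp add: Z_def left_diff_distrib)
    also have "\<dots> = (\<Sum>a<N. \<Sum>b<N. if b = j then if a = i then C $$ (b, a) else 0 else 0)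
       - s i * s j * (\<Sum>a<N. \<Sum>b<N. if b = \<tau> i then if a = \<tau> j then C $$ (b, a) else 0 else 0)"
      by (simp only: sum_subtractf sum_distrib_left)
    also have "\<dots> = C $$ (j, i) - s i * s j * C $$ (\<tau> i, \<tau> j)"
      using ij \<tau> by simp
    finally show ?thesis using ij by (simp add: fa_entry)
  qed
  then have "(\<Sum>i<N. \<Sum>j<N. B $$ (i, j) * tr (Z i j * C)) =
     (\<Sum>i<N. \<Sum>j<N. B $$ (i, j) * C $$ (j, i)) - (\<Sum>i<N. \<Sum>j<N. B $$ (i, j) * fa C $$ (j, i))"
    by (simp add: sum_subtractf right_diff_distrib)
  then show ?thesis
    using B C by (simp add: tr_def mat_mult_entry[of _ N] del: index_mult_mat(1))
qed

text \<open>On G the adjoint of A is its inverse, so this is the trace of A^(a - b). For negative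
  exponents the sign is dropped because the adjoint preserves traces.\<close>

lemma tr_pow_fa_pow:
  assumes U: "U \<in> G"
  defines "A \<equiv> to_mat N U"
  shows "tr (A ^\<^sub>m a * fa (A ^\<^sub>m b)) = tr (A ^\<^sub>m ndist a b)"
proof -
  have A: "A \<in> carrier_mat N N" by (simp add: A_def)
  define V where "V = fa A"
  have V: "V \<in> carrier_mat N N" by (simp add: V_def)
  have VA: "V * A = 1\<^sub>m N" using form[OF U] by (simp add: V_def A_def)
  have AV: "A * V = 1\<^sub>m N" by (rule mat_mult_left_right_inverse[OF V A VA])
  have Vpow: "fa (A ^\<^sub>m n) = V ^\<^sub>m n" for n by (simp add: V_def fa_pow[OF A])
  have trV: "tr (V ^\<^sub>m n) = tr (A ^\<^sub>m n)" for n
    using tr_fa[of "A ^\<^sub>m n"] A by (simp add: Vpow)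
  have cancel: "A ^\<^sub>m n * V ^\<^sub>m n = 1\<^sub>m N" for n
  proof (induction n)
    case (Suc n)
    have "A ^\<^sub>m Suc n * V ^\<^sub>m Suc n = A ^\<^sub>m n * A * (V * V ^\<^sub>m n)"
      using pow_mat_add[OF V, of 1 n] V by simp
    also have "\<dots> = A ^\<^sub>m n * (A * V) * V ^\<^sub>m n"
      using A V by (simp add: assoc_mult_mat[of _ N N _ N _ N])
    finally show ?case using Suc AV A V by (simp add: right_mult_one_mat[of _ N])
  qed (use A V in simp)
  show ?thesis
  proof (cases "b \<le> a")
    case True
    then have "A ^\<^sub>m a * V ^\<^sub>m b = A ^\<^sub>m (a - b) * (A ^\<^sub>m b * V ^\<^sub>m b)"
      using A V by (simp add: assoc_mult_mat[of _ N N _ N _ N, symmetric] pow_mat_add)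
    then show ?thesis using True A by (simp add: Vpow cancel ndist_def right_mult_one_mat[of _ N])
  next
    case False
    then have "A ^\<^sub>m a * V ^\<^sub>m b = (A ^\<^sub>m a * V ^\<^sub>m a) * V ^\<^sub>m (b - a)"
      using A V by (simp add: assoc_mult_mat[of _ N N _ N _ N] pow_mat_add)
    then show ?thesis using False V by (simp add: Vpow cancel ndist_def trV)
  qed
qed

definition mom :: "nat multiset \<Rightarrow> real" where
  "mom P = Re (\<integral>U. tr_prod (to_mat N U) P \<partial>M)"

lemma mom_empty: "mom {#} = 1"
  by (simp add: mom_def tr_prod_def prob_space)

lemma mom_add_0: "mom (add_mset 0 P) = real N * mom P"
  by (simp add: mom_def tr_prod_def tr_def)

text \<open>The loop equation before integration. The entry (i, j) of A^k is paired with the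
  direction \<open>Z i j\<close>: differentiating the power splits a trace, differentiating the
  product of traces joins one to A^k.\<close>

lemma sum_Z_deriv:
  assumes U: "U \<in> G"
  defines "A \<equiv> to_mat N U"
  shows "(\<Sum>i<N. \<Sum>j<N. dpow (Z i j) A k $$ (i, j) * tr_prod A P + (A ^\<^sub>m k) $$ (i, j) * dtr_prod (Z i j) A P) =
    (\<Sum>r<k. tr_prod A (add_mset r (add_mset (k - r) P)) - of_real \<epsilon> * tr_prod A (add_mset (ndist (2 * r) k) P))
   + (\<Sum>l\<in>#P. of_nat l * (tr_prod A (add_mset (k + l) (P - {#l#})) - tr_prod A (add_mset (ndist k l) (P - {#l#}))))"
proof -
  have A: "A \<in> carrier_mat N N" by (simp add: A_def)
  have "(\<Sum>i<N. \<Sum>j<N. dpow (Z i j) A k $$ (i, j)) =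
      (\<Sum>i<N. \<Sum>j<N. \<Sum>r<k. (A ^\<^sub>m r * Z i j * A ^\<^sub>m (k - r)) $$ (i, j))"
    by (intro sum.cong refl dpow_entry[OF A]) auto
  also have "\<dots> = (\<Sum>i<N. \<Sum>r<k. \<Sum>j<N. (A ^\<^sub>m r * Z i j * A ^\<^sub>m (k - r)) $$ (i, j))"
    by (rule sum.cong[OF refl]) (rule sum.swap)
  also have "\<dots> = (\<Sum>r<k. \<Sum>i<N. \<Sum>j<N. (A ^\<^sub>m r * Z i j * A ^\<^sub>m (k - r)) $$ (i, j))"
    by (rule sum.swap)
  also have "\<dots> = (\<Sum>r<k. tr (A ^\<^sub>m r) * tr (A ^\<^sub>m (k - r)) - of_real \<epsilon> * tr (A ^\<^sub>m ndist (2 * r) k))"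
  proof (intro sum.cong refl)
    fix r assume "r \<in> {..<k}"
    then have "ndist r (k - r) = ndist (2 * r) k" by (auto simp: ndist_def)
    then show "(\<Sum>i<N. \<Sum>j<N. (A ^\<^sub>m r * Z i j * A ^\<^sub>m (k - r)) $$ (i, j)) =
      tr (A ^\<^sub>m r) * tr (A ^\<^sub>m (k - r)) - of_real \<epsilon> * tr (A ^\<^sub>m ndist (2 * r) k)"
      using A tr_pow_fa_pow[OF U] by (subst sum_Z_split) (auto simp: A_def)
  qed
  finally have "(\<Sum>i<N. \<Sum>j<N. dpow (Z i j) A k $$ (i, j) * tr_prod A P) =
     (\<Sum>r<k. tr (A ^\<^sub>m r) * tr (A ^\<^sub>m (k - r)) - of_real \<epsilon> * tr (A ^\<^sub>m ndist (2 * r) k)) * tr_prod A P"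
    by (simp only: sum_distrib_right[symmetric])
  also have "\<dots> =
     (\<Sum>r<k. tr_prod A (add_mset r (add_mset (k - r) P)) - of_real \<epsilon> * tr_prod A (add_mset (ndist (2 * r) k) P))"
    unfolding sum_distrib_right by (rule sum.cong) (simp_all add: tr_prod_def algebra_simps)
  finally have 1: "(\<Sum>i<N. \<Sum>j<N. dpow (Z i j) A k $$ (i, j) * tr_prod A P) =
     (\<Sum>r<k. tr_prod A (add_mset r (add_mset (k - r) P)) - of_real \<epsilon> * tr_prod A (add_mset (ndist (2 * r) k) P))" .
  have dZ: "dtr_prod (Z i j) A P = (\<Sum>l\<in>#P. of_nat l * tr (Z i j * A ^\<^sub>m l) * tr_prod A (P - {#l#}))" for i j
    by (simp add: dtr_prod_def tr_dpow[OF A Z_carrier])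
  have sm: "(\<Sum>i\<in>I. \<Sum>l\<in>#Q. f i l) = (\<Sum>l\<in>#Q. \<Sum>i\<in>I. f i l)"
    for I :: "nat set" and Q :: "nat multiset" and f :: "nat \<Rightarrow> nat \<Rightarrow> complex"
    by (induction Q) (simp_all add: sum.distrib)
  have "(\<Sum>i<N. \<Sum>j<N. (A ^\<^sub>m k) $$ (i, j) * dtr_prod (Z i j) A P) =
     (\<Sum>l\<in>#P. \<Sum>i<N. \<Sum>j<N. (A ^\<^sub>m k) $$ (i, j) * (of_nat l * tr (Z i j * A ^\<^sub>m l) * tr_prod A (P - {#l#})))"
    unfolding dZ sum_mset_distrib_left sm ..
  also have "\<dots> = (\<Sum>l\<in>#P. of_nat l * (tr_prod A (add_mset (k + l) (P - {#l#})) - tr_prod A (add_mset (ndist k l) (P - {#l#}))))"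
  proof (intro arg_cong[of _ _ sum_mset] image_mset_cong)
    fix l
    have "(\<Sum>i<N. \<Sum>j<N. (A ^\<^sub>m k) $$ (i, j) * (of_nat l * tr (Z i j * A ^\<^sub>m l) * tr_prod A (P - {#l#}))) =
       (of_nat l * tr_prod A (P - {#l#})) * (\<Sum>i<N. \<Sum>j<N. (A ^\<^sub>m k) $$ (i, j) * tr (Z i j * A ^\<^sub>m l))"
      by (simp add: sum_distrib_left algebra_simps)
    also have "(\<Sum>i<N. \<Sum>j<N. (A ^\<^sub>m k) $$ (i, j) * tr (Z i j * A ^\<^sub>m l)) = tr (A ^\<^sub>m (k + l)) - tr (A ^\<^sub>m ndist k l)"
      using tr_pow_fa_pow[OF U, of k l, folded A_def] pow_mat_add[OF A, of k l]
        sum_Z_join[of "A ^\<^sub>m k" "A ^\<^sub>m l"] A by simp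
    finally show "(\<Sum>i<N. \<Sum>j<N. (A ^\<^sub>m k) $$ (i, j) * (of_nat l * tr (Z i j * A ^\<^sub>m l) * tr_prod A (P - {#l#}))) =
      of_nat l * (tr_prod A (add_mset (k + l) (P - {#l#})) - tr_prod A (add_mset (ndist k l) (P - {#l#})))"
      by (simp add: tr_prod_def algebra_simps)
  qed
  finally show ?thesis using 1 by (simp add: sum.distrib)
qed

lemma loop_eq_mom:
  assumes null: "\<And>i j. i < N \<Longrightarrow> j < N \<Longrightarrow> null_dir (Z i j)"
  shows "loop_eq \<epsilon> mom k P"
proof -
  define T where "T Q U = tr_prod (to_mat N U) Q" for Q U
  have iT: "integrable M (T Q)" for Q unfolding T_def by (rule nice_integrable) simp
  have isum: "integrable M (\<lambda>U. \<Sum>l\<in>#Q. f l U)" "(\<integral>U. (\<Sum>l\<in>#Q. f l U) \<partial>M) = (\<Sum>l\<in>#Q. \<integral>U. f l U \<partial>M)"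
    if "\<And>l. integrable M (f l)" for Q :: "nat multiset" and f :: "nat \<Rightarrow> cmat \<Rightarrow> complex"
    by (induction Q) (use that in auto)
  have ReT: "Re (\<integral>U. T Q U \<partial>M) = mom Q" for Q by (simp add: T_def mom_def)
  define D where "D i j U = dpow (Z i j) (to_mat N U) k $$ (i, j) * tr_prod (to_mat N U) P
     + (to_mat N U ^\<^sub>m k) $$ (i, j) * dtr_prod (Z i j) (to_mat N U) P" for i j U
  let ?R = "\<lambda>U. (\<Sum>r<k. T (add_mset r (add_mset (k - r) P)) U - of_real \<epsilon> * T (add_mset (ndist (2 * r) k) P) U)
   + (\<Sum>l\<in>#P. of_nat l * (T (add_mset (k + l) (P - {#l#})) U - T (add_mset (ndist k l) (P - {#l#})) U))"
  have nD: "nice (D i j)" if "i < N" "j < N" for i j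
    unfolding D_def using that by simp
  have "0 = (\<Sum>i<N. \<Sum>j<N. \<integral>U. D i j U \<partial>M)"
    using null by (intro sum.neutral[symmetric]) (auto simp: null_dir_def D_def intro!: sum.neutral)
  also have "\<dots> = (\<integral>U. (\<Sum>i<N. \<Sum>j<N. D i j U) \<partial>M)"
  proof -
    have iD: "integrable M (D i j)" if "i < N" "j < N" for i j
      using nice_integrable[OF nD] that .
    have "(\<integral>U. (\<Sum>i<N. \<Sum>j<N. D i j U) \<partial>M) = (\<Sum>i<N. \<integral>U. (\<Sum>j<N. D i j U) \<partial>M)"
      by (rule Bochner_Integration.integral_sum) (intro Bochner_Integration.integrable_sum iD, auto)
    also have "\<dots> = (\<Sum>i<N. \<Sum>j<N. \<integral>U. D i j U \<partial>M)"
      by (rule sum.cong[OF refl], rule Bochner_Integration.integral_sum) (intro iD, auto)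
    finally show ?thesis ..
  qed
  also have "\<dots> = (\<integral>U. ?R U \<partial>M)"
  proof (rule integral_cong_AE)
    have "nice (\<lambda>U. \<Sum>i<N. \<Sum>j<N. D i j U)" by (intro nice_sum nD) auto
    then show "(\<lambda>U. \<Sum>i<N. \<Sum>j<N. D i j U) \<in> borel_measurable M" by (simp add: nice_def)
    show "?R \<in> borel_measurable M"
      using iT isum by (intro borel_measurable_integrable) auto
    show "AE U in M. (\<Sum>i<N. \<Sum>j<N. D i j U) = ?R U"
      using AE_G by eventually_elim (simp only: sum_Z_deriv T_def D_def)
  qed
  also have "\<dots> = (\<Sum>r<k. (\<integral>U. T (add_mset r (add_mset (k - r) P)) U \<partial>M) - of_real \<epsilon> * (\<integral>U. T (add_mset (ndist (2 * r) k) P) U \<partial>M))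
   + (\<Sum>l\<in>#P. of_nat l * ((\<integral>U. T (add_mset (k + l) (P - {#l#})) U \<partial>M) - (\<integral>U. T (add_mset (ndist k l) (P - {#l#})) U \<partial>M)))"
    using iT isum by simp
  finally have "0 = Re \<dots>" by simp
  moreover have "Re (\<Sum>l\<in>#Q. f l) = (\<Sum>l\<in>#Q. Re (f l))" for Q :: "nat multiset" and f
    by (induction Q) auto
  ultimately show ?thesis
    unfolding loop_eq_def by (simp add: ReT)
qed

lemma mom_eq_joint:
  assumes "\<And>i j. i < N \<Longrightarrow> j < N \<Longrightarrow> null_dir (Z i j)" "sum_mset P < N"
  shows "mom P = joint \<epsilon> (real N) P"
proof (rule loop_eq_unique[OF \<epsilon>_sq _ mom_empty mom_add_0])
  \<comment> \<open>For \<epsilon> = 1 the required inequality is just degree < N; for \<epsilon> =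
    -1 it leaves room.\<close>
  have "real (sum_mset P) < real N" using assms(2) by (simp only: of_nat_less_iff)
  moreover have "\<epsilon> \<le> 1" using \<epsilon> by auto
  ultimately show "real (sum_mset P) - 1 < real N - \<epsilon>" by linarith
qed (rule loop_eq_mom[OF assms(1)])

lemma nice_lin: "nice (\<lambda>U. (of_real a + (\<Sum>j\<in>J. of_real (c j) * tr (to_mat N U ^\<^sub>m j))) ^ k)"
  by (induction k) (auto intro!: nice_add nice_mult nice_sum nice_tr)

lemma integral_lin_pow:
  assumes "finite J"
  shows "Re (\<integral>U. (of_real a + (\<Sum>j\<in>J. of_real (c j) * tr (to_mat N U ^\<^sub>m j))) ^ k * tr_prod (to_mat N U) P \<partial>M)
    = lin_moment mom J a c k P"
proof (induction k arbitrary: P)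
  case (Suc k)
  define S where "S U = of_real a + (\<Sum>j\<in>J. of_real (c j) * tr (to_mat N U ^\<^sub>m j))" for U
  have int: "integrable M (\<lambda>U. S U ^ k * tr_prod (to_mat N U) Q)" for Q
    unfolding S_def by (intro nice_integrable nice_mult nice_lin) simp
  have *: "S U ^ Suc k * tr_prod (to_mat N U) P = of_real a * (S U ^ k * tr_prod (to_mat N U) P)
    + (\<Sum>j\<in>J. of_real (c j) * (S U ^ k * tr_prod (to_mat N U) (add_mset j P)))" for U
  proof -
    have "S U ^ Suc k * tr_prod (to_mat N U) P = S U * (S U ^ k * tr_prod (to_mat N U) P)" by simp
    also have "\<dots> = of_real a * (S U ^ k * tr_prod (to_mat N U) P)
      + (\<Sum>j\<in>J. of_real (c j) * tr (to_mat N U ^\<^sub>m j)) * (S U ^ k * tr_prod (to_mat N U) P)"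
      by (subst (1) S_def) (rule distrib_right)
    also have "(\<Sum>j\<in>J. of_real (c j) * tr (to_mat N U ^\<^sub>m j)) * (S U ^ k * tr_prod (to_mat N U) P) =
      (\<Sum>j\<in>J. of_real (c j) * (S U ^ k * tr_prod (to_mat N U) (add_mset j P)))"
      unfolding sum_distrib_right by (simp add: tr_prod_def mult_ac)
    finally show ?thesis .
  qed
  have "Re (\<integral>U. S U ^ Suc k * tr_prod (to_mat N U) P \<partial>M) = a * lin_moment mom J a c k P +
      (\<Sum>j\<in>J. c j * lin_moment mom J a c k (add_mset j P))"
    unfolding * using int Suc.IH by (simp add: S_def)
  then show ?case unfolding S_def by simp
qed (simp add: mom_def)

theorem lin_pow_gauss:
  assumes "\<And>i j. i < N \<Longrightarrow> j < N \<Longrightarrow> null_dir (Z i j)"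
    and J: "finite J" "0 \<notin> J" "\<And>j. j \<in> J \<Longrightarrow> k * j < N" and "N > 0"
  shows "Re (\<integral>U. (of_real a + (\<Sum>j\<in>J. of_real (c j) * tr (to_mat N U ^\<^sub>m j))) ^ k \<partial>M) =
    gauss_moment (a + \<epsilon> * (\<Sum>j\<in>J. of_bool (even j) * c j)) (\<Sum>j\<in>J. real j * (c j)\<^sup>2) k"
proof -
  \<comment> \<open>Every index satisfies k j \<le> N - 1, so k times a sum of at most k indices is
    at most k (N - 1).\<close>
  have small: "sum_mset P < N" if "set_mset P \<subseteq> J" "size P \<le> k" for P
  proof (cases "k = 0")
    case False
    have "\<exists>t. t = sum_mset P \<and> k * t \<le> size P * (N - 1)"
      using that(1)
    proof (induction P)
      case (add x P)
      then have "k * x \<le> N - 1" using J(3)[of x] by auto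
      moreover obtain t where "t = sum_mset P" "k * t \<le> size P * (N - 1)" using add by auto
      ultimately have "x + t = sum_mset (add_mset x P)" "k * (x + t) \<le> size (add_mset x P) * (N - 1)"
        by (simp, simp only: distrib_left size_add_mset mult_Suc add_mono)
      then show ?case by blast
    qed simp
    then obtain t where t: "t = sum_mset P" "k * t \<le> size P * (N - 1)" by blast
    have "size P * (N - 1) \<le> k * (N - 1)" using that by simp
    with t(2) have "k * t \<le> k * (N - 1)" by (rule order.trans)
    then show ?thesis using False \<open>N > 0\<close> unfolding t(1)[symmetric] mult_le_cancel1 by linarith
  qed (use that \<open>N > 0\<close> in auto)
  have "lin_moment mom J a c k {#} = lin_moment (joint \<epsilon> (real N)) J a c k {#}"
    by (rule lin_moment_cong[of J k]) (use mom_eq_joint[OF assms(1)] small in auto)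
  then show ?thesis
    using integral_lin_pow[OF J(1), of a c k "{#}"] lin_moment_joint[OF J(1,2)] by (simp add: tr_prod_def)
qed

end

section \<open>The special orthogonal and the symplectic group\<close>

lemma of_mat_to_mat: "U \<in> space (mat_space N) \<Longrightarrow> of_mat N (to_mat N U) = U"
  by (rule ext) (force simp: of_mat_def mat_space_def space_PiM idx_def PiE_def extensional_def)

lemma of_mat_eq_iff:
  assumes "A \<in> carrier_mat N N" "B \<in> carrier_mat N N"
  shows "of_mat N A = of_mat N B \<longleftrightarrow> A = B"
  using assms by (metis to_mat_of_mat)

lemma mmul_in_space [simp]: "mmul N g U \<in> space (mat_space N)"
  by (simp add: mmul_eq)

lemma haar_AE:
  assumes "is_haar N G M"
  shows "AE U in M. U \<in> G"
proof -
  interpret prob_space M using assms by (simp add: is_haar_def)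
  show ?thesis
    by (rule AE_prob_1) (use assms in \<open>simp add: is_haar_def emeasure_eq_measure\<close>)
qed

text \<open>\<open>is_haar\<close> speaks of images of subsets of G, the push-forward of preimages.
  They match on G because g has an inverse there, and the complement of G is a null set.\<close>

lemma haar_invariant:
  assumes H: "is_haar N G M"
    and closed: "\<And>g h. g \<in> G \<Longrightarrow> h \<in> G \<Longrightarrow> mmul N g h \<in> G"
    and G: "G \<subseteq> space (mat_space N)"
    and inv: "\<And>g. g \<in> G \<Longrightarrow> \<exists>h\<in>G. to_mat N g * to_mat N h = 1\<^sub>m N"
    and g: "g \<in> G"
  shows "distr M M (mmul N g) = M"
proof (rule measure_eqI)
  have sets: "sets M = sets (mat_space N)" and GM: "G \<in> sets M"
    using H by (auto simp: is_haar_def)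
  have meas: "mmul N g \<in> measurable M M" by (rule measurable_mmul[OF sets])
  fix A assume "A \<in> sets (distr M M (mmul N g))"
  then have A: "A \<in> sets M" by simp
  define B where "B = (mmul N g -` A \<inter> space M) \<inter> G"
  have B: "B \<in> sets M" "B \<subseteq> G"
    using measurable_sets[OF meas A] GM by (auto simp: B_def)
  have "mmul N g ` B = A \<inter> G"
  proof safe
    fix U assume "U \<in> A" "U \<in> G"
    obtain h where h: "h \<in> G" "to_mat N g * to_mat N h = 1\<^sub>m N" using inv[OF g] by auto
    have "mmul N g (mmul N h U) = of_mat N (to_mat N g * to_mat N h * to_mat N U)"
      unfolding mmul_eq[of N g] to_mat_mmul
      by (subst assoc_mult_mat[of _ N N _ N _ N]) auto
    also have "\<dots> = U" using h(2) \<open>U \<in> G\<close> G by (simp add: of_mat_to_mat subset_iff)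
    finally have "mmul N g (mmul N h U) = U" .
    moreover from this have "mmul N h U \<in> B"
      using closed[OF h(1) \<open>U \<in> G\<close>] \<open>U \<in> A\<close> GM sets.sets_into_space[OF GM] by (auto simp: B_def)
    ultimately show "U \<in> mmul N g ` B" by (metis imageI)
  qed (use closed[OF g] in \<open>auto simp: B_def\<close>)
  then have "emeasure M B = emeasure M (A \<inter> G)"
    using H g B unfolding is_haar_def by metis
  also have "\<dots> = emeasure M A"
    by (rule emeasure_eq_AE) (use haar_AE[OF H] A GM in auto)
  also have "emeasure M B = emeasure M (mmul N g -` A \<inter> space M)"
    by (rule emeasure_eq_AE) (use haar_AE[OF H] B measurable_sets[OF meas A] in \<open>auto simp: B_def\<close>)
  finally show "emeasure (distr M M (mmul N g)) A = emeasure M A"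
    using meas A by (simp add: emeasure_distr)
qed simp

text \<open>The one-parameter group law, from the addition formulas. Both adjoints reverse the sign
  of t, so it shows that rotations lie in the isometry group; halving t will give their
  determinant.\<close>

lemma rot_add:
  assumes X: "X \<in> carrier_mat N N" "X * X * X = - X"
  shows "rot N X u * rot N X t = rot N X (u + t)"
proof -
  define B where "B = rot N X t"
  have B: "B \<in> carrier_mat N N" using X by (simp add: B_def)
  have XXX: "X * (X * X) = - X" using X assoc_mult_mat[of X N N X N X N] by simp
  have XB: "X * B = complex_of_real (cos t) \<cdot>\<^sub>m X + complex_of_real (sin t) \<cdot>\<^sub>m (X * X)"
    unfolding B_def by (rule mult_rot[OF X])
  have "(X * X) * B = X * (X * B)" using X B by (simp add: assoc_mult_mat[of _ N N _ N _ N])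
  also have "\<dots> = complex_of_real (cos t) \<cdot>\<^sub>m (X * X) + complex_of_real (sin t) \<cdot>\<^sub>m (- X)"
    unfolding XB using X XXX
    by (simp add: mult_add_distrib_mat[of _ N N _ N] mult_smult_distrib[of _ N N _ N])
  finally have XXB: "(X * X) * B = complex_of_real (cos t) \<cdot>\<^sub>m (X * X) + complex_of_real (sin t) \<cdot>\<^sub>m (- X)" .
  define XX where "XX = X * X"
  have XX: "XX \<in> carrier_mat N N" using X by (simp add: XX_def)
  have "rot N X u * B = (1\<^sub>m N + complex_of_real (sin u) \<cdot>\<^sub>m X) * B + (complex_of_real (1 - cos u) \<cdot>\<^sub>m XX) * B"
    unfolding rot_def XX_def[symmetric] using X B XX by (intro add_mult_distrib_mat) auto
  also have "(1\<^sub>m N + complex_of_real (sin u) \<cdot>\<^sub>m X) * B = 1\<^sub>m N * B + (complex_of_real (sin u) \<cdot>\<^sub>m X) * B"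
    using X B by (intro add_mult_distrib_mat) auto
  also have "(complex_of_real (sin u) \<cdot>\<^sub>m X) * B = complex_of_real (sin u) \<cdot>\<^sub>m (X * B)"
    using X B by (intro mult_smult_assoc_mat) auto
  also have "(complex_of_real (1 - cos u) \<cdot>\<^sub>m XX) * B = complex_of_real (1 - cos u) \<cdot>\<^sub>m (XX * B)"
    using XX B by (intro mult_smult_assoc_mat) auto
  finally have eq: "rot N X u * B = B + complex_of_real (sin u) \<cdot>\<^sub>m (X * B) + complex_of_real (1 - cos u) \<cdot>\<^sub>m (XX * B)"
    using B by simp
  show ?thesis
  proof (rule eq_matI)
    fix i j assume "i < dim_row (rot N X (u + t))" "j < dim_col (rot N X (u + t))"
    then have ij: "i < N" "j < N" using X by (auto simp: rot_def)
    show "(rot N X u * rot N X t) $$ (i, j) = rot N X (u + t) $$ (i, j)"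
      unfolding B_def[symmetric] eq unfolding XB XXB[folded XX_def] unfolding B_def rot_def XX_def[symmetric]
      using ij X XX by (simp add: sin_add cos_add algebra_simps)
  qed (use X in \<open>auto simp: rot_def\<close>)
qed

lemma hadj_rot:
  assumes "X \<in> carrier_mat N N" "hadj X = - X"
  shows "hadj (rot N X t) = rot N X (- t)"
proof (rule eq_matI)
  fix i j assume "i < dim_row (rot N X (- t))" "j < dim_col (rot N X (- t))"
  then have ij: "i < N" "j < N" using assms by (auto simp: rot_def)
  have "hadj (X * X) = X * X"
    using hadj_mult[OF assms(1,1)] assms by simp
  then have "cnj ((X * X) $$ (j, i)) = (X * X) $$ (i, j)"
    using hadj_entry[of "X * X" N i j] assms ij by simp
  moreover have "cnj (X $$ (j, i)) = - X $$ (i, j)"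
    using hadj_entry[of X N i j] assms ij by simp
  ultimately show "hadj (rot N X t) $$ (i, j) = rot N X (- t) $$ (i, j)"
    using assms ij by (simp add: hadj_entry[of _ N] rot_def del: index_mult_mat(1))
qed (use assms in \<open>auto simp: rot_def hadj_def\<close>)

lemma hadj_hadj: "A \<in> carrier_mat N N \<Longrightarrow> hadj (hadj A) = A"
  by (auto simp: hadj_def)

context bilinear_form
begin

lemma fa_fa: "A \<in> carrier_mat N N \<Longrightarrow> fa (fa A) = A"
proof (rule eq_matI)
  fix i j assume A: "A \<in> carrier_mat N N" and "i < dim_row A" "j < dim_col A"
  then have ij: "i < N" "j < N" by auto
  have "fa (fa A) $$ (i, j) = of_real (\<epsilon> * \<epsilon>) * (s i * s i) * (s j * s j) * A $$ (i, j)"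
    using ij \<tau> s(2) by (simp add: fa_entry)
  then show "fa (fa A) $$ (i, j) = A $$ (i, j)" using ij by (simp add: s_sq \<epsilon>_sq)
qed (auto simp: fadj_def)

lemma fa_rot:
  assumes "X \<in> carrier_mat N N" "fa X = - X"
  shows "fa (rot N X t) = rot N X (- t)"
proof (rule eq_matI)
  fix i j assume "i < dim_row (rot N X (- t))" "j < dim_col (rot N X (- t))"
  then have ij: "i < N" "j < N" using assms by (auto simp: rot_def)
  have "fa (X * X) = X * X"
    using fa_mult[OF assms(1,1)] assms by simp
  then have 1: "s i * s j * ((X * X) $$ (\<tau> j, \<tau> i)) = (X * X) $$ (i, j)"
    using fa_entry[of i j "X * X"] ij by simp
  have 2: "s i * s j * X $$ (\<tau> j, \<tau> i) = - X $$ (i, j)"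
    using fa_entry[of i j X] assms ij by simp
  have 3: "s i * s j * (1\<^sub>m N) $$ (\<tau> j, \<tau> i) = (1\<^sub>m N) $$ (i, j)"
    using fa_entry[of i j "1\<^sub>m N"] ij by (simp add: fa_one)
  have "fa (rot N X t) $$ (i, j) = s i * s j * (1\<^sub>m N) $$ (\<tau> j, \<tau> i)
     + complex_of_real (sin t) * (s i * s j * X $$ (\<tau> j, \<tau> i))
     + complex_of_real (1 - cos t) * (s i * s j * ((X * X) $$ (\<tau> j, \<tau> i)))"
    using assms(1) ij \<tau> by (simp add: fa_entry rot_def algebra_simps del: index_mult_mat(1) index_one_mat)
  also have "\<dots> = rot N X (- t) $$ (i, j)"
    unfolding 1 2 3 using assms(1) ij by (simp add: rot_def del: index_mult_mat(1))
  finally show "fa (rot N X t) $$ (i, j) = rot N X (- t) $$ (i, j)" .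
qed (use assms in \<open>auto simp: rot_def fadj_def\<close>)

text \<open>The unitary isometries of the form. Both adjoints are then the inverse, so they
  coincide; for the identity form this makes the matrices real.\<close>

definition grp :: "cmat set" where
  "grp = {U \<in> space (mat_space N). hadj (to_mat N U) * to_mat N U = 1\<^sub>m N \<and> fa (to_mat N U) * to_mat N U = 1\<^sub>m N}"

lemma grp_closed:
  assumes "g \<in> grp" "h \<in> grp"
  shows "mmul N g h \<in> grp"
proof -
  define A B where "A = to_mat N g" and "B = to_mat N h"
  have AB: "A \<in> carrier_mat N N" "B \<in> carrier_mat N N" by (auto simp: A_def B_def)
  have *: "(B' * A') * (A * B) = 1\<^sub>m N"
    if "A' \<in> carrier_mat N N" "B' \<in> carrier_mat N N" "A' * A = 1\<^sub>m N" "B' * B = 1\<^sub>m N" for A' B'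
  proof -
    have "(B' * A') * (A * B) = B' * (A' * (A * B))"
      by (rule assoc_mult_mat) (use that AB in auto)
    also have "A' * (A * B) = A' * A * B"
      by (rule assoc_mult_mat[symmetric]) (use that AB in auto)
    finally show ?thesis using that AB by simp
  qed
  show ?thesis
    using assms AB unfolding grp_def
    by (auto simp: A_def[symmetric] B_def[symmetric] hadj_mult[OF AB] fa_mult[OF AB] intro!: *)
qed

lemma unitary_inverse:
  assumes A: "A \<in> carrier_mat N N" and u: "hadj A * A = 1\<^sub>m N" and f: "fa A * A = 1\<^sub>m N"
  shows "A * hadj A = 1\<^sub>m N" "hadj A = fa A"
proof -
  have A': "hadj A \<in> carrier_mat N N" using A by simp
  show u': "A * hadj A = 1\<^sub>m N" by (rule mat_mult_left_right_inverse[OF A' A u])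
  have "fa A = fa A * (A * hadj A)" unfolding u' by (rule right_mult_one_mat[OF fadj_carrier, symmetric])
  also have "\<dots> = fa A * A * hadj A"
    by (rule assoc_mult_mat[OF fadj_carrier A A', symmetric])
  also have "\<dots> = hadj A" unfolding f using A' by simp
  finally show "hadj A = fa A" ..
qed

lemma grp_inverse:
  assumes "g \<in> grp"
  defines "h \<equiv> of_mat N (hadj (to_mat N g))"
  shows "h \<in> grp" "to_mat N g * to_mat N h = 1\<^sub>m N"
proof -
  define A where "A = to_mat N g"
  have A: "A \<in> carrier_mat N N" and u: "hadj A * A = 1\<^sub>m N" and f: "fa A * A = 1\<^sub>m N"
    using assms by (auto simp: grp_def A_def)
  note inv = unitary_inverse[OF A u f]
  have "fa (hadj A) = A" using fa_fa[OF A] inv(2) by simp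
  then show "h \<in> grp" using A inv(1) by (simp add: grp_def h_def A_def[symmetric] hadj_hadj)
  show "to_mat N g * to_mat N h = 1\<^sub>m N" using A inv(1) by (simp add: h_def A_def[symmetric])
qed

lemma rot_in_grp:
  assumes X: "X \<in> carrier_mat N N" "X * X * X = - X" "hadj X = - X" "fa X = - X"
  shows "of_mat N (rot N X t) \<in> grp"
  using X by (simp add: grp_def hadj_rot fa_rot rot_add)

lemma haar_formI:
  assumes H: "is_haar N G M" and G: "G \<subseteq> grp"
    and closed: "\<And>g h. g \<in> G \<Longrightarrow> h \<in> G \<Longrightarrow> mmul N g h \<in> G"
    and inv: "\<And>g. g \<in> G \<Longrightarrow> of_mat N (hadj (to_mat N g)) \<in> G"
    and rot: "\<And>X t. X \<in> carrier_mat N N \<Longrightarrow> X * X * X = - X \<Longrightarrow> hadj X = - X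
        \<Longrightarrow> fa X = - X \<Longrightarrow> of_mat N (rot N X t) \<in> G"
  shows "haar_form M N \<tau> s \<epsilon> G"
proof -
  interpret prob_space M using H by (simp add: is_haar_def)
  show ?thesis
  proof
    show "distr M M (mmul N g) = M" if "g \<in> G" for g
    proof (rule haar_invariant[OF H closed _ _ that])
      show "\<exists>h\<in>G. to_mat N g * to_mat N h = 1\<^sub>m N" if "g \<in> G" for g
        using G grp_inverse(2)[of g] inv[OF that] that by blast
    qed (use G in \<open>auto simp: grp_def\<close>)
  qed (use H G closed rot haar_AE[OF H] in \<open>auto simp: grp_def is_haar_def\<close>)
qed

end

lemma mtrans_eq: "mtrans N U = of_mat N (transpose_mat (to_mat N U))"
  by (rule ext) (auto simp: mtrans_def of_mat_def idx_def transpose_mat_def)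

lemma madj_eq: "madj N U = of_mat N (hadj (to_mat N U))"
  by (rule ext) (auto simp: madj_def of_mat_def idx_def hadj_def)

section \<open>The special orthogonal group\<close>

interpretation orth: bilinear_form N "\<lambda>a. a" "\<lambda>_. 1" 1 for N
  by standard auto

lemma fadj_orth: "A \<in> carrier_mat N N \<Longrightarrow> fadj N (\<lambda>a. a) (\<lambda>_. 1) A = transpose_mat A"
  by (auto simp: fadj_def)

text \<open>Having real entries becomes the equality of two adjoints, which passes to products,
  inverses and rotations by algebra.\<close>

lemma SO_iff:
  "U \<in> SO N \<longleftrightarrow> U \<in> orth.grp N \<and> hadj (to_mat N U) = transpose_mat (to_mat N U) \<and> det (to_mat N U) = 1"
proof -
  have "hadj (to_mat N U) = transpose_mat (to_mat N U) \<longleftrightarrow> (\<forall>ij\<in>idx N. Im (U ij) = 0)"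
  proof
    assume *: "hadj (to_mat N U) = transpose_mat (to_mat N U)"
    show "\<forall>ij\<in>idx N. Im (U ij) = 0"
    proof
      fix ij assume "ij \<in> idx N"
      then obtain i j where ij: "ij = (i, j)" "i < N" "j < N" by (auto simp: idx_def)
      then have "cnj (U (i, j)) = U (i, j)"
        using arg_cong[OF *, of "\<lambda>A. A $$ (j, i)"] by (simp add: hadj_def)
      then show "Im (U ij) = 0" using ij by (simp add: complex_eq_iff)
    qed
  next
    assume "\<forall>ij\<in>idx N. Im (U ij) = 0"
    then show "hadj (to_mat N U) = transpose_mat (to_mat N U)"
      by (auto simp: hadj_def idx_def complex_eq_iff)
  qed
  moreover have "mmul N (mtrans N U) U = mid N \<longleftrightarrow> transpose_mat (to_mat N U) * to_mat N U = 1\<^sub>m N"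
    by (simp add: mmul_eq mtrans_eq mid_eq of_mat_eq_iff)
  ultimately show ?thesis
    by (auto simp: SO_def orth.grp_def fadj_orth mdet_eq_det)
qed

lemma haar_form_SO:
  assumes "is_haar N (SO N) M"
  shows "haar_form M N (\<lambda>a. a) (\<lambda>_. 1) 1 (SO N)"
proof (rule orth.haar_formI[OF assms])
  show "SO N \<subseteq> orth.grp N" by (auto simp: SO_iff)
  fix g h assume "g \<in> SO N" "h \<in> SO N"
  moreover have "transpose_mat (to_mat N g * to_mat N h) = transpose_mat (to_mat N h) * transpose_mat (to_mat N g)"
    by (rule transpose_mult) auto
  ultimately show "mmul N g h \<in> SO N"
    using orth.grp_closed[of g N h] by (simp add: SO_iff hadj_mult[of _ N] det_mult[of _ N])
next
  fix g assume g: "g \<in> SO N"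
  define A where "A = to_mat N g"
  have A: "A \<in> carrier_mat N N" by (simp add: A_def)
  have "hadj A = transpose_mat A" "det A = 1" using g by (auto simp: SO_iff A_def)
  then show "of_mat N (hadj (to_mat N g)) \<in> SO N"
    using A orth.grp_inverse(1)[of g N] g hadj_hadj[OF A] det_transpose[OF A]
    by (simp add: SO_iff A_def[symmetric])
next
  fix X t assume X: "X \<in> carrier_mat N N" "X * X * X = - X" "hadj X = - X" "fadj N (\<lambda>a. a) (\<lambda>_. 1) X = - X"
  have rot: "of_mat N (rot N X t) \<in> orth.grp N" for t
    by (rule orth.rot_in_grp[OF X])
  have real: "hadj (rot N X t) = transpose_mat (rot N X t)" for t
    using hadj_rot[OF X(1,3), of t] orth.fa_rot[OF X(1,4), of t] X(1) by (simp add: fadj_orth)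
  have "det (rot N X t) * det (rot N X t) = 1" for t
  proof -
    have "transpose_mat (rot N X t) * rot N X t = 1\<^sub>m N"
      using rot[of t] X(1) by (simp add: orth.grp_def fadj_orth)
    then have "det (transpose_mat (rot N X t) * rot N X t) = 1" by simp
    then show ?thesis using X(1) by (simp add: det_mult[of _ N] det_transpose[of _ N])
  qed
  \<comment> \<open>Each determinant squares to 1, and the rotation by t is the square of the one by
    t/2, so its determinant is 1.\<close>
  then have "det (rot N X (t / 2) * rot N X (t / 2)) = 1"
    using X(1) by (simp add: det_mult[of _ N])
  then have "det (rot N X t) = 1"
    by (simp add: rot_add[OF X(1,2)])
  then show "of_mat N (rot N X t) \<in> SO N"
    using rot[of t] real[of t] X(1) by (simp add: SO_iff)
qed

text \<open>X generates the rotations of the plane of coordinates i and j, and X^2 is minus the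
  projection onto that plane.\<close>

lemma elementary_rotation:
  assumes "i < N" "j < N" "i \<noteq> j"
  defines "X \<equiv> Matrix.mat N N (\<lambda>(a, b). if a = i \<and> b = j then 1 else if a = j \<and> b = i then - 1 else 0 :: complex)"
  shows "X * X * X = - X" "hadj X = - X" "fadj N (\<lambda>a. a) (\<lambda>_. 1) X = - X"
proof -
  have X: "X \<in> carrier_mat N N" by (simp add: X_def)
  have X_entry: "X $$ (a, b) = (if a = i \<and> b = j then 1 else if a = j \<and> b = i then - 1 else 0)"
    if "a < N" "b < N" for a b
    using that by (simp add: X_def)
  have XX: "(X * X) $$ (a, b) = (if b = a \<and> (a = i \<or> a = j) then - 1 else 0)" if ab: "a < N" "b < N" for a b
  proof -
    have "(X * X) $$ (a, b) = (\<Sum>k<N. X $$ (a, k) * X $$ (k, b))"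
      using X ab by (intro mat_mult_entry)
    also have "\<dots> = (\<Sum>k<N. if k = (if a = i then j else i) then X $$ (a, k) * X $$ (k, b) else 0)"
      by (intro sum.cong refl) (use ab in \<open>simp add: X_entry\<close>)
    also have "\<dots> = (let k = (if a = i then j else i) in X $$ (a, k) * X $$ (k, b))"
      using assms by simp
    also have "\<dots> = (if b = a \<and> (a = i \<or> a = j) then - 1 else 0)"
      using assms(1-3) ab by (simp add: X_entry)
    finally show ?thesis .
  qed
  show "X * X * X = - X"
  proof (rule eq_matI)
    fix a b assume "a < dim_row (- X)" "b < dim_col (- X)"
    then have ab: "a < N" "b < N" using X by auto
    have "(X * X * X) $$ (a, b) = (\<Sum>k<N. (X * X) $$ (a, k) * X $$ (k, b))"
      using X ab by (intro mat_mult_entry) auto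
    also have "\<dots> = (\<Sum>k<N. if k = a then (if a = i \<or> a = j then - X $$ (a, b) else 0) else 0)"
      by (intro sum.cong refl) (use ab in \<open>simp add: XX del: index_mult_mat(1)\<close>)
    also have "\<dots> = (- X) $$ (a, b)" using ab X by (simp add: X_entry)
    finally show "(X * X * X) $$ (a, b) = (- X) $$ (a, b)" .
  qed (use X in auto)
  show "hadj X = - X"
    by (rule eq_matI) (use assms(3) in \<open>auto simp: hadj_def X_def\<close>)
  show "fadj N (\<lambda>a. a) (\<lambda>_. 1) X = - X"
    by (rule eq_matI) (use assms(3) in \<open>auto simp: fadj_def X_def\<close>)
qed

lemma null_dir_SO:
  assumes "is_haar N (SO N) M" "i < N" "j < N"
  shows "haar_form.null_dir M N (haar_form.Z N (\<lambda>a. a) (\<lambda>_. 1) i j)"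
proof -
  interpret haar_form M N "\<lambda>a. a" "\<lambda>_. 1" 1 "SO N" by (rule haar_form_SO[OF assms(1)])
  show ?thesis
  proof (cases "i = j")
    case True
    then have "Z i j = 0\<^sub>m N N" by (auto simp: Z_def)
    moreover have "null_dir (0\<^sub>m N N)"
      by (rule null_dirI) (auto simp: hadj_def fadj_def)
    ultimately show ?thesis by simp
  next
    case False
    let ?X = "Matrix.mat N N (\<lambda>(a, b). if a = i \<and> b = j then 1 else if a = j \<and> b = i then - 1 else 0 :: complex)"
    have "Z i j = ?X" using False by (auto simp: Z_def)
    moreover have "null_dir ?X"
      by (rule null_dirI[OF _ elementary_rotation[OF assms(2,3) False]]) simp
    ultimately show ?thesis by simp
  qed
qed

section \<open>The symplectic group\<close>

definition sp_tau :: "nat \<Rightarrow> nat \<Rightarrow> nat" where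
  "sp_tau n a = (if a < n then a + n else a - n)"

definition sp_sgn :: "nat \<Rightarrow> nat \<Rightarrow> complex" where
  "sp_sgn n a = (if a < n then 1 else -1)"

interpretation symp: bilinear_form "2 * n" "sp_tau n" "sp_sgn n" "-1" for n
  by standard (auto simp: sp_tau_def sp_sgn_def)

lemma symJ_eq: "symJ n = of_mat (2 * n) (Matrix.mat (2 * n) (2 * n) (\<lambda>(a, b). sp_sgn n a * of_bool (b = sp_tau n a)))"
  by (rule ext) (auto simp: symJ_def of_mat_def idx_def sp_sgn_def sp_tau_def)

lemma Sp_eq: "Sp n = symp.grp n"
proof -
  have "mmul (2*n) (mtrans (2*n) U) (mmul (2*n) (symJ n) U) = symJ n \<longleftrightarrow>
      fadj (2 * n) (sp_tau n) (sp_sgn n) (to_mat (2 * n) U) * to_mat (2 * n) U = 1\<^sub>m (2 * n)" for U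
  proof -
    let ?N = "2 * n" and ?s = "sp_sgn n" and ?t = "sp_tau n"
    define A where "A = to_mat ?N U"
    define J where "J = Matrix.mat ?N ?N (\<lambda>(a, b). ?s a * of_bool (b = ?t a))"
    have A: "A \<in> carrier_mat ?N ?N" and J: "J \<in> carrier_mat ?N ?N" by (simp_all add: A_def J_def)
    have t: "?t a < ?N" "?t (?t a) = a" "?s (?t a) = - ?s a" "?s a * ?s a = 1" if "a < ?N" for a
      using that symp.\<tau>[of a n] symp.s(2)[of a n] symp.s_sq[of a n] by auto
    have J_entry: "J $$ (a, b) = ?s a * of_bool (b = ?t a)" if "a < ?N" "b < ?N" for a b
      using that by (simp add: J_def)
    have JA: "(J * A) $$ (c, b) = ?s c * A $$ (?t c, b)" if "c < ?N" "b < ?N" for b c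
    proof -
      have "(J * A) $$ (c, b) = (\<Sum>k<?N. J $$ (c, k) * A $$ (k, b))"
        using A J that by (intro mat_mult_entry)
      also have "\<dots> = (\<Sum>k<?N. if k = ?t c then ?s c * A $$ (k, b) else 0)"
        using that by (intro sum.cong refl) (auto simp: J_entry)
      finally show ?thesis using t that by simp
    qed
    \<comment> \<open>This is multiplication by J^-1 = -J, which moves row \<open>?t a\<close> to
      row a with the factor -\<open>?s a\<close>.\<close>
    have rel: "(symp.fa n A * A) $$ (a, b) = - ?s a * (transpose_mat A * (J * A)) $$ (?t a, b)"
      if ab: "a < ?N" "b < ?N" for a b
    proof -
      have "(symp.fa n A * A) $$ (a, b) = (\<Sum>c<?N. symp.fa n A $$ (a, c) * A $$ (c, b))"
        using A ab by (intro mat_mult_entry) auto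
      also have "\<dots> = (\<Sum>c<?N. symp.fa n A $$ (a, ?t c) * A $$ (?t c, b))"
        by (rule symp.sum_\<tau>[symmetric])
      also have "\<dots> = (\<Sum>c<?N. - ?s a * (?s c * A $$ (c, ?t a) * A $$ (?t c, b)))"
        using t ab by (intro sum.cong refl) (simp add: symp.fa_entry)
      also have "\<dots> = - ?s a * (\<Sum>c<?N. ?s c * A $$ (c, ?t a) * A $$ (?t c, b))"
        by (rule sum_distrib_left[symmetric])
      also have "(\<Sum>c<?N. ?s c * A $$ (c, ?t a) * A $$ (?t c, b)) = (transpose_mat A * (J * A)) $$ (?t a, b)"
        using A J t ab by (subst mat_mult_entry[of _ ?N]) (auto simp: JA intro!: sum.cong simp del: index_mult_mat(1))
      finally show ?thesis .
    qed
    have "transpose_mat A * (J * A) = J \<longleftrightarrow> symp.fa n A * A = 1\<^sub>m ?N"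
    proof
      assume *: "transpose_mat A * (J * A) = J"
      show "symp.fa n A * A = 1\<^sub>m ?N"
      proof (rule eq_matI)
        fix a b assume "a < dim_row (1\<^sub>m ?N :: complex mat)" "b < dim_col (1\<^sub>m ?N :: complex mat)"
        then have ab: "a < ?N" "b < ?N" by auto
        then show "(symp.fa n A * A) $$ (a, b) = 1\<^sub>m ?N $$ (a, b)"
          unfolding rel[OF ab] * using t by (simp add: J_entry)
      qed (use A in \<open>auto simp: fadj_def\<close>)
    next
      assume *: "symp.fa n A * A = 1\<^sub>m ?N"
      show "transpose_mat A * (J * A) = J"
      proof (rule eq_matI)
        fix a b assume "a < dim_row J" "b < dim_col J"
        then have ab: "a < ?N" "b < ?N" by (auto simp: J_def)
        have "(1\<^sub>m ?N) $$ (?t a, b) = ?s a * (transpose_mat A * (J * A)) $$ (a, b)"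
          using rel[of "?t a" b] t ab unfolding * by simp
        then have "?s a * (1\<^sub>m ?N) $$ (?t a, b) = (?s a * ?s a) * (transpose_mat A * (J * A)) $$ (a, b)"
          by (simp only: mult.assoc)
        then show "(transpose_mat A * (J * A)) $$ (a, b) = J $$ (a, b)"
          using t ab by (auto simp: J_entry)
      qed (use A in \<open>auto simp: J_def\<close>)
    qed
    then show ?thesis
      using A J by (simp add: mmul_eq mtrans_eq symJ_eq of_mat_eq_iff A_def J_def)
  qed
  moreover have "mmul (2*n) (madj (2*n) U) U = mid (2*n) \<longleftrightarrow> hadj (to_mat (2*n) U) * to_mat (2*n) U = 1\<^sub>m (2*n)" for U
    by (simp add: mmul_eq madj_eq mid_eq of_mat_eq_iff)
  ultimately show ?thesis by (simp add: Sp_def symp.grp_def)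
qed

lemma haar_form_Sp:
  assumes "is_haar (2 * n) (Sp n) M"
  shows "haar_form M (2 * n) (sp_tau n) (sp_sgn n) (-1) (Sp n)"
  using assms unfolding Sp_eq
  by (intro symp.haar_formI symp.grp_closed symp.grp_inverse(1) symp.rot_in_grp) auto


text \<open>The matrix \<open>v v\<^sup>* - w w\<^sup>*\<close>, where \<open>w\<close> is \<open>J\<close> applied to the complex conjugate of \<open>v\<close>.\<close>

definition sp_dir :: "nat \<Rightarrow> (nat \<Rightarrow> complex) \<Rightarrow> complex mat" where
  "sp_dir n v = Matrix.mat (2 * n) (2 * n) (\<lambda>(a, b).
     v a * cnj (v b) - sp_sgn n a * sp_sgn n b * (v (sp_tau n b) * cnj (v (sp_tau n a))))"

text \<open>The vectors v and w are orthonormal, so X acts as \<i> on v, as -\<i> on w and as 0 on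
  their orthogonal complement, whence X^3 = -X. The adjoint for the form exchanges v v* and w w*,
  which explains the last claim.\<close>

lemma sp_dir_unit:
  assumes "(\<Sum>a<2 * n. (cmod (v a))\<^sup>2) = 1"
  defines "X \<equiv> \<i> \<cdot>\<^sub>m sp_dir n v"
  shows "X \<in> carrier_mat (2 * n) (2 * n)" "X * X * X = - X" "hadj X = - X" "symp.fa n X = - X"
proof -
  let ?N = "2 * n" and ?s = "sp_sgn n" and ?t = "sp_tau n"
  have t: "?t a < ?N" "?t (?t a) = a" "?s (?t a) = - ?s a" "?s a * ?s a = 1" if "a < ?N" for a
    using that symp.\<tau>[of a n] symp.s(2)[of a n] symp.s_sq[of a n] by auto
  have sc: "cnj (?s a) = ?s a" for a by (simp add: sp_sgn_def)
  define w where "w a = ?s a * cnj (v (?t a))" for a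
  have X_entry: "X $$ (a, b) = \<i> * (v a * cnj (v b) - w a * cnj (w b))" if "a < ?N" "b < ?N" for a b
    using that by (simp add: X_def sp_dir_def w_def sc)
  show X: "X \<in> carrier_mat ?N ?N" by (simp add: X_def sp_dir_def)
  have vv: "(\<Sum>a<?N. cnj (v a) * v a) = 1"
    using arg_cong[OF assms(1), of complex_of_real] by (simp add: complex_norm_square mult.commute del: of_real_power)
  have ww: "(\<Sum>a<?N. cnj (w a) * w a) = 1"
  proof -
    have "(\<Sum>a<?N. cnj (w a) * w a) = (\<Sum>a<?N. cnj (v (?t a)) * v (?t a))"
    proof (intro sum.cong refl)
      fix a assume "a \<in> {..<?N}"
      have "cnj (w a) * w a = (?s a * ?s a) * (cnj (v (?t a)) * v (?t a))" by (simp add: w_def sc mult_ac)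
      then show "cnj (w a) * w a = cnj (v (?t a)) * v (?t a)" using t \<open>a \<in> _\<close> by simp
    qed
    then show ?thesis using vv symp.sum_\<tau>[of "\<lambda>a. cnj (v a) * v a" n] by simp
  qed
  have vw: "(\<Sum>a<?N. cnj (v a) * w a) = 0"
  proof -
    \<comment> \<open>Exchanging a with its partner \<open>?t a\<close> reverses the sign of each
      summand, the form being alternating; hence S = -S.\<close>
    define S where "S = (\<Sum>a<?N. cnj (v a) * w a)"
    have "S = (\<Sum>a<?N. cnj (v (?t a)) * w (?t a))"
      unfolding S_def by (rule symp.sum_\<tau>[symmetric])
    also have "\<dots> = (\<Sum>a<?N. - (cnj (v a) * w a))"
      by (intro sum.cong refl) (simp add: w_def t)
    also have "\<dots> = - S" by (simp add: S_def sum_negf)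
    finally show ?thesis by (simp add: S_def)
  qed
  have wv: "(\<Sum>a<?N. cnj (w a) * v a) = 0"
    using arg_cong[OF vw, of cnj] by (simp add: mult.commute)
  have prod4: "(\<Sum>k<?N. (p * cnj (v k) + q * cnj (w k)) * (v k * c + w k * d)) = p * c + q * d" for p q c d
  proof -
    have "(\<Sum>k<?N. (p * cnj (v k) + q * cnj (w k)) * (v k * c + w k * d)) =
      p * c * (\<Sum>k<?N. cnj (v k) * v k) + p * d * (\<Sum>k<?N. cnj (v k) * w k)
      + q * c * (\<Sum>k<?N. cnj (w k) * v k) + q * d * (\<Sum>k<?N. cnj (w k) * w k)"
      unfolding sum_distrib_left sum.distrib[symmetric]
      by (intro sum.cong refl) (simp add: algebra_simps)
    then show ?thesis by (simp add: vv ww vw wv)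
  qed
  have XX: "(X * X) $$ (a, b) = - (v a * cnj (v b) + w a * cnj (w b))" if "a < ?N" "b < ?N" for a b
  proof -
    have "(X * X) $$ (a, b) = (\<Sum>k<?N. X $$ (a, k) * X $$ (k, b))"
      using X that by (intro mat_mult_entry)
    also have "\<dots> = (\<Sum>k<?N. ((\<i> * v a) * cnj (v k) + (- \<i> * w a) * cnj (w k)) * (v k * (\<i> * cnj (v b)) + w k * (- \<i> * cnj (w b))))"
      using that by (intro sum.cong refl) (simp add: X_entry algebra_simps)
    also have "\<dots> = - (v a * cnj (v b) + w a * cnj (w b))"
      unfolding prod4 by (simp add: algebra_simps)
    finally show ?thesis .
  qed
  show "X * X * X = - X"
  proof (rule eq_matI)
    fix a b assume "a < dim_row (- X)" "b < dim_col (- X)"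
    then have ab: "a < ?N" "b < ?N" using X by auto
    have "(X * X * X) $$ (a, b) = (\<Sum>k<?N. (X * X) $$ (a, k) * X $$ (k, b))"
      using X ab by (intro mat_mult_entry) auto
    also have "\<dots> = (\<Sum>k<?N. ((- v a) * cnj (v k) + (- w a) * cnj (w k)) * (v k * (\<i> * cnj (v b)) + w k * (- \<i> * cnj (w b))))"
      using ab by (intro sum.cong refl) (simp add: X_entry XX algebra_simps del: index_mult_mat(1))
    also have "\<dots> = (- X) $$ (a, b)"
      unfolding prod4 using ab X by (simp add: X_entry algebra_simps)
    finally show "(X * X * X) $$ (a, b) = (- X) $$ (a, b)" .
  qed (use X in auto)
  show "hadj X = - X"
  proof (rule eq_matI)
    fix a b assume "a < dim_row (- X)" "b < dim_col (- X)"
    then have ab: "a < ?N" "b < ?N" using X by auto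
    then show "hadj X $$ (a, b) = (- X) $$ (a, b)"
      using X by (simp add: hadj_entry[of _ ?N] X_entry algebra_simps)
  qed (use X in \<open>auto simp: hadj_def\<close>)
  show "symp.fa n X = - X"
  proof (rule eq_matI)
    fix a b assume "a < dim_row (- X)" "b < dim_col (- X)"
    then have ab: "a < ?N" "b < ?N" using X by auto
    have dist: "x * y * (z * (p - q)) = z * (x * y * p - x * y * q)" for x y z p q :: complex
      by (simp add: algebra_simps)
    have 1: "?s a * ?s b * (v (?t b) * cnj (v (?t a))) = w a * cnj (w b)"
      by (simp add: w_def sc)
    have "?s a * ?s b * (w (?t b) * cnj (w (?t a))) = (?s a * ?s a) * (?s b * ?s b) * (v a * cnj (v b))"
      using t(1-3) ab by (simp add: w_def sc mult_ac)
    then have 2: "?s a * ?s b * (w (?t b) * cnj (w (?t a))) = v a * cnj (v b)"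
      by (simp only: t(4)[OF ab(1)] t(4)[OF ab(2)] mult_1_left)
    have "symp.fa n X $$ (a, b) = ?s a * ?s b * (\<i> * (v (?t b) * cnj (v (?t a)) - w (?t b) * cnj (w (?t a))))"
      using t(1-3) ab by (simp add: symp.fa_entry X_entry)
    also have "\<dots> = \<i> * (?s a * ?s b * (v (?t b) * cnj (v (?t a))) - ?s a * ?s b * (w (?t b) * cnj (w (?t a))))"
      by (rule dist)
    also have "\<dots> = (- X) $$ (a, b)"
      unfolding 1 2 using ab X by (simp add: X_entry algebra_simps)
    finally show "symp.fa n X $$ (a, b) = (- X) $$ (a, b)" .
  qed (use X in \<open>auto simp: fadj_def\<close>)
qed

text \<open>The generators at hand are \<i> times \<open>sp_dir\<close> of unit vectors. Complex
  linearity removes the \<i>, admits vectors of any length, and then reaches \<open>Z i j\<close>, a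
  combination of four such matrices.\<close>

lemma null_dir_Sp:
  assumes "is_haar (2 * n) (Sp n) M" "i < 2 * n" "j < 2 * n"
  shows "haar_form.null_dir M (2 * n) (haar_form.Z (2 * n) (sp_tau n) (sp_sgn n) i j)"
proof -
  interpret haar_form M "2 * n" "sp_tau n" "sp_sgn n" "-1" "Sp n" by (rule haar_form_Sp[OF assms(1)])
  let ?N = "2 * n"
  have dir: "null_dir (sp_dir n v)" for v
  proof -
    define r where "r = sqrt (\<Sum>a<?N. (cmod (v a))\<^sup>2)"
    have nonneg: "(\<Sum>a<?N. (cmod (v a))\<^sup>2) \<ge> 0" by (intro sum_nonneg) auto
    have r2: "r\<^sup>2 = (\<Sum>a<?N. (cmod (v a))\<^sup>2)" using nonneg by (simp add: r_def)
    \<comment> \<open>If v = 0, any unit vector serves, as the factor r^2 = 0 annihilates it; the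
      i-th basis vector is taken.\<close>
    define u where "u a = (if r = 0 then of_bool (a = i) else v a / of_real r)" for a
    have "(\<Sum>a<?N. (cmod (u a))\<^sup>2) = 1"
    proof (cases "r = 0")
      case True
      have "(\<Sum>a<?N. (cmod (u a))\<^sup>2) = (\<Sum>a<?N. if a = i then 1 else 0)"
        using True by (intro sum.cong) (auto simp: u_def)
      then show ?thesis using assms by simp
    next
      case False
      then have "(\<Sum>a<?N. (cmod (u a))\<^sup>2) = (\<Sum>a<?N. (cmod (v a))\<^sup>2) / r\<^sup>2"
        by (simp add: u_def norm_divide power_divide sum_divide_distrib)
      then show ?thesis using False by (simp add: r2[symmetric])
    qed
    \<comment> \<open>The scalar -\<i> r^2 cancels \<i> and undoes the normalization; the second
      summand with coefficient 0 only brings scaling into the form of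
      \<open>null_dir_lin\<close>.\<close>
    from sp_dir_unit[OF this] have "null_dir (\<i> \<cdot>\<^sub>m sp_dir n u)" by (rule null_dirI)
    then have "null_dir ((- \<i> * of_real (r\<^sup>2)) \<cdot>\<^sub>m (\<i> \<cdot>\<^sub>m sp_dir n u) + 0 \<cdot>\<^sub>m (\<i> \<cdot>\<^sub>m sp_dir n u))"
      by (intro null_dir_lin)
    also have "(- \<i> * of_real (r\<^sup>2)) \<cdot>\<^sub>m (\<i> \<cdot>\<^sub>m sp_dir n u) + 0 \<cdot>\<^sub>m (\<i> \<cdot>\<^sub>m sp_dir n u) = sp_dir n v"
    proof (rule eq_matI)
      fix a b assume "a < dim_row (sp_dir n v)" "b < dim_col (sp_dir n v)"
      then have ab: "a < ?N" "b < ?N" by (auto simp: sp_dir_def)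
      have tau: "sp_tau n a < ?N" "sp_tau n b < ?N" using ab symp.\<tau>(1) by auto
      have uv: "of_real (r\<^sup>2) * (u c * cnj (u d)) = v c * cnj (v d)" if "c < ?N" "d < ?N" for c d
      proof (cases "r = 0")
        case True
        then have "(\<Sum>a<?N. (cmod (v a))\<^sup>2) = 0" using r2 by simp
        then have "v c = 0" using that by (subst (asm) sum_nonneg_eq_0_iff) auto
        then show ?thesis using True by simp
      next
        case False
        then show ?thesis by (simp add: u_def power2_eq_square)
      qed
      have "((- \<i> * of_real (r\<^sup>2)) \<cdot>\<^sub>m (\<i> \<cdot>\<^sub>m sp_dir n u) + 0 \<cdot>\<^sub>m (\<i> \<cdot>\<^sub>m sp_dir n u)) $$ (a, b) =
        of_real (r\<^sup>2) * (u a * cnj (u b))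
        - sp_sgn n a * sp_sgn n b * (of_real (r\<^sup>2) * (u (sp_tau n b) * cnj (u (sp_tau n a))))"
        using ab by (simp add: sp_dir_def algebra_simps)
      also have "\<dots> = sp_dir n v $$ (a, b)"
        using ab tau by (simp only: uv) (simp add: sp_dir_def)
      finally show "((- \<i> * of_real (r\<^sup>2)) \<cdot>\<^sub>m (\<i> \<cdot>\<^sub>m sp_dir n u) + 0 \<cdot>\<^sub>m (\<i> \<cdot>\<^sub>m sp_dir n u)) $$ (a, b) = sp_dir n v $$ (a, b)" .
    qed (auto simp: sp_dir_def)
    finally show ?thesis .
  qed
  text \<open>The matrices \<open>v v\<^sup>*\<close> span all matrices by polarization.\<close>
  define e where "e z a = of_bool (a = i) + z * of_bool (a = j)" for z :: complex and a
  define H where "H z = sp_dir n (e z)" for z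
  have "null_dir (1 \<cdot>\<^sub>m ((1 / 4) \<cdot>\<^sub>m H 1 + (- 1 / 4) \<cdot>\<^sub>m H (- 1)) + 1 \<cdot>\<^sub>m ((\<i> / 4) \<cdot>\<^sub>m H \<i> + (- \<i> / 4) \<cdot>\<^sub>m H (- \<i>)))"
    unfolding H_def by (intro null_dir_lin dir)
  also have "1 \<cdot>\<^sub>m ((1 / 4) \<cdot>\<^sub>m H 1 + (- 1 / 4) \<cdot>\<^sub>m H (- 1)) + 1 \<cdot>\<^sub>m ((\<i> / 4) \<cdot>\<^sub>m H \<i> + (- \<i> / 4) \<cdot>\<^sub>m H (- \<i>)) = Z i j"
  proof (rule eq_matI)
    fix a b assume "a < dim_row (Z i j)" "b < dim_col (Z i j)"
    then have ab: "a < ?N" "b < ?N" by (auto simp: Z_def)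
    define h where "h z c d = e z c * cnj (e z d)" for z c d
    \<comment> \<open>The weights are z/4 for the fourth roots of unity z. E_ij has the coefficient
      \<open>cnj z\<close> in \<open>h z\<close>, so it survives with coefficient 1, while the other
      coefficients average out.\<close>
    have pol: "of_bool (c = i \<and> d = j) =
      1 / 4 * h 1 c d - 1 / 4 * h (- 1) c d + \<i> / 4 * h \<i> c d - \<i> / 4 * h (- \<i>) c d" for c d
      by (cases "c = i"; cases "c = j"; cases "d = i"; cases "d = j"; simp add: h_def e_def complex_eq_iff)
    have H: "H z $$ (a, b) = h z a b - sp_sgn n a * sp_sgn n b * h z (sp_tau n b) (sp_tau n a)" for z
      using ab by (simp add: H_def sp_dir_def h_def)
    have H_dim: "dim_row (H z) = ?N" "dim_col (H z) = ?N" for z by (simp_all add: H_def sp_dir_def)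
    have inv: "sp_tau n (sp_tau n x) = x" if "x < ?N" for x
      using symp.\<tau>(2) that by simp
    have tau: "sp_tau n b = i \<and> sp_tau n a = j \<longleftrightarrow> a = sp_tau n j \<and> b = sp_tau n i"
      using inv[OF ab(1)] inv[OF ab(2)] inv[OF assms(2)] inv[OF assms(3)] by auto
    have "sp_sgn n a * sp_sgn n b * of_bool (sp_tau n b = i \<and> sp_tau n a = j) =
        sp_sgn n i * sp_sgn n j * of_bool (a = sp_tau n j \<and> b = sp_tau n i)"
      unfolding tau using assms symp.s(2)[of i n] symp.s(2)[of j n] by (cases "a = sp_tau n j \<and> b = sp_tau n i") auto
    then have "Z i j $$ (a, b) = of_bool (a = i \<and> b = j) - sp_sgn n a * sp_sgn n b * of_bool (sp_tau n b = i \<and> sp_tau n a = j)"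
      using ab by (simp add: Z_def)
    then show "(1 \<cdot>\<^sub>m ((1 / 4) \<cdot>\<^sub>m H 1 + (- 1 / 4) \<cdot>\<^sub>m H (- 1)) + 1 \<cdot>\<^sub>m ((\<i> / 4) \<cdot>\<^sub>m H \<i> + (- \<i> / 4) \<cdot>\<^sub>m H (- \<i>))) $$ (a, b) = Z i j $$ (a, b)"
      unfolding pol using ab by (simp add: H H_dim algebra_simps)
  qed (auto simp: Z_def H_def sp_dir_def)
  finally show ?thesis .
qed

section \<open>Poisson summation\<close>

text \<open>Weierstrass approximation on the unit circle gives uniqueness of Fourier coefficients.\<close>

lemma continuous_on_circle_Arg:
  fixes h :: "real \<Rightarrow> real"
  assumes h: "continuous_on UNIV h" and per: "\<And>x. h (x + 2 * pi) = h x"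
  shows "continuous_on (sphere 0 1) (\<lambda>z. h (Arg z))"
proof (rule continuous_at_imp_continuous_on, intro ballI)
  fix z :: complex assume "z \<in> sphere 0 1"
  then have z0: "z \<noteq> 0" by auto
  have hc: "isCont h x" for x
    using h by (simp add: continuous_on_eq_continuous_at)
  show "isCont (\<lambda>z. h (Arg z)) z"
  proof (cases "z \<in> \<real>\<^sub>\<le>\<^sub>0")
    case False
    then show ?thesis
      by (rule isCont_o2[where f = Arg and g = h, OF continuous_at_Arg hc])
  next
    case True
    \<comment> \<open>On the negative axis Arg jumps, but Arg(-w) + pi is continuous there and
      differs from Arg w by 0 or 2 pi, which h does not notice.\<close>
    have nz: "- z \<notin> \<real>\<^sub>\<le>\<^sub>0" using True z0 by (auto simp: complex_nonpos_Reals_iff complex_eq_iff)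
    have "isCont (\<lambda>z. Arg (- z) + pi) z"
      by (intro continuous_intros isCont_o2[where f = uminus and g = Arg, OF _ continuous_at_Arg[OF nz]])
    then have "isCont (\<lambda>z. h (Arg (- z) + pi)) z"
      by (rule isCont_o2[where g = h, OF _ hc])
    moreover have "h (Arg (- w) + pi) = h (Arg w)" if "w \<noteq> 0" for w
      using per[of "Arg w"] that by (auto simp: Arg_minus add_ac)
    then have "eventually (\<lambda>w. h (Arg (- w) + pi) = h (Arg w)) (nhds z)"
      using z0 by (auto intro: eventually_mono[OF t1_space_nhds])
    ultimately show ?thesis by (rule isCont_cong[THEN iffD1, rotated])
  qed
qed

text \<open>h is orthogonal to all characters, hence to p(cis x) for every real polynomial p on the
  plane. Such functions approximate h uniformly, so the integral of h^2 is at most e times that of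
  |h| for every e > 0.\<close>

lemma fourier_coefficients_unique:
  fixes h :: "real \<Rightarrow> real"
  assumes h: "continuous_on UNIV h" and per: "\<And>x. h (x + 2 * pi) = h x"
    and coeff: "\<And>n :: int. integral {-pi..pi} (\<lambda>x. of_real (h x) * cis (of_int n * x)) = 0"
    and x: "x \<in> {-pi..pi}"
  shows "h x = 0"
proof -
  have cis_cont [continuous_intros]: "continuous_on A (\<lambda>x. cis (c * x))" for A c
    unfolding cis_conv_exp by (intro continuous_intros)
  have hc: "continuous_on A (\<lambda>x. complex_of_real (h x))" for A
    by (intro continuous_intros continuous_on_subset[OF h]) auto
  \<comment> \<open>Weights w for which h w is still orthogonal to every character. Quantifying over
    all n makes W closed under multiplication by characters.\<close>
  define W where "W = {w :: real \<Rightarrow> complex. continuous_on UNIV w \<and>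
     (\<forall>n :: int. integral {-pi..pi} (\<lambda>x. of_real (h x) * w x * cis (of_int n * x)) = 0)}"
  have int: "(\<lambda>x. of_real (h x) * w x * cis (of_int n * x)) integrable_on {-pi..pi}" if "w \<in> W" for w and n :: int
    using that by (intro integrable_continuous_interval continuous_intros hc) (auto simp: W_def intro: continuous_on_subset)
  have W_add: "(\<lambda>x. w x + w' x) \<in> W" if "w \<in> W" "w' \<in> W" for w w'
  proof -
    have "integral {-pi..pi} (\<lambda>x. of_real (h x) * (w x + w' x) * cis (of_int n * x)) = 0" for n :: int
      using integral_add[OF int[OF that(1), of n] int[OF that(2), of n]] that by (simp add: algebra_simps W_def)
    then show ?thesis using that by (auto simp: W_def intro!: continuous_intros)
  qed
  have W_scale: "(\<lambda>x. c * w x) \<in> W" if "w \<in> W" for w c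
  proof -
    have "integral {-pi..pi} (\<lambda>x. of_real (h x) * (c * w x) * cis (of_int n * x)) = 0" for n :: int
    proof -
      have "(\<lambda>x. of_real (h x) * (c * w x) * cis (of_int n * x)) = (\<lambda>x. c * (of_real (h x) * w x * cis (of_int n * x)))"
        by (simp add: mult_ac)
      then show ?thesis using that by (simp add: W_def)
    qed
    then show ?thesis using that by (auto simp: W_def intro!: continuous_intros)
  qed
  have W_cis: "(\<lambda>x. cis (of_int k * x) * w x) \<in> W" if "w \<in> W" for w and k :: int
  proof -
    have "integral {-pi..pi} (\<lambda>x. of_real (h x) * (cis (of_int k * x) * w x) * cis (of_int n * x)) = 0" for n :: int
    proof -
      have eq: "of_real (h x) * (cis (of_int k * x) * w x) * cis (of_int n * x) = of_real (h x) * w x * cis (of_int (k + n) * x)" for x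
      proof -
        have "cis (of_int (k + n) * x) = cis (of_int k * x) * cis (of_int n * x)"
          by (simp add: cis_mult distrib_right)
        then show ?thesis by (simp only: mult_ac)
      qed
      have "integral {-pi..pi} (\<lambda>x. of_real (h x) * w x * cis (of_int (k + n) * x)) = 0"
        using that unfolding W_def by blast
      then show ?thesis by (simp only: eq)
    qed
    then show ?thesis using that by (auto simp: W_def intro!: continuous_intros)
  qed
  have W_poly: "(\<lambda>x. of_real (p (cis x)) * w x) \<in> W" if "real_polynomial_function p" "w \<in> W" for p w
    using that
  proof (induction p arbitrary: w rule: real_polynomial_function.induct)
    case (linear p)
    \<comment> \<open>A real-linear p is determined by p 1 and p \<i>; expressing cos and sin by
      \<open>cis x\<close> and \<open>cis (- x)\<close> reduces to the closure properties of
      W.\<close>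
    have "of_real (p (cis x)) * w x =
      of_real (p 1) * ((1 / 2) * (cis (of_int 1 * x) * w x + cis (of_int (- 1) * x) * w x))
      + of_real (p \<i>) * ((1 / (2 * \<i>)) * (cis (of_int 1 * x) * w x + (- 1) * (cis (of_int (- 1) * x) * w x)))" for x
    proof -
      have "cis x = cos x *\<^sub>R 1 + sin x *\<^sub>R \<i>" by (simp add: complex_eq_iff)
      then have "p (cis x) = cos x * p 1 + sin x * p \<i>"
        using linear.hyps by (simp add: linear_simps)
      moreover have "complex_of_real (cos x) = (1 / 2) * (cis x + cis (- x))"
        "complex_of_real (sin x) = (1 / (2 * \<i>)) * (cis x - cis (- x))"
        by (auto simp: complex_eq_iff)
      ultimately have pf: "complex_of_real (p (cis x)) = (1 / 2) * (cis x + cis (- x)) * of_real (p 1)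
         + (1 / (2 * \<i>)) * (cis x - cis (- x)) * of_real (p \<i>)"
        by (simp only: of_real_add of_real_mult)
      have rg: "(a * (c + c') * P + b * (c - c') * Q) * v = P * (a * (c * v + c' * v)) + Q * (b * (c * v + (- 1) * (c' * v)))"
        for a b c c' P Q v :: complex by (simp add: algebra_simps)
      show ?thesis unfolding pf rg by simp
    qed
    then show ?case
      using linear.prems by (simp only:) (intro W_add W_scale W_cis)
  next
    case (const c)
    then show ?case by (intro W_scale)
  next
    case (add p q)
    then show ?case using W_add[OF add.IH(1)[OF add.prems] add.IH(2)[OF add.prems]] by (simp add: algebra_simps)
  next
    case (mult p q)
    then show ?case using mult.IH(1)[OF mult.IH(2)[OF mult.prems]] by (simp add: mult_ac)
  qed
  have one: "(\<lambda>_. 1) \<in> W" using coeff by (auto simp: W_def)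
  have hint: "continuous_on {-pi..pi} h" using h by (rule continuous_on_subset) auto
  define B where "B = integral {-pi..pi} (\<lambda>x. \<bar>h x\<bar>)"
  have le: "integral {-pi..pi} (\<lambda>x. h x * h x) \<le> e * B" if "e > 0" for e
  proof -
    obtain p where p: "real_polynomial_function p" "\<And>z. z \<in> sphere 0 1 \<Longrightarrow> \<bar>h (Arg z) - p z\<bar> < e"
      using Stone_Weierstrass_real_polynomial_function[OF compact_sphere continuous_on_circle_Arg[OF h per] \<open>e > 0\<close>]
      by metis
    have cis_mpi: "cis (- pi) = cis pi" by (simp add: complex_eq_iff)
    have approx: "\<bar>h x - p (cis x)\<bar> \<le> e" if "x \<in> {-pi..pi}" for x
    proof -
      have "h (Arg (cis x)) = h x"
      proof (cases "x = - pi")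
        case True
        then show ?thesis using per[of "- pi"] Arg_cis[of pi] by (simp add: cis_mpi)
      next
        case False
        then show ?thesis using that by (simp add: Arg_cis)
      qed
      then show ?thesis using p(2)[of "cis x"] by simp
    qed
    have pc: "continuous_on {-pi..pi} (\<lambda>x. p (cis x))"
      using continuous_on_polymonial_function p(1) cis_cont[of _ 1]
      by (intro continuous_on_compose2[of UNIV p _ cis])
         (auto simp: real_polynomial_function_eq intro: continuous_on_polymonial_function)
    have "integral {-pi..pi} (\<lambda>x. complex_of_real (h x * p (cis x))) = 0"
      using W_poly[OF p(1) one] by (auto simp: W_def dest!: spec[of _ "0::int"])
    moreover have "integral {-pi..pi} (\<lambda>x. complex_of_real (h x * p (cis x))) = of_real (integral {-pi..pi} (\<lambda>x. h x * p (cis x)))"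
      using has_integral_of_real[OF integrable_integral[OF integrable_continuous_interval[OF continuous_on_mult[OF hint pc]]]]
      by (rule integral_unique)
    ultimately have 0: "integral {-pi..pi} (\<lambda>x. h x * p (cis x)) = 0" by simp
    have "integral {-pi..pi} (\<lambda>x. h x * h x) = integral {-pi..pi} (\<lambda>x. h x * h x) - integral {-pi..pi} (\<lambda>x. h x * p (cis x))"
      by (simp add: 0)
    also have "\<dots> = integral {-pi..pi} (\<lambda>x. h x * h x - h x * p (cis x))"
      by (rule integral_diff[symmetric]) (intro integrable_continuous_interval continuous_intros hint pc)+
    also have "\<dots> \<le> integral {-pi..pi} (\<lambda>x. e * \<bar>h x\<bar>)"
    proof (rule integral_le)
      fix x assume x: "x \<in> {-pi..pi}"
      have "h x * h x - h x * p (cis x) = h x * (h x - p (cis x))" by (simp add: algebra_simps)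
      also have "\<dots> \<le> \<bar>h x\<bar> * \<bar>h x - p (cis x)\<bar>" by (metis abs_ge_self abs_mult)
      also have "\<dots> \<le> \<bar>h x\<bar> * e" using approx[OF x] by (intro mult_left_mono) auto
      finally show "h x * h x - h x * p (cis x) \<le> e * \<bar>h x\<bar>" by (simp add: mult.commute)
    qed (intro integrable_continuous_interval continuous_intros hint pc)+
    also have "\<dots> = e * B" by (simp add: B_def)
    finally show ?thesis .
  qed
  have "B \<ge> 0" unfolding B_def
    by (intro integral_nonneg integrable_continuous_interval continuous_intros hint) auto
  have "integral {-pi..pi} (\<lambda>x. h x * h x) \<le> 0"
  proof (rule field_le_epsilon)
    fix e :: real assume "e > 0" 
    \<comment> \<open>The denominator B + 1 allows for B = 0.\<close>
    then have "integral {-pi..pi} (\<lambda>x. h x * h x) \<le> (e / (B + 1)) * B"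
      using \<open>B \<ge> 0\<close> by (intro le) simp
    also have "\<dots> \<le> e" using \<open>B \<ge> 0\<close> \<open>e > 0\<close> by (simp add: field_simps)
    finally show "integral {-pi..pi} (\<lambda>x. h x * h x) \<le> 0 + e" by simp
  qed
  moreover have "integral {-pi..pi} (\<lambda>x. h x * h x) \<ge> 0"
    by (intro integral_nonneg integrable_continuous_interval continuous_intros hint) auto
  ultimately have "integral {-pi..pi} (\<lambda>x. h x * h x) = 0" by simp
  then have "h x * h x = 0"
    using integral_eq_0_iff[of "-pi" pi "\<lambda>x. h x * h x"] x continuous_on_mult[OF hint hint] by simp
  then show ?thesis by simp
qed

section \<open>Periodization of an even Schwartz function\<close>

locale even_schwartz =
  fixes f :: "real \<Rightarrow> real"
  assumes schwartz: "schwartz f" and even: "\<And>x. f (- x) = f x"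
begin

definition fh :: "real \<Rightarrow> real" where "fh t = Re (fourier f t)"

lemma f_cont: "continuous_on A f"
proof -
  have "f differentiable (at x)" for x
    using schwartz unfolding schwartz_def by (metis funpow_0)
  then show ?thesis
    by (intro continuous_at_imp_continuous_on) (auto simp: differentiable_imp_continuous_within)
qed

lemma f_decay: obtains C where "C > 0" "\<And>x. \<bar>f x\<bar> \<le> C / (1 + x\<^sup>2)"
proof -
  have "bounded (range (\<lambda>x. x ^ k * (deriv ^^ 0) f x))" for k
    using schwartz unfolding schwartz_def by blast
  then have b: "bounded (range (\<lambda>x. x ^ k * f x))" for k by simp
  obtain A where A: "\<And>x. \<bar>f x\<bar> \<le> A" using b[of 0] by (auto simp: bounded_iff)
  obtain B where B: "\<And>x. \<bar>x\<^sup>2 * f x\<bar> \<le> B" using b[of 2] unfolding bounded_iff by auto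
  have "\<bar>f x\<bar> \<le> (\<bar>A\<bar> + \<bar>B\<bar> + 1) / (1 + x\<^sup>2)" for x
  proof -
    have "\<bar>f x\<bar> * (1 + x\<^sup>2) = \<bar>f x\<bar> + \<bar>x\<^sup>2 * f x\<bar>" by (simp add: algebra_simps abs_mult)
    also have "\<dots> \<le> \<bar>A\<bar> + \<bar>B\<bar> + 1" using A[of x] B[of x] by linarith
    finally show ?thesis by (simp add: pos_le_divide_eq add_pos_nonneg)
  qed
  then show ?thesis using that[of "\<bar>A\<bar> + \<bar>B\<bar> + 1"] by force
qed

lemma f_measurable [measurable]: "f \<in> borel_measurable borel"
  using f_cont by (rule borel_measurable_continuous_onI)

lemma f_integrable: "integrable lborel f"
proof -
  obtain C where C: "C > 0" "\<And>x. \<bar>f x\<bar> \<le> C / (1 + x\<^sup>2)" by (rule f_decay) blast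
  have "integrable lborel (\<lambda>x. C * (1 / (1 + x\<^sup>2)))"
    using integrable_inverse_1_plus_square
    by (intro integrable_mult_right) (simp add: set_integrable_def einterval_def inverse_eq_divide)
  then show ?thesis
    by (rule Bochner_Integration.integrable_bound) (use C in \<open>auto intro: order.trans[OF _ abs_ge_self]\<close>)
qed

lemma integrable_f_cis: "integrable lborel (\<lambda>x. complex_of_real (f x) * cis (c * x))"
proof (rule Bochner_Integration.integrable_bound[OF f_integrable])
  show "(\<lambda>x. complex_of_real (f x) * cis (c * x)) \<in> borel_measurable lborel"
    unfolding cis_conv_exp by measurable
qed (simp add: norm_mult)

lemma fourier_cis: "fourier f t = (\<integral>x. complex_of_real (f x) * cis (- (2 * pi * t) * x) \<partial>lborel)"
  unfolding fourier_def cis_conv_exp by (intro Bochner_Integration.integral_cong refl) (simp add: mult_ac)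

lemma fourier_minus: "fourier f (- t) = fourier f t"
proof -
  have "fourier f t = (\<integral>x. complex_of_real (f (- x)) * cis (- (2 * pi * t) * (- x)) \<partial>lborel)"
    unfolding fourier_cis
    using lborel_integral_real_affine[of "-1" "\<lambda>x. complex_of_real (f x) * cis (- (2 * pi * t) * x)" 0] by simp
  then show ?thesis by (simp add: fourier_cis even)
qed

text \<open>Conjugation replaces t by -t, and evenness of f undoes this, so the transform is
  real.\<close>

lemma fourier_fh: "fourier f t = complex_of_real (fh t)"
proof -
  have "cnj (fourier f t) = (\<integral>x. cnj (complex_of_real (f x) * cis (- (2 * pi * t) * x)) \<partial>lborel)"
    unfolding fourier_cis by (rule Bochner_Integration.integral_cnj[symmetric])
  also have "\<dots> = fourier f (- t)" by (simp add: fourier_cis cis_cnj)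
  finally have "cnj (fourier f t) = fourier f t" by (simp add: fourier_minus)
  then show ?thesis by (simp add: fh_def complex_eq_iff)
qed

lemma fh_minus: "fh (- t) = fh t"
  by (simp add: fh_def fourier_minus)

lemma fh_cont: "continuous_on A fh"
proof -
  have "isCont (fourier f) t" for t
    unfolding continuous_at_sequentially
  proof (intro allI impI)
    fix u assume u: "u \<longlonglongrightarrow> t"
    have "(\<lambda>n. \<integral>x. complex_of_real (f x) * cis (- (2 * pi * u n) * x) \<partial>lborel)
      \<longlonglongrightarrow> (\<integral>x. complex_of_real (f x) * cis (- (2 * pi * t) * x) \<partial>lborel)"
    proof (rule integral_dominated_convergence[where w = "\<lambda>x. \<bar>f x\<bar>"])
      show "AE x in lborel. (\<lambda>n. complex_of_real (f x) * cis (- (2 * pi * u n) * x)) \<longlonglongrightarrow> complex_of_real (f x) * cis (- (2 * pi * t) * x)"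
        unfolding cis_conv_exp by (intro AE_I2 tendsto_intros u)
      show "integrable lborel (\<lambda>x. \<bar>f x\<bar>)" using f_integrable by simp
      show "(\<lambda>x. complex_of_real (f x) * cis (- (2 * pi * t) * x)) \<in> borel_measurable lborel"
        by (rule borel_measurable_integrable[OF integrable_f_cis])
      show "(\<lambda>x. complex_of_real (f x) * cis (- (2 * pi * u n) * x)) \<in> borel_measurable lborel" for n
        by (rule borel_measurable_integrable[OF integrable_f_cis])
    qed (simp add: norm_mult)
    then show "(fourier f \<circ> u) \<longlonglongrightarrow> fourier f t" by (simp add: fourier_cis o_def)
  qed
  then have "isCont (\<lambda>t. Re (fourier f t)) t" for t by (intro continuous_Re) simp
  then have "isCont fh t" for t by (simp add: fh_def[abs_def])
  then show ?thesis by (intro continuous_at_imp_continuous_on) auto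
qed

lemma fh_zero:
  assumes "fsupp (fourier f) \<subseteq> S" "t \<notin> S"
  shows "fh t = 0"
proof -
  have "fourier f t = 0" using assms closure_subset[of "{t. fourier f t \<noteq> 0}"] unfolding fsupp_def by blast
  then show ?thesis by (simp add: fh_def)
qed

text \<open>Enumerating the integers turns the two-sided sum into a series over the naturals, to
  which the Weierstrass test and termwise integration apply.\<close>

definition term_N :: "nat \<Rightarrow> nat \<Rightarrow> real \<Rightarrow> real" where
  "term_N N n \<theta> = f (real N / (2 * pi) * (\<theta> + 2 * pi * of_int (int_decode n)))"

lemma int_decode_bound: "real n \<le> 2 * \<bar>of_int (int_decode n)\<bar>"
proof -
  have "int_encode i \<le> nat (2 * \<bar>i\<bar>)" for i
    by (auto simp: int_encode_def sum_encode_def)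
  from this[of "int_decode n"] have "n \<le> nat (2 * \<bar>int_decode n\<bar>)" by simp
  then have "int n \<le> 2 * \<bar>int_decode n\<bar>" by linarith
  then have "real_of_int (int n) \<le> real_of_int (2 * \<bar>int_decode n\<bar>)" by (simp only: of_int_le_iff)
  then show ?thesis by simp
qed

text \<open>Peetre's inequality: decay at the point a + b becomes decay in the shift b, uniformly
  for bounded a.\<close>

lemma peetre: "1 + (b::real)\<^sup>2 \<le> 2 * (1 + a\<^sup>2) * (1 + (a + b)\<^sup>2)"
proof -
  have "b\<^sup>2 \<le> 2 * (a + b)\<^sup>2 + 2 * a\<^sup>2"
    using zero_le_power2[of "2 * a + b"] by (simp add: power2_eq_square algebra_simps)
  moreover have "0 \<le> a\<^sup>2 * (a + b)\<^sup>2" by simp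
  moreover have "2 * (1 + a\<^sup>2) * (1 + (a + b)\<^sup>2) = 2 + 2 * a\<^sup>2 + 2 * (a + b)\<^sup>2 + 2 * (a\<^sup>2 * (a + b)\<^sup>2)"
    by (simp add: algebra_simps)
  ultimately show ?thesis by linarith
qed

lemma term_N_bound:
  assumes N: "N \<ge> 1"
  obtains K where "\<And>n \<theta>. \<bar>\<theta>\<bar> \<le> R \<Longrightarrow> \<bar>term_N N n \<theta>\<bar> \<le> K / (1 + (real n)\<^sup>2)"
proof -
  obtain C where C: "C > 0" "\<And>x. \<bar>f x\<bar> \<le> C / (1 + x\<^sup>2)" by (rule f_decay) blast
  \<comment> \<open>The 4 comes from n \<le> 2|b|, the factor 2 (1 + a^2) from Peetre's inequality
    with |a| \<le> N R / (2 pi).\<close>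
  define K where "K = 4 * (C * (2 * (1 + (real N / (2 * pi) * R)\<^sup>2)))"
  have "\<bar>term_N N n \<theta>\<bar> \<le> K / (1 + (real n)\<^sup>2)" if th: "\<bar>\<theta>\<bar> \<le> R" for n \<theta>
  proof -
    define a b where "a = real N / (2 * pi) * \<theta>" and "b = real N * of_int (int_decode n)"
    have x: "real N / (2 * pi) * (\<theta> + 2 * pi * of_int (int_decode n)) = a + b"
      by (simp add: a_def b_def field_simps)
    have "\<bar>a\<bar> \<le> real N / (2 * pi) * R"
      unfolding a_def abs_mult by (rule mult_mono) (use th in auto)
    then have a2: "a\<^sup>2 \<le> (real N / (2 * pi) * R)\<^sup>2"
      by (metis abs_ge_zero power2_abs power_mono)
    have "real n \<le> 2 * \<bar>b\<bar>"
    proof -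
      have "1 * \<bar>of_int (int_decode n)\<bar> \<le> real N * \<bar>of_int (int_decode n)\<bar>"
        by (rule mult_right_mono) (use N in auto)
      then show ?thesis using int_decode_bound[of n] by (simp add: b_def abs_mult)
    qed
    then have "(real n)\<^sup>2 \<le> (2 * \<bar>b\<bar>)\<^sup>2" by (rule power_mono) simp
    then have n2: "1 + (real n)\<^sup>2 \<le> 4 * (1 + b\<^sup>2)" by (simp add: power_mult_distrib)
    have pos: "1 + (a + b)\<^sup>2 > 0" "1 + (real n)\<^sup>2 > 0" by (auto intro: add_pos_nonneg)
    have "C * (1 + (real n)\<^sup>2) \<le> C * (4 * (2 * (1 + a\<^sup>2) * (1 + (a + b)\<^sup>2)))"
      using n2 peetre[of b a] C(1) by (intro mult_left_mono) auto
    also have "\<dots> = 4 * (C * (2 * (1 + a\<^sup>2))) * (1 + (a + b)\<^sup>2)" by simp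
    also have "\<dots> \<le> K * (1 + (a + b)\<^sup>2)"
      unfolding K_def using a2 C(1) pos by (intro mult_right_mono mult_left_mono) auto
    finally have "C / (1 + (a + b)\<^sup>2) \<le> K / (1 + (real n)\<^sup>2)"
      using pos by (simp add: divide_simps)
    then show ?thesis using C(2)[of "a + b"] unfolding term_N_def x by linarith
  qed
  then show ?thesis using that by blast
qed

lemma summable_bound: "summable (\<lambda>n. K / (1 + (real n)\<^sup>2))"
proof (rule summable_comparison_test)
  have "summable (\<lambda>n. 1 / (real n)\<^sup>2)" using inverse_power_summable[of 2, where 'a = real] by (simp add: inverse_eq_divide)
  then show "summable (\<lambda>n. \<bar>K\<bar> * (1 / (real n)\<^sup>2))" by (rule summable_mult)
  show "\<exists>M. \<forall>n\<ge>M. norm (K / (1 + (real n)\<^sup>2)) \<le> \<bar>K\<bar> * (1 / (real n)\<^sup>2)"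
  proof (intro exI[of _ 1] allI impI)
    fix n :: nat assume "n \<ge> 1"
    then have "0 < (real n)\<^sup>2" by simp
    then have "\<bar>K\<bar> / (1 + (real n)\<^sup>2) \<le> \<bar>K\<bar> / (real n)\<^sup>2"
      by (intro divide_left_mono mult_pos_pos add_pos_nonneg) auto
    then show "norm (K / (1 + (real n)\<^sup>2)) \<le> \<bar>K\<bar> * (1 / (real n)\<^sup>2)" by simp
  qed
qed

lemma summable_term: "N \<ge> 1 \<Longrightarrow> summable (\<lambda>n. \<bar>term_N N n \<theta>\<bar>)"
proof -
  assume "N \<ge> 1"
  then obtain K where "\<And>n \<theta>'. \<bar>\<theta>'\<bar> \<le> \<bar>\<theta>\<bar> \<Longrightarrow> \<bar>term_N N n \<theta>'\<bar> \<le> K / (1 + (real n)\<^sup>2)" by (rule term_N_bound) blast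
  then show ?thesis by (intro summable_comparison_test[OF _ summable_bound[of K]]) auto
qed

lemma FN_suminf:
  assumes "N \<ge> 1"
  shows "FN f N \<theta> = (\<Sum>n. term_N N n \<theta>)"
proof -
  have "(\<lambda>n. term_N N n \<theta>) sums (\<Sum>n. term_N N n \<theta>)"
    by (rule summable_sums[OF summable_rabs_cancel[OF summable_term[OF assms]]])
  moreover have "summable (\<lambda>n. norm (term_N N n \<theta>))"
    unfolding real_norm_def by (rule summable_term[OF assms])
  ultimately have "((\<lambda>n. term_N N n \<theta>) has_sum (\<Sum>n. term_N N n \<theta>)) UNIV"
    by (rule norm_summable_imp_has_sum[rotated])
  then have "(\<Sum>\<^sub>\<infinity>n. term_N N n \<theta>) = (\<Sum>n. term_N N n \<theta>)" by (rule infsumI)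
  moreover have "FN f N \<theta> = (\<Sum>\<^sub>\<infinity>n. term_N N n \<theta>)"
    unfolding FN_def term_N_def by (rule infsum_reindex_bij_betw[OF bij_int_decode, symmetric])
  ultimately show ?thesis by (simp only:)
qed

lemma FN_cont:
  assumes "N \<ge> 1"
  shows "continuous_on UNIV (FN f N)"
proof -
  have "isCont (FN f N) \<theta>" for \<theta>
  proof -
    define R where "R = \<bar>\<theta>\<bar> + 1"
    obtain K where K: "\<And>n \<theta>'. \<bar>\<theta>'\<bar> \<le> R \<Longrightarrow> \<bar>term_N N n \<theta>'\<bar> \<le> K / (1 + (real n)\<^sup>2)"
      using term_N_bound[OF assms] by blast
    have "uniform_limit {- R..R} (\<lambda>n x. \<Sum>i<n. term_N N i x) (\<lambda>x. \<Sum>i. term_N N i x) sequentially"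
      by (rule Weierstrass_m_test[OF _ summable_bound[of K]]) (simp only: real_norm_def, rule K, auto)
    then have "continuous_on {- R..R} (\<lambda>x. \<Sum>i. term_N N i x)"
      by (rule uniform_limit_theorem[rotated])
         (auto simp: term_N_def intro!: always_eventually continuous_intros continuous_on_compose2[OF f_cont[of UNIV]])
    moreover have "\<theta> \<in> interior {- R..R}" by (auto simp: R_def interior_atLeastAtMost_real)
    moreover have "FN f N = (\<lambda>x. \<Sum>i. term_N N i x)"
      by (rule ext) (rule FN_suminf[OF assms])
    ultimately show ?thesis by (simp only: continuous_on_interior)
  qed
  then show ?thesis by (intro continuous_at_imp_continuous_on) auto
qed

lemma FN_periodic: "FN f N (\<theta> + 2 * pi) = FN f N \<theta>"
proof -
  have "bij (\<lambda>j :: int. j + 1)" by (rule bij_betw_byWitness[of _ "\<lambda>j. j - 1"]) auto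
  from infsum_reindex_bij_betw[OF this, of "\<lambda>j. f (real N / (2 * pi) * (\<theta> + 2 * pi * of_int j))"]
  show ?thesis by (simp add: FN_def algebra_simps)
qed

text \<open>Unfolding: the sets \<open>A n\<close> are translates of [-pi, pi) that tile the line,
  and the character has period 2 pi. So the integral of the periodized function over one period is
  that of a single copy over the line, which after rescaling is the transform.\<close>

lemma FN_coefficient:
  fixes k :: int
  assumes N: "N \<ge> 1"
  shows "integral {-pi..pi} (\<lambda>x. of_real (FN f N x) * cis (of_int k * x)) = of_real (2 * pi / real N * fh (of_int k / real N))"
proof -
  define A where "A n = {-pi + 2 * pi * of_int (int_decode n) ..< pi + 2 * pi * of_int (int_decode n)}" for n
  define u where "u x = complex_of_real (f (real N / (2 * pi) * x)) * cis (of_int k * x)" for x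
  have Npos: "real N / (2 * pi) > 0" using N by simp
  have u_int: "integrable lborel u"
  proof -
    have "integrable lborel (\<lambda>x. complex_of_real (f (0 + real N / (2 * pi) * x)) * cis ((of_int k * (2 * pi / real N)) * (0 + real N / (2 * pi) * x)))"
      by (rule lborel_integrable_real_affine[OF integrable_f_cis]) (use N in auto)
    then show ?thesis using N by (simp add: u_def[abs_def])
  qed
  have u_val: "(\<integral>x. u x \<partial>lborel) = of_real (2 * pi / real N * fh (of_int k / real N))"
  proof -
    let ?g = "\<lambda>x. complex_of_real (f x) * cis ((of_int k * (2 * pi / real N)) * x)"
    have "(\<integral>x. ?g x \<partial>lborel) = \<bar>real N / (2 * pi)\<bar> *\<^sub>R (\<integral>x. ?g (0 + real N / (2 * pi) * x) \<partial>lborel)"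
      by (rule lborel_integral_real_affine) (use N in auto)
    also have "(\<lambda>x. ?g (0 + real N / (2 * pi) * x)) = u" using N by (auto simp: u_def)
    also have "(\<integral>x. ?g x \<partial>lborel) = fourier f (- (of_int k / real N))"
      unfolding fourier_cis by (simp add: mult_ac)
    finally have "complex_of_real (fh (of_int k / real N)) = (real N / (2 * pi)) *\<^sub>R (\<integral>x. u x \<partial>lborel)"
      using Npos by (simp add: fourier_fh fh_minus)
    then show ?thesis using N by (simp add: scaleR_conv_of_real field_simps)
  qed
  have pi2_pos: "0 < 2 * pi" by simp
  have disj: "disjoint_family A"
    unfolding disjoint_family_on_def
  proof (intro ballI impI)
    fix m n :: nat assume "m \<noteq> n"
    then have ne: "int_decode m \<noteq> int_decode n" by (metis bij_int_decode bij_pointE)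
    show "A m \<inter> A n = {}"
    proof (rule ccontr)
      assume "A m \<inter> A n \<noteq> {}"
      then obtain x where x: "x \<in> A m" "x \<in> A n" by auto
      then have "2 * pi * of_int (int_decode m) < 2 * pi * of_int (int_decode n + 1)"
        "2 * pi * of_int (int_decode n) < 2 * pi * of_int (int_decode m + 1)"
        unfolding A_def of_int_add distrib_left by auto
      then have "int_decode m < int_decode n + 1" "int_decode n < int_decode m + 1"
        by (simp_all only: mult_less_cancel_left_pos[OF pi2_pos] of_int_less_iff)
      then show False using ne by linarith
    qed
  qed
  have cover: "(\<Union>n. A n) = UNIV"
  proof -
    have "\<exists>n. x \<in> A n" for x
    proof -
      define j where "j = \<lfloor>(x + pi) / (2 * pi)\<rfloor>"
      have "of_int j \<le> (x + pi) / (2 * pi)" "(x + pi) / (2 * pi) < of_int j + 1" by (auto simp: j_def)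
      then have "2 * pi * of_int j \<le> x + pi" "x + pi < 2 * pi * (of_int j + 1)"
        by (auto simp: field_simps)
      then have "x \<in> A (int_encode j)" by (auto simp: A_def algebra_simps)
      then show ?thesis ..
    qed
    then show ?thesis by auto
  qed
  have shift: "(\<integral>x\<in>A n. u x \<partial>lborel) = (\<integral>x\<in>{-pi..<pi}. of_real (term_N N n x) * cis (of_int k * x) \<partial>lborel)" for n
  proof -
    let ?j = "int_decode n"
    have "(\<integral>x\<in>A n. u x \<partial>lborel) = (\<integral>x. indicator (A n) (2 * pi * of_int ?j + 1 * x) *\<^sub>R u (2 * pi * of_int ?j + 1 * x) \<partial>lborel)"
      unfolding set_lebesgue_integral_def
      using lborel_integral_real_affine[of 1 "\<lambda>x. indicator (A n) x *\<^sub>R u x" "2 * pi * of_int ?j"] by simp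
    also have "\<dots> = (\<integral>x\<in>{-pi..<pi}. of_real (term_N N n x) * cis (of_int k * x) \<partial>lborel)"
      unfolding set_lebesgue_integral_def
    proof (intro Bochner_Integration.integral_cong refl)
      fix x
      have "cis (of_int k * (2 * pi * of_int ?j + x)) = cis (2 * pi * of_int (k * ?j)) * cis (of_int k * x)"
        by (simp add: cis_mult algebra_simps)
      also have "cis (2 * pi * of_int (k * ?j)) = 1"
        by (rule cis_multiple_2pi) simp
      finally have "u (2 * pi * of_int ?j + 1 * x) = of_real (term_N N n x) * cis (of_int k * x)"
        by (simp add: u_def term_N_def add.commute)
      then show "indicator (A n) (2 * pi * of_int ?j + 1 * x) *\<^sub>R u (2 * pi * of_int ?j + 1 * x) =
        indicator {-pi..<pi} x *\<^sub>R (of_real (term_N N n x) * cis (of_int k * x))"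
        by (auto simp: A_def indicator_def)
    qed
    finally show ?thesis .
  qed
  obtain K where K: "\<And>n x. \<bar>x\<bar> \<le> pi \<Longrightarrow> \<bar>term_N N n x\<bar> \<le> K / (1 + (real n)\<^sup>2)"
    using term_N_bound[OF N, of pi] by blast
  let ?g = "\<lambda>n x. indicator {-pi..<pi} x *\<^sub>R (of_real (term_N N n x) * cis (of_int k * x))"
  have g_bound: "norm (?g n x) \<le> indicator {-pi..<pi} x * (K / (1 + (real n)\<^sup>2))" for n x
    using K[of x n] by (auto simp: indicator_def norm_mult)
  have ind_int: "integrable lborel (\<lambda>x. indicator {-pi..<pi} x * c :: real)" for c
    by simp
  have g_meas: "?g n \<in> borel_measurable lborel" for n
    unfolding term_N_def cis_conv_exp by measurable
  have g_int: "integrable lborel (?g n)" for n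
    by (rule Bochner_Integration.integrable_bound[OF ind_int[of "K / (1 + (real n)\<^sup>2)"] g_meas])
       (intro AE_I2 order.trans[OF g_bound], simp only: real_norm_def abs_ge_self)
  have norm_int: "(\<integral>x. norm (?g n x) \<partial>lborel) \<le> 2 * pi * (K / (1 + (real n)\<^sup>2))" for n
  proof -
    have "(\<integral>x. norm (?g n x) \<partial>lborel) \<le> (\<integral>x. indicator {-pi..<pi} x * (K / (1 + (real n)\<^sup>2)) \<partial>lborel)"
      by (intro integral_mono integrable_norm g_int ind_int g_bound)
    then show ?thesis by simp
  qed
  have "(\<integral>x. (\<Sum>n. ?g n x) \<partial>lborel) = (\<Sum>n. \<integral>x. ?g n x \<partial>lborel)"
  proof (rule integral_suminf[OF g_int])
    show "AE x in lborel. summable (\<lambda>n. norm (?g n x))"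
    proof (intro AE_I2)
      fix x show "summable (\<lambda>n. norm (?g n x))"
        by (rule summable_comparison_test[OF _ summable_mult[OF summable_bound[of K], of "indicator {-pi..<pi} x"]])
           (use g_bound in auto)
    qed
    show "summable (\<lambda>n. \<integral>x. norm (?g n x) \<partial>lborel)"
      by (rule summable_comparison_test[OF _ summable_mult[OF summable_bound[of K], of "2 * pi"]])
         (use norm_int in auto)
  qed
  also have "\<dots> = (\<Sum>n. \<integral>x\<in>A n. u x \<partial>lborel)"
    unfolding shift by (simp add: set_lebesgue_integral_def)
  also have "\<dots> = (\<integral>x\<in>(\<Union>n. A n). u x \<partial>lborel)"
  proof (rule lebesgue_integral_countable_add[symmetric])
    show "A n \<in> sets lborel" for n by (simp add: A_def)
    show "A i \<inter> A j = {}" if "i \<noteq> j" for i j using disj that by (auto simp: disjoint_family_on_def)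
    show "set_integrable lborel (\<Union>n. A n) u" unfolding cover set_integrable_def using u_int by simp
  qed
  also have "\<dots> = (\<integral>x. u x \<partial>lborel)" by (simp add: cover set_lebesgue_integral_def)
  finally have 1: "(\<integral>x. (\<Sum>n. ?g n x) \<partial>lborel) = of_real (2 * pi / real N * fh (of_int k / real N))"
    by (simp only: u_val)
  have "(\<Sum>n. ?g n x) = indicator {-pi..<pi} x *\<^sub>R (of_real (FN f N x) * cis (of_int k * x))" for x
  proof -
    have "(\<lambda>n. term_N N n x) sums FN f N x"
      unfolding FN_suminf[OF N] using summable_term[OF N] by (intro summable_sums) (rule summable_rabs_cancel)
    then have "(\<lambda>n. indicator {-pi..<pi} x *\<^sub>R (complex_of_real (term_N N n x) * cis (of_int k * x))) sums
      (indicator {-pi..<pi} x *\<^sub>R (of_real (FN f N x) * cis (of_int k * x)))"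
      by (intro sums_scaleR_right sums_mult2 sums_of_real)
    then show ?thesis by (rule sums_unique[symmetric])
  qed
  then have "(\<integral>x. (\<Sum>n. ?g n x) \<partial>lborel) = (\<integral>x\<in>{-pi..<pi}. of_real (FN f N x) * cis (of_int k * x) \<partial>lborel)"
    by (simp add: set_lebesgue_integral_def)
  also have "\<dots> = (\<integral>x\<in>{-pi..pi}. of_real (FN f N x) * cis (of_int k * x) \<partial>lborel)"
    unfolding set_lebesgue_integral_def
  proof (rule integral_cong_AE)
    have FNm: "FN f N \<in> borel_measurable lborel" using borel_measurable_continuous_onI[OF FN_cont[OF N]] by simp
    show "(\<lambda>x. indicator {-pi..<pi} x *\<^sub>R (of_real (FN f N x) * cis (of_int k * x))) \<in> borel_measurable lborel"
      "(\<lambda>x. indicator {-pi..pi} x *\<^sub>R (of_real (FN f N x) * cis (of_int k * x))) \<in> borel_measurable lborel"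
      unfolding cis_conv_exp using FNm by measurable
    show "AE x in lborel. indicator {-pi..<pi} x *\<^sub>R (of_real (FN f N x) * cis (of_int k * x)) =
      indicator {-pi..pi} x *\<^sub>R (complex_of_real (FN f N x) * cis (of_int k * x))"
      using AE_lborel_singleton[of pi] by eventually_elim (auto simp: indicator_def)
  qed
  also have "\<dots> = integral {-pi..pi} (\<lambda>x. of_real (FN f N x) * cis (of_int k * x))"
  proof (rule set_borel_integral_eq_integral(2))
    show "set_integrable lborel {-pi..pi} (\<lambda>x. complex_of_real (FN f N x) * cis (of_int k * x))"
      unfolding cis_conv_exp
      by (intro borel_integrable_atLeastAtMost' continuous_intros continuous_on_subset[OF FN_cont[OF N]]) auto
  qed
  finally show ?thesis using 1 by simp
qed


lemma integral_cis:
  fixes m :: int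
  shows "integral {-pi..pi} (\<lambda>x. cis (of_int m * x)) = (if m = 0 then of_real (2 * pi) else 0)"
proof (cases "m = 0")
  case True
  then show ?thesis by (simp add: scaleR_conv_of_real)
next
  case False
  have "((\<lambda>x. cis (of_int m * x)) has_integral
      (cis (of_int m * pi) / (\<i> * of_int m) - cis (of_int m * (- pi)) / (\<i> * of_int m))) {-pi..pi}"
  proof (rule fundamental_theorem_of_calculus)
    fix x :: real
    have "((\<lambda>x. exp (\<i> * of_real (of_int m * x))) has_vector_derivative (\<i> * of_int m) * exp (\<i> * of_real (of_int m * x))) (at x within {-pi..pi})"
      by (auto intro!: derivative_eq_intros has_vector_derivative_real_field)
    then have "((\<lambda>x. exp (\<i> * of_real (of_int m * x)) / (\<i> * of_int m)) has_vector_derivative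
       ((\<i> * of_int m) * exp (\<i> * of_real (of_int m * x))) / (\<i> * of_int m)) (at x within {-pi..pi})"
      by (rule has_vector_derivative_divide)
    then show "((\<lambda>x. cis (of_int m * x) / (\<i> * of_int m)) has_vector_derivative cis (of_int m * x)) (at x within {-pi..pi})"
      using False by (simp add: cis_conv_exp)
  qed simp
  moreover have "cis (of_int m * pi) = cis (of_int m * (- pi))"
    by (auto simp: complex_eq_iff sin_zero_iff_int2)
  ultimately have "((\<lambda>x. cis (of_int m * x)) has_integral 0) {-pi..pi}" by simp
  then show ?thesis using False by (simp add: integral_unique)
qed

text \<open>Both sides are continuous, 2 pi-periodic and have the same Fourier coefficients. The
  support condition makes the right side a finite sum, and evenness pairs k with -k into a
  cosine.\<close>

lemma poisson:
  assumes N: "N \<ge> 1" and supp: "\<And>t. \<bar>t\<bar> > 1 \<Longrightarrow> fh t = 0" and \<theta>: "\<theta> \<in> {-pi..pi}"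
  shows "FN f N \<theta> = (fh 0 + 2 * (\<Sum>k=1..N. fh (real k / real N) * cos (real k * \<theta>))) / real N"
proof -
  define T where "T x = (fh 0 + 2 * (\<Sum>k=1..N. fh (real k / real N) * cos (real k * x))) / real N" for x
  define I where "I m = integral {-pi..pi} (\<lambda>x. cis (of_int m * x))" for m :: int
  have I: "I m = (if m = 0 then of_real (2 * pi) else 0)" for m
    unfolding I_def by (rule integral_cis)
  have T_cont: "continuous_on A T" for A
    unfolding T_def using N by (intro continuous_intros) auto
  have T_cis: "of_real (T x) * cis (of_int n * x) = (1 / of_nat N) * (of_real (fh 0) * cis (of_int n * x) +
      (\<Sum>k=1..N. of_real (fh (real k / real N)) * (cis (of_int (n + int k) * x) + cis (of_int (n - int k) * x))))"
    for n :: int and x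
  proof -
    have c: "2 * complex_of_real (cos (real k * x)) * cis (of_int n * x) = cis (of_int (n + int k) * x) + cis (of_int (n - int k) * x)" for k
    proof -
      have "2 * complex_of_real (cos (real k * x)) = cis (real k * x) + cis (- (real k * x))"
        by (simp add: complex_eq_iff)
      then show ?thesis by (simp add: distrib_right cis_mult algebra_simps)
    qed
    have "of_real (T x) * cis (of_int n * x) = (1 / of_nat N) * (of_real (fh 0) * cis (of_int n * x) +
      (\<Sum>k=1..N. of_real (fh (real k / real N)) * (2 * complex_of_real (cos (real k * x)) * cis (of_int n * x))))"
      unfolding T_def by (simp add: sum_distrib_left sum_distrib_right distrib_left distrib_right add_divide_distrib sum_divide_distrib mult_ac)
    then show ?thesis unfolding c .
  qed
  have cis_int: "(\<lambda>x. cis (of_int m * x)) integrable_on {-pi..pi}" for m :: int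
    unfolding cis_conv_exp by (intro integrable_continuous_interval continuous_intros)
  have T_coeff: "integral {-pi..pi} (\<lambda>x. of_real (T x) * cis (of_int n * x)) = of_real (2 * pi / real N * fh (of_int n / real N))" for n :: int
  proof -
    have "((\<lambda>x. of_real (T x) * cis (of_int n * x)) has_integral ((1 / of_nat N) * (of_real (fh 0) * I n +
      (\<Sum>k=1..N. of_real (fh (real k / real N)) * (I (n + int k) + I (n - int k)))))) {-pi..pi}"
      unfolding T_cis I_def
      by (intro has_integral_mult_right has_integral_add has_integral_sum integrable_integral cis_int) auto
    then have "integral {-pi..pi} (\<lambda>x. of_real (T x) * cis (of_int n * x)) = (1 / of_nat N) * (of_real (fh 0) * I n +
      (\<Sum>k=1..N. of_real (fh (real k / real N)) * (I (n + int k) + I (n - int k))))" by (rule integral_unique)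
    also have "of_real (fh 0) * I n + (\<Sum>k=1..N. of_real (fh (real k / real N)) * (I (n + int k) + I (n - int k)))
       = of_real (2 * pi * fh (of_int n / real N))"
    proof (cases "n = 0")
      case True
      then have "(\<Sum>k=1..N. of_real (fh (real k / real N)) * (I (n + int k) + I (n - int k))) = 0"
        by (intro sum.neutral) (auto simp: I)
      then show ?thesis using True by (simp add: I)
    next
      case False
      define j where "j = nat \<bar>n\<bar>"
      have "(\<Sum>k=1..N. of_real (fh (real k / real N)) * (I (n + int k) + I (n - int k))) =
        (\<Sum>k=1..N. if k = j then complex_of_real (2 * pi * fh (real j / real N)) else 0)"
      proof (intro sum.cong refl)
        fix k assume "k \<in> {1..N}"
        then show "of_real (fh (real k / real N)) * (I (n + int k) + I (n - int k)) =
          (if k = j then complex_of_real (2 * pi * fh (real j / real N)) else 0)"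
          using False unfolding I j_def by auto
      qed
      also have "\<dots> = (if j \<in> {1..N} then complex_of_real (2 * pi * fh (real j / real N)) else 0)"
        by simp
      also have "\<dots> = of_real (2 * pi * fh (real j / real N))"
      proof (cases "j \<in> {1..N}")
        \<comment> \<open>Frequencies beyond N do not occur in the sum; there j/N > 1 and the
          transform vanishes.\<close>
        case outside: False
        then have "real j / real N > 1" using False N by (auto simp: j_def)
        then show ?thesis using supp[of "real j / real N"] by auto
      qed simp
      also have "fh (real j / real N) = fh (of_int n / real N)"
        using fh_minus[of "of_int n / real N"] by (auto simp: j_def abs_if)
      finally show ?thesis using False by (simp add: I)
    qed
    finally show ?thesis by simp
  qed
  have cont: "continuous_on {-pi..pi} (\<lambda>x. complex_of_real (FN f N x) * cis (of_int n * x))"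
    "continuous_on {-pi..pi} (\<lambda>x. complex_of_real (T x) * cis (of_int n * x))" for n :: int
    unfolding cis_conv_exp
    by (intro continuous_intros T_cont continuous_on_subset[OF FN_cont[OF N]]; simp)+
  have "FN f N \<theta> - T \<theta> = 0"
  proof (rule fourier_coefficients_unique[OF _ _ _ \<theta>])
    show "continuous_on UNIV (\<lambda>x. FN f N x - T x)"
      by (intro continuous_on_diff FN_cont[OF N] T_cont)
    show "FN f N (x + 2 * pi) - T (x + 2 * pi) = FN f N x - T x" for x
    proof -
      have "cos (real k * (x + 2 * pi)) = cos (real k * x)" for k
      proof -
        have "cos (real k * x + 2 * pi * of_int (int k)) = cos (real k * x)"
          by (simp only: cos_add cos_int_2pin sin_int_2pin mult_zero_right mult_1_right diff_0_right)
        then show ?thesis by (simp add: algebra_simps)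
      qed
      then show ?thesis by (simp add: FN_periodic T_def)
    qed
    show "integral {-pi..pi} (\<lambda>x. of_real (FN f N x - T x) * cis (of_int n * x)) = 0" for n :: int
      using integral_diff[OF integrable_continuous_interval[OF cont(1)] integrable_continuous_interval[OF cont(2)], of n n]
      by (simp add: FN_coefficient[OF N] T_coeff left_diff_distrib)
  qed
  then show ?thesis by (simp add: T_def)
qed

end

section \<open>Moments of the linear statistic\<close>

text \<open>On G the conjugate transpose equals the adjoint for the form, and the latter preserves
  traces.\<close>

lemma (in haar_form) tr_pow_real:
  assumes U: "U \<in> G"
  shows "tr (to_mat N U ^\<^sub>m k) = of_real (Re (tr (to_mat N U ^\<^sub>m k)))"
proof -
  define A where "A = to_mat N U"
  have A: "A \<in> carrier_mat N N" by (simp add: A_def)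
  have "hadj A = fa A" by (rule unitary_inverse(2)[OF A]) (use unitary form U in \<open>auto simp: A_def\<close>)
  then have "hadj (A ^\<^sub>m k) = fa (A ^\<^sub>m k)"
  proof (induction k)
    case 0
    then show ?case using fa_one A by (auto simp: hadj_def fadj_def)
  next
    case (Suc k)
    then show ?case using A by (simp add: hadj_mult[of _ N] fa_mult)
  qed
  then have "tr (hadj (A ^\<^sub>m k)) = tr (A ^\<^sub>m k)"
    using tr_fa[of "A ^\<^sub>m k"] A by simp
  moreover have "tr (hadj (A ^\<^sub>m k)) = cnj (tr (A ^\<^sub>m k))"
    using A by (simp add: tr_def hadj_def)
  ultimately show ?thesis by (simp add: A_def complex_eq_iff)
qed

text \<open>Hides the form and the group, so that the analysis below is done once with \<epsilon> as
  a parameter.\<close>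

definition loop_measure :: "cmat measure \<Rightarrow> nat \<Rightarrow> real \<Rightarrow> bool" where
  "loop_measure M N \<epsilon> \<longleftrightarrow> (\<exists>\<tau> s G. haar_form M N \<tau> s \<epsilon> G \<and>
     (\<forall>i<N. \<forall>j<N. haar_form.null_dir M N (haar_form.Z N \<tau> s i j)))"

lemma loop_measure_SO: "is_haar N (SO N) M \<Longrightarrow> loop_measure M N 1"
  unfolding loop_measure_def using haar_form_SO null_dir_SO by blast

lemma loop_measure_Sp: "is_haar (2 * n) (Sp n) M \<Longrightarrow> loop_measure M (2 * n) (- 1)"
  unfolding loop_measure_def using haar_form_Sp null_dir_Sp by blast

context even_schwartz
begin

text \<open>Eigenvalues a have modulus 1, so cos(k Arg a) = Re (a^k); summing the Poisson formula
  over them gives the traces.\<close>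

lemma Zf_unitary:
  assumes N: "N \<ge> 1" and supp: "\<And>t. \<bar>t\<bar> > 1 \<Longrightarrow> fh t = 0"
    and U: "hadj (to_mat N U) * to_mat N U = 1\<^sub>m N"
  shows "Zf f N U = fh 0 + (\<Sum>k=1..N. (2 / real N * fh (real k / real N)) * Re (tr (to_mat N U ^\<^sub>m k)))"
proof -
  define A where "A = to_mat N U"
  obtain as where as: "length as = N" "char_poly A = (\<Prod>a\<leftarrow>as. [:- a, 1:])"
    "\<And>k. tr (A ^\<^sub>m k) = (\<Sum>a\<leftarrow>as. a ^ k)"
    using eigenvalue_list[of A N] by (auto simp: A_def)
  have FN: "FN f N (Arg a) = (fh 0 + 2 * (\<Sum>k=1..N. fh (real k / real N) * Re (a ^ k))) / real N"
    if "a \<in> set as" for a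
  proof -
    have "poly (char_poly A) a = 0"
      unfolding as(2) poly_prod_list using that by (auto simp: prod_list_zero_iff o_def)
    then have "cmod a = 1" using U by (intro unitary_eigenvalue[of A N]) (auto simp: A_def)
    then have a: "cis (Arg a) = a" by (cases "a = 0") (auto simp: cis_Arg sgn_eq)
    have "cos (real k * Arg a) = Re (a ^ k)" for k
      using Complex.DeMoivre[of "Arg a" k] by (simp add: a)
    moreover have "Arg a \<in> {-pi..pi}" using Arg_bounded[of a] by auto
    ultimately show ?thesis using poisson[OF N supp] by simp
  qed
  have Re_sum: "Re (\<Sum>a\<leftarrow>bs. g a) = (\<Sum>a\<leftarrow>bs. Re (g a))" for bs :: "complex list" and g
    by (induction bs) auto
  have lin: "(\<Sum>a\<leftarrow>bs. (fh 0 + 2 * (\<Sum>k=1..N. fh (real k / real N) * Re (a ^ k))) / real N) =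
      real (length bs) / real N * fh 0 + (\<Sum>k=1..N. (2 / real N * fh (real k / real N)) * (\<Sum>a\<leftarrow>bs. Re (a ^ k)))" for bs
    by (induction bs)
       (simp_all add: add_divide_distrib distrib_left distrib_right sum.distrib sum_distrib_left sum_divide_distrib mult_ac)
  have "Zf f N U = (\<Sum>a\<leftarrow>as. FN f N (Arg a))"
    unfolding Zf_root_sum charpoly_eq A_def[symmetric] as(2) by (rule root_sum_linear_factors)
  also have "\<dots> = (\<Sum>a\<leftarrow>as. (fh 0 + 2 * (\<Sum>k=1..N. fh (real k / real N) * Re (a ^ k))) / real N)"
    by (intro arg_cong[of _ _ sum_list] map_cong refl FN)
  also have "\<dots> = fh 0 + (\<Sum>k=1..N. (2 / real N * fh (real k / real N)) * Re (tr (A ^\<^sub>m k)))"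
    unfolding lin as(3) Re_sum using as(1) N by simp
  finally show ?thesis unfolding A_def .
qed

text \<open>The roots of a general matrix are arbitrary complex numbers. Off the origin FN(Arg z) is
  a polynomial expression Q in z/|z|, so only the origin obstructs continuity.\<close>

lemma Zf_measurable:
  assumes N: "N \<ge> 1" and supp: "\<And>t. \<bar>t\<bar> > 1 \<Longrightarrow> fh t = 0"
  shows "Zf f N \<in> borel_measurable (mat_space N)"
proof -
  define Q where "Q w = (fh 0 + 2 * (\<Sum>k=1..N. fh (real k / real N) * Re (w ^ k))) / real N" for w
  \<comment> \<open>Since \<open>Arg 0\<close> is 0, the limit at the origin has to be
    \<open>FN f N 0\<close>. The spike of height c corrects Q 0 to this value, and for fixed z
    \<noteq> 0 it is eventually zero; the cut-off denominator is then eventually |z|.\<close>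
  define c where "c = FN f N 0 - Q 0"
  define \<psi> where "\<psi> n z = Q (z / of_real (max (cmod z) (1 / real (Suc n)))) + c * max 0 (1 - real (Suc n) * cmod z)" for n z
  have cont: "continuous_on UNIV (\<psi> n)" for n
    unfolding \<psi>_def Q_def using N by (intro continuous_intros) (auto simp: max_def)
  have lim: "(\<lambda>n. \<psi> n z) \<longlonglongrightarrow> FN f N (Arg z)" for z
  proof (cases "z = 0")
    case True
    then show ?thesis by (simp add: \<psi>_def c_def Arg_zero)
  next
    case False
    have "cis (Arg z) = z / of_real (cmod z)"
      using False by (simp add: cis_Arg sgn_eq)
    then have "cos (real k * Arg z) = Re ((z / of_real (cmod z)) ^ k)" for k
      using Complex.DeMoivre[of "Arg z" k] by simp
    moreover have "Arg z \<in> {-pi..pi}" using Arg_bounded[of z] by auto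
    ultimately have Q: "FN f N (Arg z) = Q (z / of_real (cmod z))"
      unfolding Q_def using poisson[OF N supp] by simp
    obtain n0 where n0: "1 / real (Suc n0) < cmod z"
      using False reals_Archimedean[of "cmod z"] by (auto simp: inverse_eq_divide)
    have "\<psi> n z = FN f N (Arg z)" if "n \<ge> n0" for n
    proof -
      have "1 / real (Suc n) \<le> 1 / real (Suc n0)" using that by (simp add: frac_le)
      then have "1 / real (Suc n) < cmod z" using n0 by simp
      moreover from this have "1 - real (Suc n) * cmod z < 0"
        by (simp add: pos_divide_less_eq mult.commute del: of_nat_Suc)
      ultimately show ?thesis by (simp add: \<psi>_def Q max_def)
    qed
    then show ?thesis
      by (intro tendsto_eventually) (auto simp: eventually_sequentially)
  qed
  show ?thesis
    using root_sum_measurable_LIMSEQ[OF cont lim, of N] unfolding Zf_root_sum[symmetric] .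
qed

text \<open>Closes the support condition at its end point by continuity from the right.\<close>

lemma fh_boundary:
  assumes "\<And>t. t > r \<Longrightarrow> fh t = 0"
  shows "fh r = 0"
proof -
  have "isCont fh r" using fh_cont[of UNIV] by (simp add: continuous_on_eq_continuous_at)
  moreover have "(\<lambda>n. r + 1 / real (Suc n)) \<longlonglongrightarrow> r + 0"
    by (intro tendsto_intros) (use LIMSEQ_inverse_real_of_nat in \<open>simp add: inverse_eq_divide\<close>)
  ultimately have "(\<lambda>n. fh (r + 1 / real (Suc n))) \<longlonglongrightarrow> fh r"
    by (intro isCont_tendsto_compose[of r fh]) auto
  moreover have "fh (r + 1 / real (Suc n)) = 0" for n
    by (rule assms) (simp del: of_nat_Suc)
  ultimately show ?thesis by (simp add: LIMSEQ_const_iff)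
qed

definition cf :: "nat \<Rightarrow> nat \<Rightarrow> real" where "cf N j = 2 / real N * fh (real j / real N)"

definition mean_N :: "real \<Rightarrow> nat \<Rightarrow> real" where
  "mean_N \<epsilon> N = fh 0 + \<epsilon> * (\<Sum>j=1..N. of_bool (even j) * cf N j)"

definition var_N :: "nat \<Rightarrow> real" where
  "var_N N = (\<Sum>j=1..N. real j * (cf N j)\<^sup>2)"

text \<open>If N \<le> k j with k \<le> m, then j/N \<ge> 1/m and the coefficient of tr U^j is zero;
  the end point is included in \<open>supp\<close> for the case of equality. The remaining indices
  satisfy k j < N, as \<open>lin_pow_gauss\<close> demands.\<close>

lemma moment_exact:
  assumes H: "loop_measure M N \<epsilon>"
    and N: "N \<ge> 1" and k: "1 \<le> k" "k \<le> m" and supp: "\<And>t. \<bar>t\<bar> \<ge> 1 / real m \<Longrightarrow> fh t = 0"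
  shows "(\<integral>U. (Zf f N U) ^ k \<partial>M) = gauss_moment (mean_N \<epsilon> N) (var_N N) k"
proof -
  obtain \<tau> s G where G: "haar_form M N \<tau> s \<epsilon> G"
    and null: "\<And>i j. i < N \<Longrightarrow> j < N \<Longrightarrow> haar_form.null_dir M N (haar_form.Z N \<tau> s i j)"
    using H unfolding loop_measure_def by blast
  interpret haar_form M N \<tau> s \<epsilon> G by (rule G)
  have supp1: "fh t = 0" if "\<bar>t\<bar> > 1" for t
  proof (rule supp)
    have "1 / real m \<le> 1" using k by simp
    then show "1 / real m \<le> \<bar>t\<bar>" using that by linarith
  qed
  define J where "J = {j \<in> {1..N}. k * j < N}"
  have cf0: "cf N j = 0" if "j \<in> {1..N} - J" for j
  proof -
    have "N \<le> k * j" using that by (auto simp: J_def)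
    also have "k * j \<le> m * j" using k by simp
    finally have "N \<le> m * j" .
    then have "real N \<le> real m * real j" by (metis of_nat_le_iff of_nat_mult)
    then have "1 / real m \<le> real j / real N" using N k by (simp add: field_simps)
    then show ?thesis by (simp add: cf_def supp)
  qed
  have sumJ: "(\<Sum>j=1..N. g j) = (\<Sum>j\<in>J. g j)" if "\<And>j. cf N j = 0 \<Longrightarrow> g j = 0" for g :: "nat \<Rightarrow> real"
    by (rule sum.mono_neutral_right) (use cf0 that in \<open>auto simp: J_def\<close>)
  have Zf: "complex_of_real (Zf f N U) = of_real (fh 0) + (\<Sum>j\<in>J. of_real (cf N j) * tr (to_mat N U ^\<^sub>m j))" if "U \<in> G" for U
  proof -
    have "Zf f N U = fh 0 + (\<Sum>j=1..N. cf N j * Re (tr (to_mat N U ^\<^sub>m j)))"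
      unfolding cf_def by (rule Zf_unitary[OF N supp1 unitary[OF that]])
    also have "(\<Sum>j=1..N. cf N j * Re (tr (to_mat N U ^\<^sub>m j))) = (\<Sum>j\<in>J. cf N j * Re (tr (to_mat N U ^\<^sub>m j)))"
      by (rule sumJ) simp
    finally have "Zf f N U = fh 0 + (\<Sum>j\<in>J. cf N j * Re (tr (to_mat N U ^\<^sub>m j)))" .
    then show ?thesis using tr_pow_real[OF that] by simp
  qed
  have meas: "Zf f N \<in> borel_measurable M"
    using Zf_measurable[OF N supp1] by (simp add: measurable_cong_sets[OF sets_M refl])
  have "complex_of_real (\<integral>U. (Zf f N U) ^ k \<partial>M) = (\<integral>U. complex_of_real ((Zf f N U) ^ k) \<partial>M)"
    by (rule integral_complex_of_real[symmetric])
  also have "\<dots> = (\<integral>U. (of_real (fh 0) + (\<Sum>j\<in>J. of_real (cf N j) * tr (to_mat N U ^\<^sub>m j))) ^ k \<partial>M)"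
  proof (rule integral_cong_AE)
    show "(\<lambda>U. complex_of_real ((Zf f N U) ^ k)) \<in> borel_measurable M" using meas by measurable
    show "(\<lambda>U. (of_real (fh 0) + (\<Sum>j\<in>J. of_real (cf N j) * tr (to_mat N U ^\<^sub>m j))) ^ k) \<in> borel_measurable M"
      using nice_lin by (simp add: nice_def)
    show "AE U in M. complex_of_real ((Zf f N U) ^ k) =
      (of_real (fh 0) + (\<Sum>j\<in>J. of_real (cf N j) * tr (to_mat N U ^\<^sub>m j))) ^ k"
      using AE_G by eventually_elim (simp only: of_real_power Zf)
  qed
  finally have "(\<integral>U. (Zf f N U) ^ k \<partial>M) =
     Re (\<integral>U. (of_real (fh 0) + (\<Sum>j\<in>J. of_real (cf N j) * tr (to_mat N U ^\<^sub>m j))) ^ k \<partial>M)"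
    by (metis Re_complex_of_real)
  also have "\<dots> = gauss_moment (fh 0 + \<epsilon> * (\<Sum>j\<in>J. of_bool (even j) * cf N j)) (\<Sum>j\<in>J. real j * (cf N j)\<^sup>2) k"
    by (rule lin_pow_gauss) (use null N in \<open>auto simp: J_def\<close>)
  also have "(\<Sum>j\<in>J. of_bool (even j) * cf N j) = (\<Sum>j=1..N. of_bool (even j) * cf N j)"
    by (rule sumJ[symmetric]) simp
  also have "(\<Sum>j\<in>J. real j * (cf N j)\<^sup>2) = (\<Sum>j=1..N. real j * (cf N j)\<^sup>2)"
    by (rule sumJ[symmetric]) simp
  finally show ?thesis by (simp only: mean_N_def var_N_def)
qed

end

section \<open>Riemann sums and passage to the limit\<close>

lemma riemann_sum_LIMSEQ:
  fixes g :: "real \<Rightarrow> real"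
  assumes c: "c > 0" and g: "continuous_on {0..c} g"
  shows "(\<lambda>N. \<Sum>i=1..N. c / real N * g (real i * c / real N)) \<longlonglongrightarrow> integral {0..c} g"
proof (rule LIMSEQ_I)
  fix e :: real assume "e > 0"
  \<comment> \<open>N pieces of length c/N, each with error at most \<open>e' * (c / N)\<close>, add
    up to e/2.\<close>
  define e' where "e' = e / (2 * c)"
  have e': "e' > 0" using \<open>e > 0\<close> c by (simp add: e'_def)
  have "uniformly_continuous_on {0..c} g" using g by (intro compact_uniformly_continuous) auto
  then obtain d where d: "d > 0" "\<And>x y. x \<in> {0..c} \<Longrightarrow> y \<in> {0..c} \<Longrightarrow> dist y x < d \<Longrightarrow> dist (g y) (g x) < e'"
    using e' unfolding uniformly_continuous_on_def by metis
  obtain n0 where n0: "c / d < real n0" using reals_Archimedean2 by blast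
  show "\<exists>no. \<forall>N\<ge>no. norm ((\<Sum>i=1..N. c / real N * g (real i * c / real N)) - integral {0..c} g) < e"
  proof (intro exI allI impI)
    fix N assume N: "N \<ge> Suc n0"
    then have Npos: "real N > 0" by simp
    have "c / d < real N" using n0 N by linarith
    then have h: "c / real N < d" using d c Npos by (simp add: field_simps)
    define x where "x i = real i * c / real N" for i
    have x_step: "x (Suc i) - x i = c / real N" for i by (simp add: x_def diff_divide_distrib[symmetric] algebra_simps)
    have x_mono: "x i \<le> x (Suc i)" for i using x_step[of i] c Npos by (smt (verit) divide_pos_pos)
    have x0: "x 0 = 0" and xN: "x N = c" using Npos by (auto simp: x_def)
    have x_in: "0 \<le> x i" "i \<le> N \<Longrightarrow> x i \<le> c" for i
      using c Npos by (auto simp: x_def divide_le_eq mult_mono' mult.commute)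
    define \<Phi> where "\<Phi> t = integral {0..t} g" for t
    have gi: "g integrable_on {a..b}" if "0 \<le> a" "b \<le> c" for a b
      using that by (intro integrable_continuous_interval continuous_on_subset[OF g]) auto
    have piece: "\<bar>c / real N * g (x (Suc i)) - (\<Phi> (x (Suc i)) - \<Phi> (x i))\<bar> \<le> e' * (c / real N)" if i: "i < N" for i
    proof -
      have "\<Phi> (x (Suc i)) = \<Phi> (x i) + integral {x i..x (Suc i)} g"
        unfolding \<Phi>_def using x_in x_mono i
        by (intro Henstock_Kurzweil_Integration.integral_combine[symmetric] gi) auto
      moreover have "integral {x i..x (Suc i)} (\<lambda>_. g (x (Suc i))) = c / real N * g (x (Suc i))"
        using x_mono[of i] by (simp add: x_step)
      moreover have "integral {x i..x (Suc i)} (\<lambda>t. g t - g (x (Suc i))) =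
          integral {x i..x (Suc i)} g - integral {x i..x (Suc i)} (\<lambda>_. g (x (Suc i)))"
        using x_in i by (intro integral_diff gi) auto
      moreover have "norm (integral {x i..x (Suc i)} (\<lambda>t. g t - g (x (Suc i)))) \<le> e' * (x (Suc i) - x i)"
      proof (rule integral_bound[OF x_mono])
        show "continuous_on {x i..x (Suc i)} (\<lambda>t. g t - g (x (Suc i)))"
          using x_in(1)[of i] x_in(2)[of "Suc i"] i by (intro continuous_intros continuous_on_subset[OF g]) auto
        fix t assume t: "t \<in> {x i..x (Suc i)}"
        have "dist t (x (Suc i)) < d" using t x_step[of i] h by (auto simp: dist_real_def)
        then have "dist (g t) (g (x (Suc i))) < e'"
          using t x_in(1)[of i] x_in(1)[of "Suc i"] x_in(2)[of "Suc i"] i by (intro d) auto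
        then show "norm (g t - g (x (Suc i))) \<le> e'" by (simp add: dist_norm)
      qed
      ultimately show ?thesis by (simp add: x_step abs_minus_commute)
    qed
    have "(\<Sum>i=1..N. c / real N * g (real i * c / real N)) = (\<Sum>i<N. c / real N * g (x (Suc i)))"
      unfolding x_def by (rule sum.reindex_bij_witness[of _ Suc "\<lambda>i. i - 1"]) auto
    moreover have "integral {0..c} g = (\<Sum>i<N. \<Phi> (x (Suc i)) - \<Phi> (x i))"
      using sum_lessThan_telescope[of "\<lambda>i. \<Phi> (x i)" N] by (simp add: \<Phi>_def x0 xN)
    ultimately have "\<bar>(\<Sum>i=1..N. c / real N * g (real i * c / real N)) - integral {0..c} g\<bar> =
        \<bar>\<Sum>i<N. c / real N * g (x (Suc i)) - (\<Phi> (x (Suc i)) - \<Phi> (x i))\<bar>"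
      by (simp only: sum_subtractf)
    also have "\<dots> \<le> (\<Sum>i<N. e' * (c / real N))"
      by (intro order.trans[OF sum_abs] sum_mono piece) auto
    also have "\<dots> = e / 2" using Npos c by (simp add: e'_def)
    also have "\<dots> < e" using \<open>e > 0\<close> by simp
    finally show "norm ((\<Sum>i=1..N. c / real N * g (real i * c / real N)) - integral {0..c} g) < e" by simp
  qed
qed

context even_schwartz
begin

text \<open>The even indices j = 2 i sample the transform with step 2/N, so with the weight 2/N they
  form a Riemann sum over [0, 2]; the support reduces its integral to [0, 1].\<close>

lemma mean_N_LIMSEQ:
  assumes supp: "\<And>t. \<bar>t\<bar> \<ge> 1 \<Longrightarrow> fh t = 0"
  shows "mean_N \<epsilon> \<longlonglongrightarrow> fh 0 + \<epsilon> * integral {0..1} fh"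
proof -
  have int2: "integral {0..2} fh = integral {0..1} fh"
  proof -
    have "integral {0..1} fh + integral {1..2} fh = integral {0..2} fh"
      by (rule Henstock_Kurzweil_Integration.integral_combine) (auto intro!: integrable_continuous_interval fh_cont)
    moreover have "integral {1..2} fh = 0"
      by (rule integral_unique[OF has_integral_is_0]) (simp add: supp)
    ultimately show ?thesis by simp
  qed
  have "(\<Sum>j=1..N. of_bool (even j) * cf N j) = (\<Sum>i=1..N. 2 / real N * fh (real i * 2 / real N))" for N
  proof -
    have "(\<Sum>j=1..N. of_bool (even j) * cf N j) = (\<Sum>j | j \<in> {1..N} \<and> even j. cf N j)"
      by (rule sum.mono_neutral_cong_right) auto
    also have "\<dots> = (\<Sum>i | i \<in> {1..N} \<and> 2 * i \<le> N. cf N (2 * i))"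
      by (rule sum.reindex_bij_witness[of _ "\<lambda>i. 2 * i" "\<lambda>j. j div 2"]) auto
    \<comment> \<open>Indices with 2 i > N sample beyond 1 and contribute nothing, so the sum may
      run over the whole grid of [0, 2].\<close>
    also have "\<dots> = (\<Sum>i=1..N. 2 / real N * fh (real i * 2 / real N))"
    proof (rule sum.mono_neutral_cong_left)
      show "\<forall>i\<in>{1..N} - {i. i \<in> {1..N} \<and> 2 * i \<le> N}. 2 / real N * fh (real i * 2 / real N) = 0"
      proof
        fix i assume "i \<in> {1..N} - {i. i \<in> {1..N} \<and> 2 * i \<le> N}"
        then have "real N \<le> real i * 2" "real N > 0" by auto
        then have "real i * 2 / real N \<ge> 1" by (simp add: field_simps)
        then show "2 / real N * fh (real i * 2 / real N) = 0" by (simp add: supp)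
      qed
    qed (auto simp: cf_def mult.commute)
    finally show ?thesis .
  qed
  moreover have "(\<lambda>N. \<Sum>i=1..N. 2 / real N * fh (real i * 2 / real N)) \<longlonglongrightarrow> integral {0..1} fh"
    using riemann_sum_LIMSEQ[of 2 fh] fh_cont int2 by simp
  ultimately show ?thesis
    unfolding mean_N_def by (intro tendsto_intros) simp
qed

text \<open>Here j (2/N)^2 = 4 (1/N) (j/N), which exhibits a Riemann sum for u times the squared
  transform.\<close>

lemma var_N_LIMSEQ: "var_N \<longlonglongrightarrow> 4 * integral {0..1} (\<lambda>u. u * (fh u)\<^sup>2)"
proof -
  have "var_N N = 4 * (\<Sum>i=1..N. 1 / real N * ((real i * 1 / real N) * (fh (real i * 1 / real N))\<^sup>2))" for N
    unfolding var_N_def cf_def sum_distrib_left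
    by (intro sum.cong refl) (simp add: power2_eq_square)
  then have "var_N = (\<lambda>N. 4 * (\<Sum>i=1..N. 1 / real N * ((real i * 1 / real N) * (fh (real i * 1 / real N))\<^sup>2)))"
    by (rule ext)
  moreover have "(\<lambda>N. \<Sum>i=1..N. 1 / real N * ((real i * 1 / real N) * (fh (real i * 1 / real N))\<^sup>2))
    \<longlonglongrightarrow> integral {0..1} (\<lambda>u. u * (fh u)\<^sup>2)"
    by (rule riemann_sum_LIMSEQ) (auto intro!: continuous_intros fh_cont)
  ultimately show ?thesis
    by (simp only:) (intro tendsto_intros)
qed

text \<open>With the support inside [-1/2, 1/2], the cut at 1/2 loses nothing; evenness doubles the
  integral over the positive half.\<close>

lemma variance_integral:
  assumes supp: "\<And>t. \<bar>t\<bar> \<ge> 1 / 2 \<Longrightarrow> fh t = 0"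
  shows "2 * integral {-1/2..1/2} (\<lambda>u. \<bar>u\<bar> * (fh u)\<^sup>2) = 4 * integral {0..1} (\<lambda>u. u * (fh u)\<^sup>2)"
proof -
  let ?g = "\<lambda>u. \<bar>u\<bar> * (fh u)\<^sup>2"
  have gi: "?g integrable_on {a..b}" for a b
    by (intro integrable_continuous_interval continuous_intros fh_cont)
  have "integral {-1/2..0} ?g + integral {0..1/2} ?g = integral {-1/2..1/2} ?g"
    by (rule Henstock_Kurzweil_Integration.integral_combine) (auto intro: gi)
  moreover have "integral {-1/2..0} ?g = integral {0..1/2} ?g"
    using Henstock_Kurzweil_Integration.integral_reflect_real[of "1/2" 0 ?g] by (simp add: fh_minus)
  moreover have "integral {0..1/2} ?g + integral {1/2..1} ?g = integral {0..1} ?g"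
    by (rule Henstock_Kurzweil_Integration.integral_combine) (auto intro: gi)
  moreover have "integral {1/2..1} ?g = 0"
    by (rule integral_unique[OF has_integral_is_0]) (simp add: supp)
  moreover have "integral {0..1} ?g = integral {0..1} (\<lambda>u. u * (fh u)\<^sup>2)"
    by (rule Henstock_Kurzweil_Integration.integral_cong) simp
  ultimately show ?thesis by simp
qed

text \<open>The sizes are a sequence \<open>N n\<close> so that N = 2 n for the symplectic group and
  N = n for the orthogonal one are both covered.\<close>

lemma moments_LIMSEQ:
  assumes m: "1 \<le> m" and k: "k \<in> {1..m}" and supp: "fsupp (fourier f) \<subseteq> {-1 / real m..1 / real m}"
    and N: "filterlim N at_top sequentially"
    and M: "\<And>n. N n \<ge> 1 \<Longrightarrow> loop_measure (M n) (N n) \<epsilon>"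
  shows "(\<lambda>n. \<integral>U. (Zf f (N n) U) ^ k \<partial>(M n)) \<longlonglongrightarrow>
    gauss_moment (fh 0 + \<epsilon> * integral {0..1} fh) (2 * integral {-1/2..1/2} (\<lambda>u. \<bar>u\<bar> * (fh u)\<^sup>2)) k"
proof -
  have out: "fh t = 0" if "\<bar>t\<bar> > 1 / real m" for t
    using fh_zero[OF supp, of t] that by (auto simp: abs_if split: if_splits)
  have zero: "fh t = 0" if "\<bar>t\<bar> \<ge> 1 / real m" for t
  proof (cases "\<bar>t\<bar> = 1 / real m")
    case True
    have "fh (1 / real m) = 0" by (rule fh_boundary) (use out in auto)
    then show ?thesis using True fh_minus[of t] by (cases "t \<ge> 0") auto
  qed (use out that in auto)
  have supp1: "fh t = 0" if "\<bar>t\<bar> \<ge> 1" for t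
  proof (rule zero)
    have "1 / real m \<le> 1" using m by simp
    then show "1 / real m \<le> \<bar>t\<bar>" using that by linarith
  qed
  have mean: "(\<lambda>n. mean_N \<epsilon> (N n)) \<longlonglongrightarrow> fh 0 + \<epsilon> * integral {0..1} fh"
    by (rule filterlim_compose[OF mean_N_LIMSEQ[OF supp1] N])
  have "(\<lambda>n. gauss_moment (mean_N \<epsilon> (N n)) (var_N (N n)) k) \<longlonglongrightarrow>
    gauss_moment (fh 0 + \<epsilon> * integral {0..1} fh) (2 * integral {-1/2..1/2} (\<lambda>u. \<bar>u\<bar> * (fh u)\<^sup>2)) k"
  \<comment> \<open>A moment of order k \<ge> 2 forces m \<ge> 2, and then the support lies in
    [-1/2, 1/2], where the stated variance is the limit of \<open>var_N\<close>. The first moment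
    involves the mean alone.\<close>
  proof (cases "k = 1")
    case True
    then show ?thesis using mean by simp
  next
    case False
    then have "m \<ge> 2" using k by auto
    then have "1 / real m \<le> 1 / 2" by (simp add: field_simps)
    then have eq: "2 * integral {-1/2..1/2} (\<lambda>u. \<bar>u\<bar> * (fh u)\<^sup>2) = 4 * integral {0..1} (\<lambda>u. u * (fh u)\<^sup>2)"
      by (intro variance_integral zero) linarith
    have "integral {0..1} (\<lambda>u. u * (fh u)\<^sup>2) \<ge> 0"
      by (rule integral_nonneg) (auto intro!: integrable_continuous_interval continuous_intros fh_cont)
    then show ?thesis
      unfolding eq
      by (intro tendsto_gauss_moment mean filterlim_compose[OF var_N_LIMSEQ N])
         (auto simp: var_N_def intro!: sum_nonneg)
  qed
  moreover have "eventually (\<lambda>n. gauss_moment (mean_N \<epsilon> (N n)) (var_N (N n)) k = (\<integral>U. (Zf f (N n) U) ^ k \<partial>(M n))) sequentially"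
    using filterlim_at_top[THEN iffD1, OF N, rule_format, of 1]
    by eventually_elim (rule moment_exact[symmetric], use M k zero in auto)
  ultimately show ?thesis by (rule Lim_transform_eventually)
qed

end

theorem theorem2:
  fixes f :: "real \<Rightarrow> real" and m :: nat
  assumes "schwartz f" and "\<forall>x. f (- x) = f x" and "m \<ge> 1"
  defines "fh \<equiv> (\<lambda>t. Re (fourier f t))"
  defines "var \<equiv> 2 * integral {-1/2..1/2} (\<lambda>u. \<bar>u\<bar> * (fh u)\<^sup>2)"
  shows
    "(fsupp (fourier f) \<subseteq> {-1 / real m .. 1 / real m} \<longrightarrow>
       (\<forall>\<mu> :: nat \<Rightarrow> cmat measure. (\<forall>n\<ge>1. is_haar (2*n) (Sp n) (\<mu> n)) \<longrightarrow>
          (\<forall>k\<in>{1..m}. (\<lambda>n. \<integral>U. (Zf f (2*n) U) ^ k \<partial>(\<mu> n))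
              \<longlonglongrightarrow> gauss_moment (fh 0 - integral {0..1} fh) var k)))
     \<and>
     (fsupp (fourier f) \<subseteq> {-1 / real m <..< 1 / real m} \<longrightarrow>
       (\<forall>\<mu> :: nat \<Rightarrow> cmat measure. (\<forall>N\<ge>1. is_haar N (SO N) (\<mu> N)) \<longrightarrow>
          (\<forall>k\<in>{1..m}. (\<lambda>N. \<integral>U. (Zf f N U) ^ k \<partial>(\<mu> N))
              \<longlonglongrightarrow> gauss_moment (fh 0 + integral {0..1} fh) var k)))"
proof -
  interpret ES: even_schwartz f by standard (use assms in auto)
  have fh_eq: "fh = even_schwartz.fh f"
    by (rule ext) (simp add: fh_def ES.fh_def)
  show ?thesis
  proof (intro conjI impI allI ballI)
    fix \<mu> :: "nat \<Rightarrow> cmat measure" and k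
    assume supp: "fsupp (fourier f) \<subseteq> {-1 / real m .. 1 / real m}"
      and haar: "\<forall>n\<ge>1. is_haar (2*n) (Sp n) (\<mu> n)" and k: "k \<in> {1..m}"
    have "filterlim (\<lambda>n :: nat. 2 * n) at_top sequentially"
      by (rule filterlim_subseq) (simp add: strict_mono_def)
    then have "(\<lambda>n. \<integral>U. (Zf f (2*n) U) ^ k \<partial>(\<mu> n)) \<longlonglongrightarrow>
      gauss_moment (ES.fh 0 + (- 1) * integral {0..1} ES.fh) (2 * integral {-1/2..1/2} (\<lambda>u. \<bar>u\<bar> * (ES.fh u)\<^sup>2)) k"
      by (rule ES.moments_LIMSEQ[OF assms(3) k supp]) (rule loop_measure_Sp, use haar in auto)
    then show "(\<lambda>n. \<integral>U. (Zf f (2*n) U) ^ k \<partial>(\<mu> n)) \<longlonglongrightarrow> gauss_moment (fh 0 - integral {0..1} fh) var k"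
      unfolding var_def fh_eq by simp
  next
    fix \<mu> :: "nat \<Rightarrow> cmat measure" and k
    assume supp: "fsupp (fourier f) \<subseteq> {-1 / real m <..< 1 / real m}"
      and haar: "\<forall>N\<ge>1. is_haar N (SO N) (\<mu> N)" and k: "k \<in> {1..m}"
    have "fsupp (fourier f) \<subseteq> {-1 / real m .. 1 / real m}" using supp by auto
    then have "(\<lambda>N. \<integral>U. (Zf f N U) ^ k \<partial>(\<mu> N)) \<longlonglongrightarrow>
      gauss_moment (ES.fh 0 + 1 * integral {0..1} ES.fh) (2 * integral {-1/2..1/2} (\<lambda>u. \<bar>u\<bar> * (ES.fh u)\<^sup>2)) k"
      by (rule ES.moments_LIMSEQ[OF assms(3) k _ filterlim_ident]) (rule loop_measure_SO, use haar in auto)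
    then show "(\<lambda>N. \<integral>U. (Zf f N U) ^ k \<partial>(\<mu> N)) \<longlonglongrightarrow> gauss_moment (fh 0 + integral {0..1} fh) var k"
      unfolding var_def fh_eq by simp
  qed
qed

end
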